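(* For every integer $d \geq 2$, the set of pairs $(f,g)\in \mathrm{Rat}_d\times\mathrm{Rat}_d$ sharing at least $4d-1$ distinct preperiodic points (that is, with $|\mathrm{Preper}(f)\cap\mathrm{Preper}(g)|\geq 4d-1$) is Zariski dense in $\mathrm{Rat}_d \times \mathrm{Rat}_d$.
   Context: $\mathrm{Rat}_d$ denotes the space of all holomorphic maps $f:\mathbb{P}^1\to\mathbb{P}^1$ of degree $d$ over $\mathbb{C}$, identified via coefficients with a Zariski-open subset of $\mathbb{P}^{2d+1}$. $\mathrm{Preper}(f)$ denotes the set of preperiodic points of $f$ in $\mathbb{P}^1(\mathbb{C})$. *)

theory Defs
  imports "HOL-Analysis.Analysis" "HOL-Library.Poly_Mapping"
begin

section \<open>Complex projective space\<close>

text \<open>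
  Vectors of \<open>\<complex>\<^sup>n\<^sup>+\<^sup>1\<close> are functions on \<^typ>\<open>nat\<close> that vanish above index \<open>n\<close>; this allows
  the dimension to depend on the degree \<open>d\<close>. A point of projective space is the set of all its
  homogeneous coordinate vectors.
\<close>

definition hcoords :: "nat \<Rightarrow> (nat \<Rightarrow> complex) set" where
  "hcoords n = {v. (\<forall>i>n. v i = 0) \<and> v \<noteq> (\<lambda>_. 0)}"

definition proportional :: "nat \<Rightarrow> ((nat \<Rightarrow> complex) \<times> (nat \<Rightarrow> complex)) set" where
  "proportional n = {(v, w). v \<in> hcoords n \<and> w \<in> hcoords n \<and> (\<exists>c. c \<noteq> 0 \<and> w = (\<lambda>i. c * v i))}"

definition proj_space :: "nat \<Rightarrow> (nat \<Rightarrow> complex) set set" where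
  "proj_space n = hcoords n // proportional n"

lemma hcoords_scale: "c \<noteq> 0 \<Longrightarrow> v \<in> hcoords n \<Longrightarrow> (\<lambda>i. c * v i) \<in> hcoords n"
  by (auto simp: hcoords_def fun_eq_iff)

lemma equiv_proportional: "equiv (hcoords n) (proportional n)"
proof (rule equivI)
  show "proportional n \<subseteq> hcoords n \<times> hcoords n"
    by (auto simp: proportional_def)
  show "refl_on (hcoords n) (proportional n)"
    by (auto simp: refl_on_def proportional_def intro: exI[of _ 1])
  show "sym (proportional n)"
  proof (rule symI)
    fix v w assume "(v, w) \<in> proportional n"
    then obtain c where "v \<in> hcoords n" "w \<in> hcoords n" "c \<noteq> 0" "w = (\<lambda>i. c * v i)"
      by (auto simp: proportional_def)
    then show "(w, v) \<in> proportional n"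
      by (auto simp: proportional_def intro!: exI[of _ "inverse c"])
  qed
  show "trans (proportional n)"
  proof (rule transI)
    fix u v w assume "(u, v) \<in> proportional n" "(v, w) \<in> proportional n"
    then obtain c e where "u \<in> hcoords n" "w \<in> hcoords n" "c \<noteq> 0" "e \<noteq> 0"
      "v = (\<lambda>i. c * u i)" "w = (\<lambda>i. e * v i)"
      by (auto simp: proportional_def)
    then show "(u, w) \<in> proportional n"
      by (auto simp: proportional_def mult.assoc intro!: exI[of _ "e * c"])
  qed
qed

lemma proportional_class:
  "v \<in> hcoords n \<Longrightarrow> proportional n `` {v} = {(\<lambda>i. c * v i) | c. c \<noteq> 0}"
  by (auto simp: proportional_def hcoords_scale)

lemma proj_space_eq:
  "proj_space n = {{(\<lambda>i. c * v i) | c. c \<noteq> 0} | v. v \<in> hcoords n}"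
  by (auto simp: proj_space_def quotient_def proportional_class)


section \<open>Rational maps of degree d on the projective line\<close>

text \<open>
  A vector \<open>v = (a\<^sub>0, \<dots>, a\<^sub>d, b\<^sub>0, \<dots>, b\<^sub>d)\<close> stands for the pair of binary forms
  \<open>(\<Sum>j. a\<^sub>j x\<^sub>0\<^sup>j x\<^sub>1\<^sup>d\<^sup>-\<^sup>j, \<Sum>j. b\<^sub>j x\<^sub>0\<^sup>j x\<^sub>1\<^sup>d\<^sup>-\<^sup>j)\<close>.
\<close>

definition form_pair :: "nat \<Rightarrow> (nat \<Rightarrow> complex) \<Rightarrow> (nat \<Rightarrow> complex) \<Rightarrow> (nat \<Rightarrow> complex)" where
  "form_pair d v x = (\<lambda>i.
     if i = 0 then (\<Sum>j\<le>d. v j * x 0 ^ j * x 1 ^ (d - j))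
     else if i = 1 then (\<Sum>j\<le>d. v (d + 1 + j) * x 0 ^ j * x 1 ^ (d - j))
     else 0)"

text \<open>
  The forms define a holomorphic map of degree \<open>d\<close> exactly when they have no common zero on the
  projective line.
\<close>

definition Rat :: "nat \<Rightarrow> (nat \<Rightarrow> complex) set set" where
  "Rat d = {f \<in> proj_space (2 * d + 1). \<forall>v\<in>f. \<forall>x\<in>hcoords 1. form_pair d v x \<noteq> (\<lambda>_. 0)}"

text \<open>
  The set of values over all representatives of \<open>f\<close> and \<open>p\<close> is a single point, see
  \<open>rat_map_class\<close> below.
\<close>

definition rat_map :: "nat \<Rightarrow> (nat \<Rightarrow> complex) set \<Rightarrow> (nat \<Rightarrow> complex) set \<Rightarrow> (nat \<Rightarrow> complex) set" where
  "rat_map d f p = {form_pair d v x | v x. v \<in> f \<and> x \<in> p}"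

definition Preper :: "nat \<Rightarrow> (nat \<Rightarrow> complex) set \<Rightarrow> (nat \<Rightarrow> complex) set set" where
  "Preper d f = {p \<in> proj_space 1. \<exists>m n. m < n \<and> (rat_map d f ^^ m) p = (rat_map d f ^^ n) p}"

lemma form_pair_scale:
  "form_pair d (\<lambda>i. c * v i) (\<lambda>i. e * x i) = (\<lambda>i. c * e ^ d * form_pair d v x i)"
proof -
  have "(\<Sum>j\<le>d. c * u j * (e * x 0) ^ j * (e * x 1) ^ (d - j)) =
        c * e ^ d * (\<Sum>j\<le>d. u j * x 0 ^ j * x 1 ^ (d - j))" for u :: "nat \<Rightarrow> complex"
    unfolding sum_distrib_left
  proof (rule sum.cong[OF refl])
    fix j assume "j \<in> {..d}"
    then have "e ^ d = e ^ j * e ^ (d - j)"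
      by (simp flip: power_add)
    then show "c * u j * (e * x 0) ^ j * (e * x 1) ^ (d - j) =
        c * e ^ d * (u j * x 0 ^ j * x 1 ^ (d - j))"
      by (simp add: power_mult_distrib algebra_simps)
  qed
  from this[of v] this[of "\<lambda>j. v (d + 1 + j)"] show ?thesis
    by (auto simp: form_pair_def fun_eq_iff)
qed

lemma rat_map_class:
  "rat_map d {(\<lambda>i. c * v i) | c. c \<noteq> 0} {(\<lambda>i. c * x i) | c. c \<noteq> 0} =
   {(\<lambda>i. c * form_pair d v x i) | c. c \<noteq> 0}"
proof (intro equalityI subsetI)
  fix y assume "y \<in> rat_map d {(\<lambda>i. c * v i) | c. c \<noteq> 0} {(\<lambda>i. c * x i) | c. c \<noteq> 0}"
  then obtain c e where "c \<noteq> 0" "e \<noteq> 0" "y = form_pair d (\<lambda>i. c * v i) (\<lambda>i. e * x i)"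
    by (auto simp: rat_map_def)
  then show "y \<in> {(\<lambda>i. c * form_pair d v x i) | c. c \<noteq> 0}"
    by (auto simp: form_pair_scale intro!: exI[of _ "c * e ^ d"])
next
  fix y assume "y \<in> {(\<lambda>i. c * form_pair d v x i) | c. c \<noteq> 0}"
  then obtain c where c: "c \<noteq> 0" "y = (\<lambda>i. c * form_pair d v x i)"
    by auto
  then have "y = form_pair d (\<lambda>i. c * v i) (\<lambda>i. 1 * x i)"
    using form_pair_scale[of d c v 1 x] by simp
  with c(1) show "y \<in> rat_map d {(\<lambda>i. c * v i) | c. c \<noteq> 0} {(\<lambda>i. c * x i) | c. c \<noteq> 0}"
    unfolding rat_map_def by force
qed

lemma rat_map_proj_space:
  assumes "f \<in> Rat d" "p \<in> proj_space 1"
  shows "rat_map d f p \<in> proj_space 1"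
proof -
  obtain v where v: "f = {(\<lambda>i. c * v i) | c. c \<noteq> 0}"
    using assms(1) by (auto simp: Rat_def proj_space_eq)
  then have "v \<in> f"
    by (auto intro: exI[of _ 1])
  obtain x where x: "x \<in> hcoords 1" "p = {(\<lambda>i. c * x i) | c. c \<noteq> 0}"
    using assms(2) by (auto simp: proj_space_eq)
  have "form_pair d v x \<in> hcoords 1"
    using assms(1) \<open>v \<in> f\<close> x(1) by (auto simp: Rat_def hcoords_def form_pair_def)
  then show ?thesis
    unfolding v x(2) rat_map_class by (auto simp: proj_space_eq)
qed


section \<open>The Zariski topology on a product of two projective spaces\<close>

text \<open>
  Multivariate polynomials are finitely supported maps from monomials to coefficients, a monomial
  being a finitely supported map from variables to exponents. On \<open>P\<^sup>n \<times> P\<^sup>m\<close> the variable \<open>Inl i\<close> is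
  the \<open>i\<close>-th coordinate of the first factor and \<open>Inr j\<close> the \<open>j\<close>-th coordinate of the second.
\<close>

type_synonym 'k cmpoly = "('k \<Rightarrow>\<^sub>0 nat) \<Rightarrow>\<^sub>0 complex"

definition monom_eval :: "('k \<Rightarrow>\<^sub>0 nat) \<Rightarrow> ('k \<Rightarrow> complex) \<Rightarrow> complex" where
  "monom_eval t z = (\<Prod>k\<in>Poly_Mapping.keys t. z k ^ Poly_Mapping.lookup t k)"

definition cmpoly_eval :: "'k cmpoly \<Rightarrow> ('k \<Rightarrow> complex) \<Rightarrow> complex" where
  "cmpoly_eval F z =
     (\<Sum>t\<in>Poly_Mapping.keys F. Poly_Mapping.lookup F t * monom_eval t z)"

definition bihomogeneous :: "nat \<Rightarrow> nat \<Rightarrow> nat \<Rightarrow> nat \<Rightarrow> (nat + nat) cmpoly \<Rightarrow> bool" where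
  "bihomogeneous n m a b F \<longleftrightarrow>
     (\<forall>t\<in>Poly_Mapping.keys F.
        Poly_Mapping.keys t \<subseteq> Inl ` {..n} \<union> Inr ` {..m} \<and>
        (\<Sum>i\<le>n. Poly_Mapping.lookup t (Inl i)) = a \<and>
        (\<Sum>j\<le>m. Poly_Mapping.lookup t (Inr j)) = b)"

definition bihom_polys :: "nat \<Rightarrow> nat \<Rightarrow> (nat + nat) cmpoly set" where
  "bihom_polys n m = {F. \<exists>a b. bihomogeneous n m a b F}"

definition zero_locus ::
  "nat \<Rightarrow> nat \<Rightarrow> (nat + nat) cmpoly set \<Rightarrow> ((nat \<Rightarrow> complex) set \<times> (nat \<Rightarrow> complex) set) set" where
  "zero_locus n m S =
     {(p, q). p \<in> proj_space n \<and> q \<in> proj_space m \<and>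
        (\<forall>F\<in>S. \<forall>v\<in>p. \<forall>w\<in>q. cmpoly_eval F (case_sum v w) = 0)}"

definition zariski ::
  "nat \<Rightarrow> nat \<Rightarrow> ((nat \<Rightarrow> complex) set \<times> (nat \<Rightarrow> complex) set) topology" where
  "zariski n m = topology (\<lambda>U. \<exists>S \<subseteq> bihom_polys n m.
     U = proj_space n \<times> proj_space m - zero_locus n m S)"

lemma monom_eval_superset:
  assumes "finite A" "Poly_Mapping.keys t \<subseteq> A"
  shows "monom_eval t z = (\<Prod>k\<in>A. z k ^ Poly_Mapping.lookup t k)"
  unfolding monom_eval_def
  by (rule prod.mono_neutral_left) (use assms in \<open>auto simp: in_keys_iff\<close>)

lemma monom_eval_add: "monom_eval (s + t) z = monom_eval s z * monom_eval t z"
proof -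
  let ?A = "Poly_Mapping.keys s \<union> Poly_Mapping.keys t"
  have "monom_eval (s + t) z = (\<Prod>k\<in>?A. z k ^ Poly_Mapping.lookup (s + t) k)"
    by (rule monom_eval_superset) (auto dest: subsetD[OF Poly_Mapping.keys_add])
  also have "\<dots> = (\<Prod>k\<in>?A. z k ^ Poly_Mapping.lookup s k) * (\<Prod>k\<in>?A. z k ^ Poly_Mapping.lookup t k)"
    by (simp add: lookup_add power_add prod.distrib)
  also have "\<dots> = monom_eval s z * monom_eval t z"
    by (simp add: monom_eval_superset[of ?A])
  finally show ?thesis .
qed

lemma cmpoly_eval_superset:
  assumes "finite A" "Poly_Mapping.keys F \<subseteq> A"
  shows "cmpoly_eval F z = (\<Sum>t\<in>A. Poly_Mapping.lookup F t * monom_eval t z)"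
  unfolding cmpoly_eval_def
  by (rule sum.mono_neutral_left) (use assms in \<open>auto simp: in_keys_iff\<close>)

lemma cmpoly_eval_0 [simp]: "cmpoly_eval 0 z = 0"
  by (simp add: cmpoly_eval_def)

lemma cmpoly_eval_1 [simp]: "cmpoly_eval 1 z = 1"
  by (simp add: cmpoly_eval_def monom_eval_def lookup_one)

lemma cmpoly_eval_single: "cmpoly_eval (Poly_Mapping.single t c) z = c * monom_eval t z"
  by (simp add: cmpoly_eval_def)

lemma cmpoly_eval_add: "cmpoly_eval (F + G) z = cmpoly_eval F z + cmpoly_eval G z"
proof -
  let ?A = "Poly_Mapping.keys F \<union> Poly_Mapping.keys G"
  have "cmpoly_eval (F + G) z = (\<Sum>t\<in>?A. Poly_Mapping.lookup (F + G) t * monom_eval t z)"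
    by (rule cmpoly_eval_superset) (auto dest: subsetD[OF Poly_Mapping.keys_add])
  also have "\<dots> = cmpoly_eval F z + cmpoly_eval G z"
    by (simp add: cmpoly_eval_superset[of ?A] lookup_add algebra_simps sum.distrib)
  finally show ?thesis .
qed

lemma cmpoly_eval_sum: "cmpoly_eval (\<Sum>x\<in>A. F x) z = (\<Sum>x\<in>A. cmpoly_eval (F x) z)"
  by (induction A rule: infinite_finite_induct) (auto simp: cmpoly_eval_add)

lemma cmpoly_expand:
  "(F :: 'k cmpoly) =
     (\<Sum>t\<in>Poly_Mapping.keys F. Poly_Mapping.single t (Poly_Mapping.lookup F t))"
  by (rule poly_mapping_eqI) (simp add: lookup_sum lookup_single when_def in_keys_iff)

lemma cmpoly_eval_mult: "cmpoly_eval (F * G) z = cmpoly_eval F z * cmpoly_eval G z"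
proof -
  have "F * G = (\<Sum>s\<in>Poly_Mapping.keys F. \<Sum>t\<in>Poly_Mapping.keys G.
      Poly_Mapping.single (s + t) (Poly_Mapping.lookup F s * Poly_Mapping.lookup G t))"
    using arg_cong2[of _ _ _ _ "(*)", OF cmpoly_expand[of F] cmpoly_expand[of G]]
    by (simp only: sum_product mult_single)
  then have "cmpoly_eval (F * G) z = (\<Sum>s\<in>Poly_Mapping.keys F. \<Sum>t\<in>Poly_Mapping.keys G.
      Poly_Mapping.lookup F s * monom_eval s z * (Poly_Mapping.lookup G t * monom_eval t z))"
    by (simp add: cmpoly_eval_sum cmpoly_eval_single monom_eval_add algebra_simps)
  then show ?thesis
    by (simp add: cmpoly_eval_def sum_product)
qed

lemma bihomogeneous_mult:
  assumes "bihomogeneous n m a b F" "bihomogeneous n m a' b' G"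
  shows "bihomogeneous n m (a + a') (b + b') (F * G)"
  unfolding bihomogeneous_def
proof
  fix t assume "t \<in> Poly_Mapping.keys (F * G)"
  then obtain r s where t: "t = r + s" "r \<in> Poly_Mapping.keys F" "s \<in> Poly_Mapping.keys G"
    using Poly_Mapping.keys_mult[of F G] by blast
  have "Poly_Mapping.keys t \<subseteq> Poly_Mapping.keys r \<union> Poly_Mapping.keys s"
    unfolding t(1) by (rule Poly_Mapping.keys_add)
  then have "Poly_Mapping.keys t \<subseteq> Inl ` {..n} \<union> Inr ` {..m}"
    using assms t(2,3) unfolding bihomogeneous_def by blast
  then show "Poly_Mapping.keys t \<subseteq> Inl ` {..n} \<union> Inr ` {..m} \<and>
      (\<Sum>i\<le>n. Poly_Mapping.lookup t (Inl i)) = a + a' \<and>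
      (\<Sum>j\<le>m. Poly_Mapping.lookup t (Inr j)) = b + b'"
    using assms t by (simp add: bihomogeneous_def lookup_add sum.distrib)
qed

lemma bihom_polys_mult: "F \<in> bihom_polys n m \<Longrightarrow> G \<in> bihom_polys n m \<Longrightarrow> F * G \<in> bihom_polys n m"
  unfolding bihom_polys_def using bihomogeneous_mult by blast

lemma one_bihom_polys: "1 \<in> bihom_polys n m"
  by (auto simp: bihom_polys_def bihomogeneous_def)

lemma cmpoly_eval_scale:
  assumes "bihomogeneous n m a b F"
  shows "cmpoly_eval F (case_sum (\<lambda>i. c * v i) (\<lambda>j. e * w j)) =
           c ^ a * e ^ b * cmpoly_eval F (case_sum v w)"
proof -
  let ?A = "Inl ` {..n} \<union> Inr ` {..m} :: (nat + nat) set"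
  have "monom_eval t (case_sum (\<lambda>i. c * v i) (\<lambda>j. e * w j)) =
        c ^ a * e ^ b * monom_eval t (case_sum v w)" if "t \<in> Poly_Mapping.keys F" for t
  proof -
    have t: "Poly_Mapping.keys t \<subseteq> ?A" "(\<Sum>i\<le>n. Poly_Mapping.lookup t (Inl i)) = a"
      "(\<Sum>j\<le>m. Poly_Mapping.lookup t (Inr j)) = b"
      using assms that by (auto simp: bihomogeneous_def)
    have *: "monom_eval t (case_sum x y) = (\<Prod>i\<le>n. x i ^ Poly_Mapping.lookup t (Inl i)) *
        (\<Prod>j\<le>m. y j ^ Poly_Mapping.lookup t (Inr j))" for x y
    proof -
      have "monom_eval t (case_sum x y) =
          (\<Prod>k\<in>?A. case_sum x y k ^ Poly_Mapping.lookup t k)"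
        by (rule monom_eval_superset) (use t in auto)
      also have "\<dots> = (\<Prod>k\<in>Inl ` {..n}. case_sum x y k ^ Poly_Mapping.lookup t k) *
          (\<Prod>k\<in>Inr ` {..m}. case_sum x y k ^ Poly_Mapping.lookup t k)"
        by (rule prod.union_disjoint) auto
      finally show ?thesis
        by (simp add: prod.reindex)
    qed
    show ?thesis
      unfolding * using t(2,3) by (simp add: power_mult_distrib prod.distrib flip: power_sum)
  qed
  then show ?thesis
    by (simp add: cmpoly_eval_def sum_distrib_left algebra_simps)
qed

lemma cmpoly_eval_zero_cong:
  assumes "F \<in> bihom_polys n m" "p \<in> proj_space n" "q \<in> proj_space m"
    "v \<in> p" "w \<in> q" "v' \<in> p" "w' \<in> q" "cmpoly_eval F (case_sum v w) = 0"
  shows "cmpoly_eval F (case_sum v' w') = 0"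
proof -
  obtain x y where x: "p = {(\<lambda>i. c * x i) | c. c \<noteq> 0}" and y: "q = {(\<lambda>i. c * y i) | c. c \<noteq> 0}"
    using assms(2,3) by (auto simp: proj_space_eq)
  obtain a b where F: "bihomogeneous n m a b F"
    using assms(1) by (auto simp: bihom_polys_def)
  have "cmpoly_eval F (case_sum x y) = 0"
    using assms(4,5,8) by (auto simp: x y cmpoly_eval_scale[OF F])
  then show ?thesis
    using assms(6,7) by (auto simp: x y cmpoly_eval_scale[OF F])
qed

lemma zero_locus_Un:
  assumes "S \<subseteq> bihom_polys n m" "T \<subseteq> bihom_polys n m"
  shows "zero_locus n m S \<union> zero_locus n m T = zero_locus n m {F * G | F G. F \<in> S \<and> G \<in> T}"
    (is "_ = ?R")
proof (intro equalityI subsetI)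
  fix x assume "x \<in> zero_locus n m S \<union> zero_locus n m T"
  then show "x \<in> ?R"
    unfolding zero_locus_def by (auto simp: cmpoly_eval_mult)
next
  fix x assume x: "x \<in> ?R"
  obtain p q where pq: "x = (p, q)" "p \<in> proj_space n" "q \<in> proj_space m"
    using x by (auto simp: zero_locus_def)
  show "x \<in> zero_locus n m S \<union> zero_locus n m T"
  proof (rule ccontr)
    assume "x \<notin> zero_locus n m S \<union> zero_locus n m T"
    then obtain F v w G v' w' where
      F: "F \<in> S" "v \<in> p" "w \<in> q" "cmpoly_eval F (case_sum v w) \<noteq> 0" and
      G: "G \<in> T" "v' \<in> p" "w' \<in> q" "cmpoly_eval G (case_sum v' w') \<noteq> 0"
      using pq by (auto simp: zero_locus_def)
    have "cmpoly_eval G (case_sum v w) \<noteq> 0"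
      using cmpoly_eval_zero_cong[of G n m p q v w v' w'] F G pq assms by blast
    then have "cmpoly_eval (F * G) (case_sum v w) \<noteq> 0"
      using F by (simp add: cmpoly_eval_mult)
    then show False
      using x F G pq by (auto simp: zero_locus_def)
  qed
qed

lemma istopology_zariski:
  "istopology (\<lambda>U. \<exists>S \<subseteq> bihom_polys n m. U = proj_space n \<times> proj_space m - zero_locus n m S)"
  (is "istopology ?L")
  unfolding istopology_def
proof (intro conjI allI impI)
  fix U V assume "?L U" "?L V"
  then obtain S T where S: "S \<subseteq> bihom_polys n m" "U = proj_space n \<times> proj_space m - zero_locus n m S"
    and T: "T \<subseteq> bihom_polys n m" "V = proj_space n \<times> proj_space m - zero_locus n m T"
    by auto
  have "U \<inter> V = proj_space n \<times> proj_space m - zero_locus n m {F * G | F G. F \<in> S \<and> G \<in> T}"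
    unfolding S(2) T(2) zero_locus_Un[OF S(1) T(1), symmetric] by blast
  moreover have "{F * G | F G. F \<in> S \<and> G \<in> T} \<subseteq> bihom_polys n m"
    using S(1) T(1) bihom_polys_mult by blast
  ultimately show "?L (U \<inter> V)"
    by blast
next
  fix K assume "\<forall>U\<in>K. ?L U"
  then obtain S where S: "\<And>U. U \<in> K \<Longrightarrow> S U \<subseteq> bihom_polys n m"
    "\<And>U. U \<in> K \<Longrightarrow> U = proj_space n \<times> proj_space m - zero_locus n m (S U)"
    by metis
  show "?L (\<Union>K)"
  proof (cases "K = {}")
    case True
    have "proj_space n \<times> proj_space m - zero_locus n m {0} = {}"
      by (auto simp: zero_locus_def)
    moreover have "{0} \<subseteq> bihom_polys n m"
      by (auto simp: bihom_polys_def bihomogeneous_def)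
    ultimately show ?thesis
      using True by (metis Union_empty)
  next
    case False
    have "\<Union>K = (\<Union>U\<in>K. proj_space n \<times> proj_space m - zero_locus n m (S U))"
      using SUP_cong[OF refl S(2), of K "\<lambda>U. U"] by simp
    also have "\<dots> = proj_space n \<times> proj_space m - zero_locus n m (\<Union>U\<in>K. S U)"
      by (auto simp: zero_locus_def)
    finally show ?thesis
      using S(1) by (intro exI[of _ "\<Union>U\<in>K. S U"] conjI UN_least)
  qed
qed

lemma openin_zariski:
  "openin (zariski n m) U \<longleftrightarrow>
     (\<exists>S \<subseteq> bihom_polys n m. U = proj_space n \<times> proj_space m - zero_locus n m S)"
  unfolding zariski_def by (simp add: topology_inverse'[OF istopology_zariski])

lemma zero_locus_subset: "zero_locus n m S \<subseteq> proj_space n \<times> proj_space m"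
  by (auto simp: zero_locus_def)

lemma proj_space_nonempty: "p \<in> proj_space n \<Longrightarrow> p \<noteq> {}"
  unfolding proj_space_def using in_quotient_imp_non_empty[OF equiv_proportional] by blast

lemma topspace_zariski: "topspace (zariski n m) = proj_space n \<times> proj_space m"
proof
  show "topspace (zariski n m) \<subseteq> proj_space n \<times> proj_space m"
    using openin_topspace[of "zariski n m", unfolded openin_zariski] by blast
  have "zero_locus n m {1} = {}"
    using proj_space_nonempty by (fastforce simp: zero_locus_def)
  then have "openin (zariski n m) (proj_space n \<times> proj_space m)"
    unfolding openin_zariski using one_bihom_polys by (intro exI[of _ "{1}"]) auto
  then show "proj_space n \<times> proj_space m \<subseteq> topspace (zariski n m)"
    by (rule openin_subset)
qed

lemma closedin_zariski:
  "closedin (zariski n m) C \<longleftrightarrow> (\<exists>S \<subseteq> bihom_polys n m. C = zero_locus n m S)"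
proof
  assume "closedin (zariski n m) C"
  then obtain S where "C \<subseteq> proj_space n \<times> proj_space m" "S \<subseteq> bihom_polys n m"
    "proj_space n \<times> proj_space m - C = proj_space n \<times> proj_space m - zero_locus n m S"
    unfolding closedin_def topspace_zariski openin_zariski by blast
  then show "\<exists>S \<subseteq> bihom_polys n m. C = zero_locus n m S"
    using zero_locus_subset[of n m S] by (intro exI[of _ S]) blast
next
  assume "\<exists>S \<subseteq> bihom_polys n m. C = zero_locus n m S"
  then obtain S where "S \<subseteq> bihom_polys n m" "C = zero_locus n m S"
    by blast
  then show "closedin (zariski n m) C"
    unfolding closedin_def topspace_zariski openin_zariski
    using zero_locus_subset by (auto simp only:)
qed

end

theory Submission
  imports Defs
begin

text \<open>
  Pairs with many common preperiodic points are constructed near one explicit base pair. Put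
  \<open>f\<^sub>0(x) = x\<^sup>d\<close> and \<open>g\<^sub>0(x) = c f\<^sub>0(x / c)\<close> with \<open>c\<close> a primitive \<open>d\<^sup>2\<close>-th root of unity: every root
  of unity is preperiodic for both maps. If \<open>f\<close> is close to \<open>f\<^sub>0\<close>, the unit circle survives as an
  invariant curve: the point \<open>z\<close> moves to \<open>z (1 + \<xi>\<^sub>f(z))\<close>, and \<open>f\<close> sends the moved \<open>z\<close> to the moved
  \<open>z\<^sup>d\<close> (\<open>exists_circle_motion\<close>, a contraction argument). Hence moved roots of unity are
  preperiodic for \<open>f\<close>, and, after rotation by \<open>c\<close>, the same holds for \<open>g\<close>.

  Fix roots of unity \<open>z\<^sub>i\<close>. The requirement that the \<open>f\<close>-motion of \<open>z\<^sub>i\<close> agrees with the \<open>g\<close>-motion of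
  the root of unity at angle \<open>2 \<pi> m\<^sub>i / k\<close> from \<open>z\<^sub>i / c\<close> is one equation in the coefficients of
  \<open>(f, g)\<close>. Its linear part at the base pair is a lacunary Fourier series in \<open>z\<^sub>i\<close>, and for a
  suitable choice of \<open>4 d - 1\<close> points these linear parts are independent
  (\<open>exists_dual_points\<close>): the two maps have \<open>2 (2 d + 1)\<close> parameters, and simultaneous conjugation
  accounts for the three that are lost. So if \<open>t\<close> is a direction in which the \<open>i\<close>-th linear part
  takes the value \<open>2 \<pi> \<i> m\<^sub>i\<close> for every \<open>i\<close>, then for all large \<open>k\<close> there is an exact solution of the
  \<open>4 d - 1\<close> equations at \<open>t / k + o(1 / k)\<close> (\<open>shadowing_along_direction\<close>), and this solution is a
  pair with \<open>4 d - 1\<close> common preperiodic points (\<open>many_common_preperiodic_points\<close>).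

  Now let \<open>F\<close> be a polynomial that does not vanish identically. Near the base pair it behaves
  like its lowest-degree form \<open>G\<close>: the value of \<open>F\<close> at displacement \<open>t / k + o(1 / k)\<close> is
  nonzero for large \<open>k\<close> as soon as \<open>G(t) \<noteq> 0\<close> (\<open>polyfuns_leading_form\<close>). The admissible directions
  \<open>t\<close> are those with linear parts in \<open>2 \<pi> \<i> \<int>\<close>, and a nonzero polynomial cannot vanish on all
  of them, since a lattice is Zariski dense (\<open>polyfuns_nonzero_at_lattice_point\<close>). So no proper
  closed subset contains every pair with \<open>4 d - 1\<close> common preperiodic points.
\<close>


section \<open>Contractions in the supremum norm\<close>

text \<open>
  The ball of radius \<open>r\<close> in the supremum norm is complete, so this is the contraction principle. The
  bound on differences is a parameter \<open>b\<close>, which keeps suprema out of the hypotheses.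
\<close>
lemma sup_contraction:
  fixes T :: "('i \<Rightarrow> complex) \<Rightarrow> 'i \<Rightarrow> complex"
  assumes k: "0 \<le> k" "k < 1"
    and self: "\<And>x. \<forall>i. norm (x i) \<le> r \<Longrightarrow> \<forall>i. norm (T x i) \<le> r"
    and contr: "\<And>x y b. \<lbrakk>\<forall>i. norm (x i) \<le> r; \<forall>i. norm (y i) \<le> r; \<forall>i. norm (x i - y i) \<le> b\<rbrakk>
                  \<Longrightarrow> \<forall>i. norm (T x i - T y i) \<le> k * b"
    and r: "0 \<le> r"
  obtains x where "\<forall>i. norm (x i) \<le> r" "T x = x"
proof -
  define X where "X n = (T ^^ n) (\<lambda>_. 0)" for n
  have X_Suc: "X (Suc n) = T (X n)" for n by (simp add: X_def)
  have X_r: "\<forall>i. norm (X n i) \<le> r" for n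
    by (induction n) (use r self in \<open>simp_all add: X_def\<close>)
  have X_diff: "\<forall>i. norm (X (n + p) i - X n i) \<le> k ^ n * r" for n p
  proof (induction n)
    case 0
    then show ?case using X_r[of p] by (simp add: X_def)
  next
    case (Suc n)
    show ?case using contr[OF X_r X_r Suc] by (simp add: X_Suc mult.assoc)
  qed
  have kr0: "(\<lambda>n. k ^ n * r) \<longlonglongrightarrow> 0"
    using k by (intro tendsto_mult_left_zero LIMSEQ_power_zero) auto
  have "Cauchy (\<lambda>n. X n i)" for i
  proof (rule metric_CauchyI)
    fix e :: real assume "0 < e"
    then obtain M where M: "k ^ M * r < e / 2"
      using order_tendstoD(2)[OF kr0, of "e / 2"] by (auto simp: eventually_sequentially)
    have "dist (X n i) (X M i) < e / 2" if n: "n \<ge> M" for n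
    proof -
      have "norm (X (M + (n - M)) i - X M i) \<le> k ^ M * r" using X_diff by blast
      then show ?thesis using M n by (simp add: dist_norm)
    qed
    then have "\<forall>m\<ge>M. \<forall>n\<ge>M. dist (X m i) (X n i) < e"
      by (meson dist_triangle_half_l)
    then show "\<exists>M. \<forall>m\<ge>M. \<forall>n\<ge>M. dist (X m i) (X n i) < e" by blast
  qed
  then have "\<forall>i. \<exists>l. (\<lambda>n. X n i) \<longlonglongrightarrow> l"
    using Cauchy_convergent_iff convergent_def by blast
  then obtain x where x: "\<And>i. (\<lambda>n. X n i) \<longlonglongrightarrow> x i" by metis
  have x_r: "\<forall>i. norm (x i) \<le> r"
    using X_r by (intro allI LIMSEQ_le_const2[OF tendsto_norm[OF x]]) auto
  have x_diff: "\<forall>i. norm (x i - X n i) \<le> k ^ n * r" for n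
  proof
    fix i
    have "(\<lambda>p. norm (X (n + p) i - X n i)) \<longlonglongrightarrow> norm (x i - X n i)"
      using LIMSEQ_ignore_initial_segment[OF x, of n]
      by (intro tendsto_intros) (simp add: add.commute)
    then show "norm (x i - X n i) \<le> k ^ n * r"
      by (rule LIMSEQ_le_const2) (use X_diff in auto)
  qed
  have "T x i = x i" for i
  proof -
    have "norm (T x i - X (Suc n) i) \<le> k ^ Suc n * r" for n
      using contr[OF x_r X_r x_diff] by (simp add: X_Suc mult.assoc)
    then have "(\<lambda>n. T x i - X (Suc n) i) \<longlonglongrightarrow> 0"
      by (intro Lim_null_comparison[OF _ LIMSEQ_Suc[OF kr0]] always_eventually) blast
    then have "(\<lambda>n. X (Suc n) i) \<longlonglongrightarrow> T x i"
      by (simp add: tendsto_iff dist_norm norm_minus_commute)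
    then show ?thesis using LIMSEQ_unique LIMSEQ_Suc[OF x] by blast
  qed
  with x_r show thesis using that by blast
qed

text \<open>
  Turns a contraction estimate with inhomogeneous term \<open>m\<close> into an a priori bound: the supremum
  \<open>s\<close> of the norms satisfies \<open>s \<le> k s + m\<close>. The crude bound \<open>b0\<close> is what makes \<open>s\<close> finite.
\<close>
lemma bounded_self_improvement:
  fixes g :: "'i \<Rightarrow> complex"
  assumes k: "0 \<le> k" "k < 1"
    and bdd: "\<forall>i. norm (g i) \<le> b0"
    and step: "\<And>b. \<forall>i. norm (g i) \<le> b \<Longrightarrow> \<forall>i. norm (g i) \<le> k * b + m"
  shows "norm (g i) \<le> m / (1 - k)"
proof -
  define s where "s = (SUP i. norm (g i))"
  have bd: "bdd_above (range (\<lambda>i. norm (g i)))" using bdd by (auto intro: bdd_aboveI)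
  have "\<forall>i. norm (g i) \<le> s" unfolding s_def using bd by (auto intro: cSUP_upper)
  from step[OF this] have "s \<le> k * s + m" unfolding s_def by (intro cSUP_least) auto
  then have "s \<le> m / (1 - k)" using k by (simp add: field_simps)
  then show ?thesis using \<open>\<forall>i. norm (g i) \<le> s\<close> order_trans by blast
qed


section \<open>Perturbing the power map near the unit circle\<close>

definition bounded_by :: "nat \<Rightarrow> real \<Rightarrow> (nat \<Rightarrow> complex) \<Rightarrow> bool" where
  "bounded_by d r u \<longleftrightarrow> (\<forall>i\<le>2 * d + 1. norm (u i) \<le> r)"

text \<open>
  A vector \<open>u\<close> of length \<open>2 d + 2\<close> records by how much the coefficients of a map differ from those of
  \<open>x\<^sup>d / 1\<close>.
\<close>
definition num :: "nat \<Rightarrow> (nat \<Rightarrow> complex) \<Rightarrow> complex \<Rightarrow> complex" where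
  "num d u x = x ^ d + (\<Sum>j\<le>d. u j * x ^ j)"

definition den :: "nat \<Rightarrow> (nat \<Rightarrow> complex) \<Rightarrow> complex \<Rightarrow> complex" where
  "den d u x = 1 + (\<Sum>j\<le>d. u (d + 1 + j) * x ^ j)"

text \<open>
  If the circle point \<open>z\<close> moves to \<open>z (1 + x)\<close> and \<open>z\<^sup>d\<close> to \<open>z\<^sup>d (1 + x')\<close>, invariance of the motion
  under the perturbed map, divided by \<open>z\<^sup>d\<close>, reads \<open>d x + residual = x'\<close>.
\<close>
definition residual :: "nat \<Rightarrow> (nat \<Rightarrow> complex) \<Rightarrow> complex \<Rightarrow> complex \<Rightarrow> complex \<Rightarrow> complex" where
  "residual d u z x x' = (1 + x) ^ d - 1 - of_nat d * x
     + (\<Sum>j\<le>d. u j * (z * (1 + x)) ^ j) / z ^ d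
     - (1 + x') * (\<Sum>j\<le>d. u (d + 1 + j) * (z * (1 + x)) ^ j)"

text \<open>
  The derivative of the logarithm of the map with respect to its coefficients, in the direction
  \<open>u\<close>, at the circle point \<open>z\<close>. It is also the linear part of \<^const>\<open>residual\<close>.
\<close>
definition log_variation :: "nat \<Rightarrow> (nat \<Rightarrow> complex) \<Rightarrow> complex \<Rightarrow> complex" where
  "log_variation d u z = (\<Sum>j\<le>d. u j * z powi (int j - int d)) - (\<Sum>j\<le>d. u (d + 1 + j) * z powi int j)"

text \<open>
  The bounded solution of \<open>d \<cdot> ell(y) = y + ell(y\<^sup>d)\<close> on the unit disc.
\<close>
definition ell :: "nat \<Rightarrow> complex \<Rightarrow> complex" where
  "ell d y = suminf (\<lambda>n. y ^ (d ^ n) / of_nat d ^ Suc n)"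

text \<open>
  The first variation of the motion in the direction \<open>u\<close>. It solves the linearized equation
  \<open>d \<cdot> velocity(z) = velocity(z\<^sup>d) - log_variation(z)\<close>, one Fourier mode at a time.
\<close>
definition velocity :: "nat \<Rightarrow> (nat \<Rightarrow> complex) \<Rightarrow> complex \<Rightarrow> complex" where
  "velocity d u z = (\<Sum>j\<le>d. u (d + 1 + j) * ell d (z powi int j))
     - (\<Sum>j\<le>d. u j * ell d (z powi (int j - int d)))"

lemma power_diff_bound:
  fixes a b :: complex
  assumes "norm a \<le> 2" "norm b \<le> 2"
  shows "norm (a ^ j - b ^ j) \<le> of_nat j * 2 ^ j * norm (a - b)"
proof (induction j)
  case (Suc j)
  have "a ^ Suc j - b ^ Suc j = a * (a ^ j - b ^ j) + (a - b) * b ^ j" by (simp add: algebra_simps)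
  then have "norm (a ^ Suc j - b ^ Suc j) \<le> norm a * norm (a ^ j - b ^ j) + norm (a - b) * norm b ^ j"
    by (metis norm_triangle_ineq norm_mult norm_power)
  also have "\<dots> \<le> 2 * (of_nat j * 2 ^ j * norm (a - b)) + norm (a - b) * 2 ^ j"
    using assms Suc by (intro add_mono mult_mono power_mono) auto
  also have "\<dots> \<le> of_nat (Suc j) * 2 ^ Suc j * norm (a - b)"
    by (simp add: algebra_simps)
  finally show ?case .
qed simp

text \<open>
  The function \<open>(1 + x)\<^sup>j - j x\<close> has vanishing derivative at 0, so on a ball of radius \<open>r\<close> its
  Lipschitz constant is of order \<open>r\<close>.
\<close>
lemma power_linearization_bound:
  fixes x y :: complex
  assumes "r \<le> 1" "norm x \<le> r" "norm y \<le> r"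
  shows "norm (((1 + x) ^ j - of_nat j * x) - ((1 + y) ^ j - of_nat j * y))
           \<le> (of_nat j)\<^sup>2 * 2 ^ j * r * norm (x - y)"
proof (induction j)
  case (Suc j)
  have r0: "0 \<le> r" using assms norm_ge_zero order_trans by blast
  have 2: "norm (1 + x) \<le> 2" "norm (1 + y) \<le> 2"
    using norm_triangle_ineq[of 1 x] norm_triangle_ineq[of 1 y] assms by auto
  let ?h = "\<lambda>j x. (1 + x) ^ j - of_nat j * x"
  have eq: "?h (Suc j) x - ?h (Suc j) y = (?h j x - ?h j y) + x * ((1 + x) ^ j - (1 + y) ^ j)
      + (x - y) * ((1 + y) ^ j - 1 ^ j)"
    by (simp add: algebra_simps)
  have "norm (?h (Suc j) x - ?h (Suc j) y) \<le> norm (?h j x - ?h j y) + norm x * norm ((1 + x) ^ j - (1 + y) ^ j)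
      + norm (x - y) * norm ((1 + y) ^ j - 1 ^ j)"
    unfolding eq by (intro norm_triangle_le add_mono) (auto simp: norm_mult)
  also have "\<dots> \<le> (of_nat j)\<^sup>2 * 2 ^ j * r * norm (x - y) + r * (of_nat j * 2 ^ j * norm (x - y))
      + norm (x - y) * (of_nat j * 2 ^ j * r)"
  proof (intro add_mono mult_mono Suc assms r0)
    show "norm ((1 + x) ^ j - (1 + y) ^ j) \<le> of_nat j * 2 ^ j * norm (x - y)"
      using power_diff_bound[OF 2, of j] by simp
    have "norm ((1 + y) ^ j - 1 ^ j) \<le> of_nat j * 2 ^ j * norm (1 + y - 1)"
      by (rule power_diff_bound) (use 2 in auto)
    also have "\<dots> \<le> of_nat j * 2 ^ j * r" using assms by (intro mult_left_mono) auto
    finally show "norm ((1 + y) ^ j - 1 ^ j) \<le> of_nat j * 2 ^ j * r" .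
  qed auto
  also have "\<dots> = ((of_nat j)\<^sup>2 + 2 * of_nat j) * 2 ^ j * r * norm (x - y)"
    by (simp add: algebra_simps)
  also have "\<dots> \<le> (of_nat (Suc j))\<^sup>2 * 2 ^ Suc j * r * norm (x - y)"
    using r0 by (intro mult_right_mono mult_mono) (auto simp: power2_eq_square algebra_simps)
  finally show ?case .
qed simp

text \<open>
  All terms of the residual other than its linear part contain a product of two small
  quantities, so they contribute a Lipschitz constant of order \<open>r\<close>. This single estimate yields the
  contraction, the size of the motion and its first variation.
\<close>
lemma residual_variation:
  "\<exists>K\<ge>0. \<forall>r u v z x x' y y' b. r \<le> 1 \<longrightarrow> norm z = 1 \<longrightarrow> bounded_by d r u \<longrightarrow> bounded_by d r v \<longrightarrow>
     bounded_by d b (\<lambda>i. u i - v i) \<longrightarrow> norm x \<le> r \<longrightarrow> norm x' \<le> r \<longrightarrow> norm y \<le> r \<longrightarrow> norm y' \<le> r \<longrightarrow>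
     norm (x - y) \<le> b \<longrightarrow> norm (x' - y') \<le> b \<longrightarrow>
     norm (residual d u z x x' - residual d v z y y' - log_variation d (\<lambda>i. u i - v i) z) \<le> K * r * b"
proof -
  define K :: real where "K = (of_nat d)\<^sup>2 * 2 ^ d + (\<Sum>j\<le>d. 2 * of_nat j * 2 ^ j) + (\<Sum>j\<le>d. 3 * of_nat j * 2 ^ j + 2 * 2 ^ j)"
  have K0: "K \<ge> 0" unfolding K_def by (intro add_nonneg_nonneg sum_nonneg) auto
  have main: "norm (residual d u z x x' - residual d v z y y' - log_variation d (\<lambda>i. u i - v i) z) \<le> K * r * b"
    if r: "r \<le> 1" and z: "norm z = 1" and u: "bounded_by d r u" and v: "bounded_by d r v" and
      uv: "bounded_by d b (\<lambda>i. u i - v i)" and x: "norm x \<le> r" and x': "norm x' \<le> r" and y: "norm y \<le> r"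
      and y': "norm y' \<le> r" and xy: "norm (x - y) \<le> b" and xy': "norm (x' - y') \<le> b"
    for r u v z x x' y y' b
  proof -
    have r0: "0 \<le> r" and b0: "0 \<le> b" using x xy norm_ge_zero order_trans by blast+
    have z0: "z \<noteq> 0" using z by auto
    let ?X = "z * (1 + x)" let ?Y = "z * (1 + y)"
    have X2: "norm ?X \<le> 2" "norm ?Y \<le> 2"
      using norm_triangle_ineq[of 1 x] norm_triangle_ineq[of 1 y] x y r z by (auto simp: norm_mult)
    have XY: "norm (?X ^ j - ?Y ^ j) \<le> of_nat j * 2 ^ j * b" for j
    proof -
      have "norm (?X ^ j - ?Y ^ j) \<le> of_nat j * 2 ^ j * norm (?X - ?Y)" by (rule power_diff_bound[OF X2])
      also have "norm (?X - ?Y) = norm (x - y)" using z by (simp add: norm_mult flip: right_diff_distrib)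
      also have "of_nat j * 2 ^ j * norm (x - y) \<le> of_nat j * 2 ^ j * b" using xy by (intro mult_left_mono) auto
      finally show ?thesis .
    qed
    have Yz: "norm (?Y ^ j - z ^ j) \<le> of_nat j * 2 ^ j * r" for j
    proof -
      have "norm (?Y ^ j - z ^ j) \<le> of_nat j * 2 ^ j * norm (?Y - z)" by (rule power_diff_bound) (use X2 z in auto)
      also have "norm (?Y - z) = norm y" using z by (simp add: algebra_simps norm_mult)
      also have "of_nat j * 2 ^ j * norm y \<le> of_nat j * 2 ^ j * r" using y by (intro mult_left_mono) auto
      finally show ?thesis .
    qed
    have Xj: "norm (?X ^ j) \<le> 2 ^ j" for j using X2 by (simp add: norm_power power_mono del: norm_mult)
    have A: "norm (u i * ?X ^ j - v i * ?Y ^ j - (u i - v i) * z ^ j) \<le> 2 * of_nat j * 2 ^ j * r * b" if "i \<le> 2 * d + 1" for i j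
    proof -
      have "u i * ?X ^ j - v i * ?Y ^ j - (u i - v i) * z ^ j = u i * (?X ^ j - ?Y ^ j) + (u i - v i) * (?Y ^ j - z ^ j)"
        by (simp add: algebra_simps)
      also have "norm \<dots> \<le> norm (u i) * norm (?X ^ j - ?Y ^ j) + norm (u i - v i) * norm (?Y ^ j - z ^ j)"
        by (metis norm_triangle_ineq norm_mult)
      also have "\<dots> \<le> r * (of_nat j * 2 ^ j * b) + b * (of_nat j * 2 ^ j * r)"
        using u uv that r0 b0 XY Yz unfolding bounded_by_def by (intro add_mono mult_mono) auto
      finally show ?thesis by (simp add: algebra_simps)
    qed
    have B: "norm ((1 + x') * (u i * ?X ^ j) - (1 + y') * (v i * ?Y ^ j) - (u i - v i) * z ^ j) \<le> (3 * of_nat j * 2 ^ j + 2 * 2 ^ j) * r * b"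
      if i: "i \<le> 2 * d + 1" for i j
    proof -
      have "(1 + x') * (u i * ?X ^ j) - (1 + y') * (v i * ?Y ^ j) - (u i - v i) * z ^ j =
          (u i * ?X ^ j - v i * ?Y ^ j - (u i - v i) * z ^ j) + (x' - y') * u i * ?X ^ j + y' * (u i - v i) * ?X ^ j
           + y' * v i * (?X ^ j - ?Y ^ j)"
        by (simp add: algebra_simps)
      also have "norm \<dots> \<le> norm (u i * ?X ^ j - v i * ?Y ^ j - (u i - v i) * z ^ j) + norm (x' - y') * norm (u i) * norm (?X ^ j)
          + norm y' * norm (u i - v i) * norm (?X ^ j) + norm y' * norm (v i) * norm (?X ^ j - ?Y ^ j)"
        by (intro norm_triangle_le add_mono) (auto simp only: norm_mult)
      also have "\<dots> \<le> 2 * of_nat j * 2 ^ j * r * b + b * r * 2 ^ j + r * b * 2 ^ j + r * 1 * (of_nat j * 2 ^ j * b)"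
        using u v uv i r0 b0 r xy' y' unfolding bounded_by_def
        by (intro add_mono mult_mono A Xj XY) (auto intro: order_trans)
      finally show ?thesis by (simp add: algebra_simps)
    qed
    have zp: "z powi (int j - int d) = z ^ j / z ^ d" for j using z0 by (simp add: power_int_diff)
    have s1: "(\<Sum>j\<le>d. u j * ?X ^ j - v j * ?Y ^ j - (u j - v j) * z ^ j) / z ^ d =
        (\<Sum>j\<le>d. u j * ?X ^ j) / z ^ d - (\<Sum>j\<le>d. v j * ?Y ^ j) / z ^ d - (\<Sum>j\<le>d. (u j - v j) * (z ^ j / z ^ d))"
      by (simp only: sum_subtractf diff_divide_distrib times_divide_eq_right flip: sum_divide_distrib)
    have s2: "(\<Sum>j\<le>d. (1 + x') * (u (d + 1 + j) * ?X ^ j) - (1 + y') * (v (d + 1 + j) * ?Y ^ j) - (u (d + 1 + j) - v (d + 1 + j)) * z ^ j) =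
        (1 + x') * (\<Sum>j\<le>d. u (d + 1 + j) * ?X ^ j) - (1 + y') * (\<Sum>j\<le>d. v (d + 1 + j) * ?Y ^ j)
          - (\<Sum>j\<le>d. (u (d + 1 + j) - v (d + 1 + j)) * z ^ j)"
      by (simp only: sum_subtractf flip: sum_distrib_left)
    have eq: "residual d u z x x' - residual d v z y y' - log_variation d (\<lambda>i. u i - v i) z =
       (((1 + x) ^ d - of_nat d * x) - ((1 + y) ^ d - of_nat d * y))
       + (\<Sum>j\<le>d. u j * ?X ^ j - v j * ?Y ^ j - (u j - v j) * z ^ j) / z ^ d
       - (\<Sum>j\<le>d. (1 + x') * (u (d + 1 + j) * ?X ^ j) - (1 + y') * (v (d + 1 + j) * ?Y ^ j) - (u (d + 1 + j) - v (d + 1 + j)) * z ^ j)"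
      unfolding residual_def log_variation_def zp s1 s2 power_int_of_nat by (simp add: diff_diff_eq2 add_diff_eq diff_add_eq)
    have t1: "norm (((1 + x) ^ d - of_nat d * x) - ((1 + y) ^ d - of_nat d * y)) \<le> (of_nat d)\<^sup>2 * 2 ^ d * r * b"
    proof -
      have "norm (((1 + x) ^ d - of_nat d * x) - ((1 + y) ^ d - of_nat d * y)) \<le> (of_nat d)\<^sup>2 * 2 ^ d * r * norm (x - y)"
        by (rule power_linearization_bound[OF r x y])
      also have "\<dots> \<le> (of_nat d)\<^sup>2 * 2 ^ d * r * b" using xy r0 by (intro mult_left_mono) auto
      finally show ?thesis .
    qed
    have "norm (\<Sum>j\<le>d. u j * ?X ^ j - v j * ?Y ^ j - (u j - v j) * z ^ j) \<le> (\<Sum>j\<le>d. 2 * of_nat j * 2 ^ j * r * b)"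
      by (intro sum_norm_le A) auto
    then have t2: "norm ((\<Sum>j\<le>d. u j * ?X ^ j - v j * ?Y ^ j - (u j - v j) * z ^ j) / z ^ d) \<le> (\<Sum>j\<le>d. 2 * of_nat j * 2 ^ j * r * b)"
      using z by (simp only: norm_divide norm_power) simp
    have t3: "norm (\<Sum>j\<le>d. (1 + x') * (u (d + 1 + j) * ?X ^ j) - (1 + y') * (v (d + 1 + j) * ?Y ^ j) - (u (d + 1 + j) - v (d + 1 + j)) * z ^ j)
        \<le> (\<Sum>j\<le>d. (3 * of_nat j * 2 ^ j + 2 * 2 ^ j) * r * b)"
      by (intro sum_norm_le B) auto
    have tri: "norm (a1 + a2 - a3) \<le> e1 + e2 + e3" if "norm a1 \<le> e1" "norm a2 \<le> e2" "norm a3 \<le> e3" for a1 a2 a3 :: complex and e1 e2 e3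
      using that norm_triangle_ineq[of a1 a2] norm_triangle_ineq4[of "a1 + a2" a3] by linarith
    have "norm (residual d u z x x' - residual d v z y y' - log_variation d (\<lambda>i. u i - v i) z) \<le>
       (of_nat d)\<^sup>2 * 2 ^ d * r * b + (\<Sum>j\<le>d. 2 * of_nat j * 2 ^ j * r * b) + (\<Sum>j\<le>d. (3 * of_nat j * 2 ^ j + 2 * 2 ^ j) * r * b)"
      unfolding eq by (rule tri[OF t1 t2 t3])
    also have "\<dots> = K * r * b" unfolding K_def by (simp only: distrib_right sum_distrib_right)
    finally show ?thesis .
  qed
  then show ?thesis using K0 by blast
qed

lemma ell_term_bound:
  fixes y :: complex
  assumes "d \<ge> 2" "norm y \<le> 1"
  shows "norm (y ^ (d ^ n) / of_nat d ^ Suc n) \<le> (1 / 2) ^ Suc n"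
proof -
  have "norm (y ^ (d ^ n) / of_nat d ^ Suc n) \<le> 1 / real d ^ Suc n"
    using assms by (simp add: norm_divide norm_power norm_mult divide_right_mono power_le_one)
  also have "\<dots> \<le> 1 / 2 ^ Suc n"
    using assms by (intro divide_left_mono power_mono) auto
  finally show ?thesis by (simp add: power_one_over)
qed

lemma summable_half: "summable (\<lambda>n. (1 / 2 :: real) ^ Suc n)"
  by (intro summable_Suc_iff[THEN iffD2] summable_geometric) auto

lemma summable_ell:
  fixes y :: complex
  assumes "d \<ge> 2" "norm y \<le> 1"
  shows "summable (\<lambda>n. y ^ (d ^ n) / of_nat d ^ Suc n)"
  by (rule summable_comparison_test'[OF summable_half, of 0]) (use ell_term_bound[OF assms] in auto)

lemma norm_ell_le:
  assumes "d \<ge> 2" "norm y \<le> 1"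
  shows "norm (ell d y) \<le> 1"
proof -
  have "norm (ell d y) \<le> suminf (\<lambda>n. (1 / 2 :: real) ^ Suc n)"
    unfolding ell_def by (rule norm_suminf_le[OF ell_term_bound[OF assms] summable_half])
  also have "\<dots> = 1" using suminf_geometric[of "1/2::real"] suminf_mult[of "\<lambda>n. (1/2::real)^n" "1/2"]
    by (simp add: summable_geometric)
  finally show ?thesis .
qed

lemma ell_step:
  assumes "d \<ge> 2" "norm y \<le> 1"
  shows "of_nat d * ell d y = y + ell d (y ^ d)"
proof -
  have yd: "norm (y ^ d) \<le> 1" using assms by (simp add: norm_power power_le_one)
  have d0: "(of_nat d :: complex) \<noteq> 0" using assms by simp
  have "ell d y = y ^ (d ^ 0) / of_nat d ^ Suc 0 + suminf (\<lambda>n. y ^ (d ^ Suc n) / of_nat d ^ Suc (Suc n))"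
    unfolding ell_def using suminf_split_head[OF summable_ell[OF assms]] by simp
  also have "(\<lambda>n. y ^ (d ^ Suc n) / of_nat d ^ Suc (Suc n)) = (\<lambda>n. ((y ^ d) ^ (d ^ n) / of_nat d ^ Suc n) / of_nat d)"
    by (simp add: power_mult mult.commute)
  also have "suminf \<dots> = ell d (y ^ d) / of_nat d"
    unfolding ell_def by (rule suminf_divide[OF summable_ell[OF assms(1) yd]])
  finally show ?thesis using d0 by (simp add: field_simps)
qed

lemma continuous_on_ell:
  assumes "d \<ge> 2"
  shows "continuous_on (cball 0 1) (ell d)"
proof -
  have "uniform_limit (cball 0 1) (\<lambda>n y. \<Sum>i<n. y ^ (d ^ i) / of_nat d ^ Suc i) (ell d) sequentially"
    unfolding ell_def
    by (rule Weierstrass_m_test[OF _ summable_half]) (use ell_term_bound[OF assms] in auto)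
  then show ?thesis
    by (rule uniform_limit_theorem[rotated]) (use assms in \<open>auto intro!: always_eventually continuous_intros\<close>)
qed

lemma norm_powi_circle: "norm z = 1 \<Longrightarrow> norm (z powi k) = (1 :: real)" for z :: complex
  by (simp add: norm_power_int)

lemma velocity_step:
  assumes d: "d \<ge> 2" and z: "norm z = 1"
  shows "of_nat d * velocity d u z = velocity d u (z ^ d) - log_variation d u z"
proof -
  have *: "of_nat d * (c * ell d (z powi k)) = c * z powi k + c * ell d ((z ^ d) powi k)" for c k
  proof -
    have "of_nat d * ell d (z powi k) = z powi k + ell d ((z powi k) ^ d)"
      by (rule ell_step) (use d z in \<open>auto simp: norm_powi_circle\<close>)
    moreover have "(z powi k) ^ d = (z ^ d) powi k"
      by (simp flip: power_int_mult power_int_of_nat add: mult.commute)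
    ultimately show ?thesis by (simp add: algebra_simps)
  qed
  show ?thesis
    unfolding velocity_def log_variation_def
    by (simp only: right_diff_distrib sum_distrib_left * sum.distrib) (simp add: algebra_simps)
qed

lemma
  assumes z: "norm z = 1" and u: "bounded_by d b u"
  shows norm_log_variation_le: "norm (log_variation d u z) \<le> (2 * real d + 2) * b"
    and norm_velocity_le: "d \<ge> 2 \<Longrightarrow> norm (velocity d u z) \<le> (2 * real d + 2) * b"
proof -
  have *: "norm ((\<Sum>j\<le>d. u (f j) * g j) - (\<Sum>j\<le>d. u (f' j) * g' j)) \<le> (2 * real d + 2) * b"
    if "\<And>j. j \<le> d \<Longrightarrow> f j \<le> 2 * d + 1 \<and> f' j \<le> 2 * d + 1" "\<And>j. norm (g j) \<le> 1 \<and> norm (g' j) \<le> 1" for f f' g g'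
  proof -
    have 1: "norm (u i * y) \<le> b" if "i \<le> 2 * d + 1" "norm y \<le> 1" for i y
    proof -
      have "norm (u i * y) \<le> b * 1" unfolding norm_mult
        by (intro mult_mono) (use u that in \<open>auto simp: bounded_by_def intro: order_trans[OF norm_ge_zero]\<close>)
      then show ?thesis by simp
    qed
    have "norm (\<Sum>j\<le>d. u (f j) * g j) \<le> (\<Sum>j\<le>d. b)" "norm (\<Sum>j\<le>d. u (f' j) * g' j) \<le> (\<Sum>j\<le>d. b)"
      by (intro sum_norm_le 1; use that in simp)+
    then show ?thesis
      using norm_triangle_ineq4[of "\<Sum>j\<le>d. u (f j) * g j" "\<Sum>j\<le>d. u (f' j) * g' j"] by (simp add: algebra_simps)
  qed
  show "norm (log_variation d u z) \<le> (2 * real d + 2) * b"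
    unfolding log_variation_def by (rule *) (use z in \<open>auto simp: norm_power_int norm_power\<close>)
  show "norm (velocity d u z) \<le> (2 * real d + 2) * b" if "d \<ge> 2"
    unfolding velocity_def by (rule *) (use that z in \<open>auto simp: norm_power_int norm_power intro!: norm_ell_le\<close>)
qed

lemma bounded_by_mono: "bounded_by d r u \<Longrightarrow> r \<le> s \<Longrightarrow> bounded_by d s u"
  unfolding bounded_by_def by force


section \<open>The motion of the unit circle\<close>

text \<open>
  The last clause is strict differentiability at the power map, uniformly on the circle, with
  derivative \<^const>\<open>velocity\<close>: the Lipschitz form is what a contraction argument in the coefficients
  consumes.
\<close>
definition circle_motion ::
  "nat \<Rightarrow> real \<Rightarrow> real \<Rightarrow> ((nat \<Rightarrow> complex) \<Rightarrow> complex \<Rightarrow> complex) \<Rightarrow> bool" where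
  "circle_motion d \<rho> C \<xi> \<longleftrightarrow>
     (\<forall>u z. bounded_by d \<rho> u \<longrightarrow> norm z = 1 \<longrightarrow>
        num d u (z * (1 + \<xi> u z)) = z ^ d * (1 + \<xi> u (z ^ d)) * den d u (z * (1 + \<xi> u z))) \<and>
     (\<forall>u r z. r \<le> \<rho> \<longrightarrow> bounded_by d r u \<longrightarrow> norm z = 1 \<longrightarrow> norm (\<xi> u z) \<le> C * r) \<and>
     (\<forall>u v r b z. r \<le> \<rho> \<longrightarrow> bounded_by d r u \<longrightarrow> bounded_by d r v \<longrightarrow> bounded_by d b (\<lambda>i. u i - v i) \<longrightarrow> norm z = 1 \<longrightarrow>
        norm (\<xi> u z - \<xi> v z - velocity d (\<lambda>i. u i - v i) z) \<le> C * r * b)"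

text \<open>
  Dividing the invariance equation by \<open>d\<close> turns it into the fixed point equation
  \<open>x(z) = (x(z\<^sup>d) - residual) / d\<close>, a contraction because the circle is expanded by the factor
  \<open>d \<ge> 2\<close> and the residual has a small Lipschitz constant. The dependence on the coefficients follows
  by applying the same expansion to the difference of two solutions, and then to what remains of it
  after subtraction of the velocity.
\<close>
lemma exists_circle_motion:
  assumes d: "d \<ge> 2"
  shows "\<exists>\<rho>>0. \<exists>C\<ge>0. \<exists>\<xi>. circle_motion d \<rho> C \<xi>"
proof -
  obtain K where K: "K \<ge> 0" and res: "\<And>r u v z x x' y y' b. r \<le> 1 \<Longrightarrow> norm z = 1 \<Longrightarrow> bounded_by d r u \<Longrightarrow> bounded_by d r v \<Longrightarrow>
     bounded_by d b (\<lambda>i. u i - v i) \<Longrightarrow> norm x \<le> r \<Longrightarrow> norm x' \<le> r \<Longrightarrow> norm y \<le> r \<Longrightarrow> norm y' \<le> r \<Longrightarrow>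
     norm (x - y) \<le> b \<Longrightarrow> norm (x' - y') \<le> b \<Longrightarrow>
     norm (residual d u z x x' - residual d v z y y' - log_variation d (\<lambda>i. u i - v i) z) \<le> K * r * b"
    using residual_variation[of d] by meson
  \<comment> \<open>on balls of radius at most \<open>r0\<close> the nonlinear part of the residual has Lipschitz constant
    at most 1/2; the factor \<open>A\<close>, twice the bound on \<open>log_variation\<close>, makes the ball of radius
    \<open>A r\<close> invariant for perturbations of size \<open>r\<close>\<close>
  define r0 where "r0 = 1 / (2 * K + 2)"
  define A where "A = 4 * real d + 4"
  have r0: "r0 > 0" "r0 \<le> 1" "K * r0 \<le> 1 / 2" using K by (auto simp: r0_def field_simps)
  have A: "A \<ge> 1" by (simp add: A_def)
  have Kr: "K * r \<le> 1 / 2" if "r \<le> r0" for r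
    using mult_left_mono[OF that K] r0 by linarith
  have zd: "norm (z ^ d) = 1" if "norm z = 1" for z :: complex using that by (simp add: norm_power)
  have half: "norm (a / of_nat d :: complex) \<le> norm a / 2" for a
    using d mult_left_mono[of 2 "real d" "norm a"] by (simp add: norm_divide field_simps)
  \<comment> \<open>the value 0 off the circle makes the functions total, so that suprema run over all of the type\<close>
  define T where "T u x z = (if norm z = 1 then (x (z ^ d) - residual d u z (x z) (x (z ^ d))) / of_nat d else 0)"
    for u :: "nat \<Rightarrow> complex" and x :: "complex \<Rightarrow> complex" and z :: complex
  have res0: "residual d (\<lambda>_. 0) z 0 0 = 0" for z by (simp add: residual_def)
  have self: "\<forall>z. norm (T u x z) \<le> A * r"
    if r: "A * r \<le> r0" "r \<ge> 0" and u: "bounded_by d r u" and x: "\<forall>z. norm (x z) \<le> A * r" for u x r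
  proof
    fix z
    have rA: "r \<le> A * r" using mult_right_mono[OF A r(2)] by simp
    show "norm (T u x z) \<le> A * r"
    proof (cases "norm z = 1")
      case True
      have "norm (residual d u z (x z) (x (z ^ d)) - residual d (\<lambda>_. 0) z 0 0 - log_variation d (\<lambda>i. u i - 0) z) \<le> K * (A * r) * (A * r)"
        by (rule res) (use r r0 True bounded_by_mono[OF u rA] x r(2) rA in \<open>auto simp: bounded_by_def\<close>)
      moreover have "K * (A * r) * (A * r) \<le> 1 / 2 * (A * r)"
        using r A by (intro mult_right_mono Kr) auto
      moreover have "norm (log_variation d u z) \<le> A * r / 2"
        using norm_log_variation_le[OF True u] by (simp add: A_def algebra_simps)
      moreover have "norm (x (z ^ d)) \<le> A * r" using x by blast
      moreover have "norm (x (z ^ d) - residual d u z (x z) (x (z ^ d))) \<le> norm (x (z ^ d)) +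
          norm (residual d u z (x z) (x (z ^ d)) - log_variation d u z) + norm (log_variation d u z)"
        using norm_triangle_ineq4[of "x (z ^ d)" "residual d u z (x z) (x (z ^ d))"]
          norm_triangle_sub[of "residual d u z (x z) (x (z ^ d))" "log_variation d u z"] by linarith
      ultimately show ?thesis
        using half[of "x (z ^ d) - residual d u z (x z) (x (z ^ d))"] True by (simp add: T_def res0)
    qed (use r A in \<open>auto simp: T_def\<close>)
  qed
  have contr: "\<forall>z. norm (T u x z - T u y z) \<le> 3 / 4 * b"
    if r: "r \<le> r0" and u: "bounded_by d r u" and x: "\<forall>z. norm (x z) \<le> r" and y: "\<forall>z. norm (y z) \<le> r"
      and xy: "\<forall>z. norm (x z - y z) \<le> b" for u x y b r
  proof
    fix z
    have b: "b \<ge> 0" using xy norm_ge_zero order_trans by blast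
    show "norm (T u x z - T u y z) \<le> 3 / 4 * b"
    proof (cases "norm z = 1")
      case True
      let ?R = "residual d u z (x z) (x (z ^ d)) - residual d u z (y z) (y (z ^ d))"
      have lv: "log_variation d (\<lambda>i. 0) z = 0" by (simp add: log_variation_def)
      have "norm (?R - log_variation d (\<lambda>i. u i - u i) z) \<le> K * r * b"
        by (rule res) (use r r0 True u x y xy b in \<open>auto simp: bounded_by_def\<close>)
      also have "\<dots> \<le> 1 / 2 * b" using b by (intro mult_right_mono Kr r) auto
      finally have R: "norm ?R \<le> b / 2" by (simp add: lv)
      have "norm (T u x z - T u y z) = norm ((x (z ^ d) - y (z ^ d) - ?R) / of_nat d)"
        using True by (simp add: T_def diff_divide_distrib add_divide_distrib algebra_simps)
      also have "\<dots> \<le> norm (x (z ^ d) - y (z ^ d) - ?R) / 2" by (rule half)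
      also have "\<dots> \<le> (b + b / 2) / 2"
        by (intro divide_right_mono order_trans[OF norm_triangle_ineq4] add_mono R spec[OF xy]) simp
      finally show ?thesis by simp
    qed (use b in \<open>auto simp: T_def\<close>)
  qed
  have ex: "\<exists>x. (\<forall>z. norm (x z) \<le> A * r) \<and> T u x = x"
    if r: "A * r \<le> r0" "r \<ge> 0" and u: "bounded_by d r u" for u r
  proof -
    have "r \<le> A * r" using mult_right_mono[OF A r(2)] by simp
    then have u': "bounded_by d (A * r) u" using u bounded_by_mono by blast
    obtain x where "\<forall>z. norm (x z) \<le> A * r" "T u x = x"
    proof (rule sup_contraction[of "3 / 4" "A * r" "T u"])
      show "\<forall>z. norm (T u x z) \<le> A * r" if "\<forall>z. norm (x z) \<le> A * r" for x
        by (rule self[OF r u that])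
      show "\<forall>z. norm (T u x z - T u y z) \<le> 3 / 4 * b"
        if "\<forall>z. norm (x z) \<le> A * r" "\<forall>z. norm (y z) \<le> A * r" "\<forall>z. norm (x z - y z) \<le> b" for x y b
        by (rule contr[OF r(1) u' that])
    qed (use r A in auto)
    then show ?thesis by blast
  qed
  define \<rho> where "\<rho> = r0 / A"
  have \<rho>: "\<rho> > 0" "A * \<rho> = r0" using r0 A by (auto simp: \<rho>_def)
  have Ar: "A * r \<le> r0" if "r \<le> \<rho>" for r using mult_left_mono[OF that, of A] \<rho> A by simp
  have uniq: "x = y" if u: "bounded_by d \<rho> u" and "\<forall>z. norm (x z) \<le> r0" "T u x = x" "\<forall>z. norm (y z) \<le> r0" "T u y = y" for u x y
  proof
    fix z
    have "\<rho> \<le> r0" using mult_right_mono[OF A, of \<rho>] \<rho> by simp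
    then have u': "bounded_by d r0 u" using u bounded_by_mono by blast
    have "norm (x z - y z) \<le> 0 / (1 - 3 / 4)"
    proof (rule bounded_self_improvement[of _ "\<lambda>z. x z - y z"])
      show "\<forall>i. norm (x i - y i) \<le> r0 + r0"
      proof
        fix i
        have "norm (x i) \<le> r0" "norm (y i) \<le> r0" using that by blast+
        then show "norm (x i - y i) \<le> r0 + r0" using norm_triangle_ineq4[of "x i" "y i"] by linarith
      qed
    next
      fix b assume "\<forall>i. norm (x i - y i) \<le> b"
      from contr[OF order_refl u' that(2) that(4) this] show "\<forall>i. norm (x i - y i) \<le> 3 / 4 * b + 0"
        using that by simp
    qed auto
    then show "x z = y z" by simp
  qed
  define \<xi> where "\<xi> u = (SOME x. (\<forall>z. norm (x z) \<le> r0) \<and> T u x = x)" for u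
  have \<xi>: "(\<forall>z. norm (\<xi> u z) \<le> r0) \<and> T u (\<xi> u) = \<xi> u" if "bounded_by d \<rho> u" for u
  proof -
    have "\<exists>x. (\<forall>z. norm (x z) \<le> r0) \<and> T u x = x" using ex[of \<rho> u] \<rho> that by simp
    then show ?thesis unfolding \<xi>_def by (rule someI_ex)
  qed
  have nonneg: "r \<ge> 0" if "bounded_by d r u" for r u
    using that norm_ge_zero order_trans unfolding bounded_by_def by blast
  have \<xi>_small: "norm (\<xi> u z) \<le> A * r" if r: "r \<le> \<rho>" and u: "bounded_by d r u" for u r z
  proof -
    obtain x where x: "\<forall>z. norm (x z) \<le> A * r" "T u x = x"
      using ex[OF Ar[OF r] nonneg[OF u] u] by blast
    have u': "bounded_by d \<rho> u" using r u bounded_by_mono by blast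
    have "\<forall>z. norm (x z) \<le> r0" using x(1) Ar[OF r] by (meson order_trans)
    then have "\<xi> u = x" using \<xi>[OF u'] x(2) by (blast intro: uniq[OF u'])
    then show ?thesis using x by simp
  qed
  have eqn: "of_nat d * \<xi> u z = \<xi> u (z ^ d) - residual d u z (\<xi> u z) (\<xi> u (z ^ d))"
    if "bounded_by d \<rho> u" "norm z = 1" for u z
  proof -
    have "\<xi> u z = T u (\<xi> u) z" using \<xi>[OF that(1)] by simp
    also have "of_nat d * \<dots> = \<xi> u (z ^ d) - residual d u z (\<xi> u z) (\<xi> u (z ^ d))"
      using that d by (simp add: T_def)
    finally show ?thesis .
  qed
  have off: "\<xi> u z = 0" if "bounded_by d \<rho> u" "norm z \<noteq> 1" for u z
  proof -
    have "T u (\<xi> u) z = \<xi> u z" using \<xi>[OF that(1)] by simp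
    then show ?thesis using that by (simp add: T_def)
  qed
  define C1 where "C1 = 4 * real d + 5"
  define C where "C = A + K * A * (C1 + 1)"
  have C: "C \<ge> A" "C \<ge> K * A * (C1 + 1)" "C \<ge> 0" using K A by (auto simp: C_def C1_def)
  have var: "norm (\<xi> u z - \<xi> v z - velocity d (\<lambda>i. u i - v i) z) \<le> C * r * b"
    if r: "r \<le> \<rho>" and u: "bounded_by d r u" and v: "bounded_by d r v" and uv: "bounded_by d b (\<lambda>i. u i - v i)" and z: "norm z = 1"
    for u v r b z
  proof -
    have b: "b \<ge> 0" and r': "r \<ge> 0" using nonneg uv u by blast+
    have u': "bounded_by d \<rho> u" "bounded_by d \<rho> v" using r u v bounded_by_mono by blast+
    have "r \<le> A * r" using mult_right_mono[OF A r'] by simp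
    then have u'': "bounded_by d (A * r) u" "bounded_by d (A * r) v" using u v bounded_by_mono by blast+
    let ?U = "log_variation d (\<lambda>i. u i - v i)"
    let ?R = "\<lambda>z. residual d u z (\<xi> u z) (\<xi> u (z ^ d)) - residual d v z (\<xi> v z) (\<xi> v (z ^ d))"
    define g where "g z = \<xi> u z - \<xi> v z" for z
    have geq': "of_nat d * g z = g (z ^ d) - ?R z" if "norm z = 1" for z
      using eqn[OF u'(1) that] eqn[OF u'(2) that] by (simp add: g_def right_diff_distrib)
    have geq: "g z = (g (z ^ d) - ?R z) / of_nat d" if "norm z = 1" for z
      using geq'[OF that] d by (simp add: nonzero_eq_divide_eq mult.commute)
    have R: "norm (?R z - ?U z) \<le> K * (A * r) * c"
      if z: "norm z = 1" and c: "\<forall>z. norm (g z) \<le> c" "b \<le> c" for z c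
    proof (rule res[OF _ z u'' bounded_by_mono[OF uv c(2)]])
      show "A * r \<le> 1" using Ar[OF r] r0 by linarith
    qed (use c \<xi>_small[OF r u] \<xi>_small[OF r v] in \<open>auto simp: g_def\<close>)
    have g: "norm (g z) \<le> C1 * b" for z
    proof -
      have "norm (g z) \<le> ((real d + 5 / 4) * b) / (1 - 3 / 4)"
      proof (rule bounded_self_improvement[where g = g])
        show "\<forall>z. norm (g z) \<le> 2 * r0"
        proof
          fix z
          have "norm (\<xi> u z) \<le> r0" "norm (\<xi> v z) \<le> r0" using \<xi>[OF u'(1)] \<xi>[OF u'(2)] by blast+
          then show "norm (g z) \<le> 2 * r0"
            using norm_triangle_ineq4[of "\<xi> u z" "\<xi> v z"] unfolding g_def by linarith
        qed
      next
        fix c assume c: "\<forall>z. norm (g z) \<le> c"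
        then have c0: "0 \<le> c" using norm_ge_zero order_trans by blast
        show "\<forall>z. norm (g z) \<le> 3 / 4 * c + (real d + 5 / 4) * b"
        proof
          fix z show "norm (g z) \<le> 3 / 4 * c + (real d + 5 / 4) * b"
          proof (cases "norm z = 1")
            case True
            have cb: "\<forall>z. norm (g z) \<le> c + b" using c b by (auto intro: add_increasing2)
            have "norm (?R z - ?U z) \<le> K * (A * r) * (c + b)"
              by (rule R[OF True cb]) (use c0 in simp)
            also have "\<dots> \<le> 1 / 2 * (c + b)"
              using c0 b by (intro mult_right_mono Kr Ar r) auto
            finally have 1: "norm (?R z - ?U z) \<le> 1 / 2 * (c + b)" .
            have 2: "norm (?U z) \<le> (2 * real d + 2) * b" by (rule norm_log_variation_le[OF True uv])
            have 3: "norm (g (z ^ d)) \<le> c" using c by blast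
            have "norm (g z) \<le> norm (g (z ^ d) - ?R z) / 2"
              by (subst geq[OF True]) (rule half)
            also have "\<dots> \<le> (c + 1 / 2 * (c + b) + (2 * real d + 2) * b) / 2"
            proof (rule divide_right_mono)
              show "norm (g (z ^ d) - ?R z) \<le> c + 1 / 2 * (c + b) + (2 * real d + 2) * b"
                using norm_triangle_ineq4[of "g (z ^ d)" "?R z"] norm_triangle_sub[of "?R z" "?U z"] 1 2 3 by linarith
            qed simp
            also have "\<dots> = 3 / 4 * c + (real d + 5 / 4) * b" by (simp add: field_simps)
            finally show ?thesis .
          next
            case False
            then show ?thesis using off u' c0 b by (simp add: g_def)
          qed
        qed
      qed auto
      then show ?thesis by (simp add: C1_def algebra_simps)
    qed
    define h where "h z = (if norm z = 1 then g z - velocity d (\<lambda>i. u i - v i) z else 0)" for z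
    have "norm (h z) \<le> (K * (A * r) * ((C1 + 1) * b) / 2) / (1 - 1 / 2)"
    proof (rule bounded_self_improvement[where g = h])
      show "\<forall>z. norm (h z) \<le> C1 * b + (2 * real d + 2) * b"
      proof
        fix z show "norm (h z) \<le> C1 * b + (2 * real d + 2) * b"
        proof (cases "norm z = 1")
          case True
          then show ?thesis
            using g[of z] norm_velocity_le[OF True uv d] norm_triangle_ineq4[of "g z" "velocity d (\<lambda>i. u i - v i) z"]
            unfolding h_def if_P[OF True] by linarith
        next
          case False
          then show ?thesis using b by (simp add: h_def C1_def)
        qed
      qed
    next
      fix c assume c: "\<forall>z. norm (h z) \<le> c"
      then have c0: "0 \<le> c" using norm_ge_zero order_trans by blast
      show "\<forall>z. norm (h z) \<le> 1 / 2 * c + K * (A * r) * ((C1 + 1) * b) / 2"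
      proof
        fix z show "norm (h z) \<le> 1 / 2 * c + K * (A * r) * ((C1 + 1) * b) / 2"
        proof (cases "norm z = 1")
          case True
          have C1b: "0 \<le> C1 * b" using b by (simp add: C1_def)
          have "C1 * b \<le> (C1 + 1) * b" using b by (simp add: algebra_simps)
          then have gb: "\<forall>z. norm (g z) \<le> (C1 + 1) * b" using g order_trans by blast
          have 1: "norm (?R z - ?U z) \<le> K * (A * r) * ((C1 + 1) * b)"
            by (rule R[OF True gb]) (use C1b in \<open>simp add: algebra_simps\<close>)
          have "h z = (h (z ^ d) - (?R z - ?U z)) / of_nat d"
          proof -
            have "of_nat d * h z = h (z ^ d) - (?R z - ?U z)"
              using True zd[OF True] geq'[OF True] velocity_step[OF d True, of "\<lambda>i. u i - v i"]
              by (simp add: h_def right_diff_distrib)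
            then show ?thesis using d by (simp add: nonzero_eq_divide_eq mult.commute)
          qed
          then have "norm (h z) = norm ((h (z ^ d) - (?R z - ?U z)) / of_nat d)" by (rule arg_cong)
          also have "\<dots> \<le> norm (h (z ^ d) - (?R z - ?U z)) / 2" by (rule half)
          also have "\<dots> \<le> (c + K * (A * r) * ((C1 + 1) * b)) / 2"
            by (intro divide_right_mono order_trans[OF norm_triangle_ineq4] add_mono 1 spec[OF c]) simp
          also have "\<dots> = 1 / 2 * c + K * (A * r) * ((C1 + 1) * b) / 2" by (simp add: field_simps)
          finally show ?thesis .
        next
          case False
          then show ?thesis using c0 b r' K A by (simp add: h_def C1_def)
        qed
      qed
    qed auto
    also have "\<dots> = (K * A * (C1 + 1)) * (r * b)" by simp
    also have "\<dots> \<le> C * (r * b)" using C b r' by (intro mult_right_mono) auto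
    finally show ?thesis using z by (simp add: h_def g_def)
  qed
  have semiconj: "num d u (z * (1 + \<xi> u z)) = z ^ d * (1 + \<xi> u (z ^ d)) * den d u (z * (1 + \<xi> u z))"
    if "bounded_by d \<rho> u" "norm z = 1" for u z
  proof -
    have z0: "z ^ d \<noteq> 0" using that by auto
    define S where "S = (\<Sum>j\<le>d. u j * (z * (1 + \<xi> u z)) ^ j)"
    define S' where "S' = (\<Sum>j\<le>d. u (d + 1 + j) * (z * (1 + \<xi> u z)) ^ j)"
    have R: "residual d u z (\<xi> u z) (\<xi> u (z ^ d)) =
        (1 + \<xi> u z) ^ d - 1 - of_nat d * \<xi> u z + S / z ^ d - (1 + \<xi> u (z ^ d)) * S'"
      by (simp only: residual_def S_def S'_def)
    have "p + s = (1 + b) * (1 + t)" if "a = b - e" "e = p - 1 - a + s - (1 + b) * t" for a b e p s t :: complex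
      using that by (simp add: algebra_simps)
    from this[OF eqn[OF that] R]
    have "(1 + \<xi> u z) ^ d + S / z ^ d = (1 + \<xi> u (z ^ d)) * (1 + S')" .
    then have "z ^ d * ((1 + \<xi> u z) ^ d + S / z ^ d) = z ^ d * ((1 + \<xi> u (z ^ d)) * (1 + S'))" by simp
    moreover have "z ^ d * ((1 + \<xi> u z) ^ d + S / z ^ d) = num d u (z * (1 + \<xi> u z))"
    proof -
      have "z ^ d * (a ^ d + S / z ^ d) = (z * a) ^ d + S" for a
        using z0 by (simp add: distrib_left power_mult_distrib)
      then show ?thesis by (simp only: num_def S_def)
    qed
    ultimately show ?thesis by (simp add: den_def S'_def mult.assoc)
  qed
  have "norm (\<xi> u z) \<le> C * r" if "r \<le> \<rho>" "bounded_by d r u" for u r z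
    using \<xi>_small[OF that] mult_right_mono[OF C(1) nonneg[OF that(2)]] by (rule order_trans)
  then have "circle_motion d \<rho> C \<xi>"
    unfolding circle_motion_def using semiconj var by blast
  then show ?thesis using \<rho> C by blast
qed


section \<open>Independence of the first variations\<close>

text \<open>
  The first variation of the difference between the motion of \<open>z\<close> under the first map and the
  motion of \<open>z / c\<close>, rotated back by \<open>c\<close>, under the second. The coefficient perturbations of the two
  maps are the \<open>Inl\<close> and the \<open>Inr\<close> components of \<open>q\<close>.
\<close>
definition gap_velocity :: "nat \<Rightarrow> complex \<Rightarrow> (nat + nat \<Rightarrow> complex) \<Rightarrow> complex \<Rightarrow> complex" where
  "gap_velocity d c q z = velocity d (q \<circ> Inl) z - velocity d (q \<circ> Inr) (z / c)"

lemma gap_velocity_add: "gap_velocity d c (\<lambda>j. p j + q j) z = gap_velocity d c p z + gap_velocity d c q z"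
  unfolding gap_velocity_def velocity_def by (simp add: sum.distrib algebra_simps)

lemma gap_velocity_scale: "gap_velocity d c (\<lambda>j. a * q j) z = a * gap_velocity d c q z"
  unfolding gap_velocity_def velocity_def by (simp add: sum_distrib_left algebra_simps)

lemma gap_velocity_sum:
  "finite J \<Longrightarrow> gap_velocity d c (\<lambda>j. \<Sum>l\<in>J. a l * q l j) z = (\<Sum>l\<in>J. a l * gap_velocity d c (q l) z)"
proof (induction J rule: finite_induct)
  case empty
  show ?case using gap_velocity_scale[of d c 0] by simp
next
  case (insert x J)
  then show ?case by (simp add: gap_velocity_add gap_velocity_scale)
qed

text \<open>
  Finitely many independent functions can be interpolated at as many points, and the points can be
  found one at a time: a new function minus its interpolant at the previous points is not
  identically zero, so there is a point where it can be normalized to 1.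
\<close>
lemma independent_functions_dual_points:
  fixes f :: "'j \<Rightarrow> 'x \<Rightarrow> complex"
  assumes "finite J" "\<And>a. (\<forall>x\<in>X. (\<Sum>j\<in>J. a j * f j x) = 0) \<Longrightarrow> \<forall>j\<in>J. a j = 0"
  shows "\<exists>p b. (\<forall>j\<in>J. p j \<in> X) \<and>
           (\<forall>i\<in>J. \<forall>l\<in>J. (\<Sum>j\<in>J. b l j * f j (p i)) = (if i = l then 1 else 0))"
  using assms
proof (induction J rule: finite_induct)
  case empty
  show ?case by simp
next
  case (insert x J)
  define E where "E a y = (\<Sum>j\<in>J. a j * f j y)" for a y
  have ins: "(\<Sum>j\<in>insert x J. a j * f j y) = a x * f x y + E a y" for a y
    using insert.hyps by (simp add: E_def)
  have "\<forall>j\<in>J. a j = 0" if "\<forall>y\<in>X. E a y = 0" for a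
  proof -
    define a' where "a' = a(x := 0)"
    have "E a' y = E a y" for y
      unfolding E_def by (rule sum.cong) (use insert.hyps in \<open>auto simp: a'_def\<close>)
    moreover have "a' x = 0" by (simp add: a'_def)
    ultimately have "\<forall>j\<in>insert x J. a' j = 0"
      using that by (intro insert.prems) (simp add: ins)
    moreover have "a' j = a j" if "j \<in> J" for j using that insert.hyps by (auto simp: a'_def)
    ultimately show ?thesis by auto
  qed
  then have "\<exists>p b. (\<forall>j\<in>J. p j \<in> X) \<and> (\<forall>i\<in>J. \<forall>l\<in>J. E (b l) (p i) = (if i = l then 1 else 0))"
    unfolding E_def by (rule insert.IH)
  then obtain p b where p: "\<And>j. j \<in> J \<Longrightarrow> p j \<in> X"
    and b: "\<And>i l. i \<in> J \<Longrightarrow> l \<in> J \<Longrightarrow> E (b l) (p i) = (if i = l then 1 else 0)"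
    by blast
  \<comment> \<open>the new function minus its interpolant at the points found so far\<close>
  define q where "q j = (if j = x then 1 else - (\<Sum>l\<in>J. f x (p l) * b l j))" for j
  define Q where "Q y = f x y - (\<Sum>l\<in>J. f x (p l) * E (b l) y)" for y
  have Eq: "E q y = - (\<Sum>l\<in>J. f x (p l) * E (b l) y)" for y
  proof -
    have "E q y = (\<Sum>j\<in>J. - (\<Sum>l\<in>J. f x (p l) * b l j * f j y))"
      unfolding E_def by (rule sum.cong) (use insert.hyps in \<open>auto simp: q_def sum_distrib_right\<close>)
    also have "\<dots> = - (\<Sum>l\<in>J. \<Sum>j\<in>J. f x (p l) * b l j * f j y)"
      unfolding sum_negf by (subst sum.swap) simp
    finally show ?thesis by (simp add: E_def sum_distrib_left mult.assoc)
  qed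
  have Q: "(\<Sum>j\<in>insert x J. q j * f j y) = Q y" for y
    unfolding ins Eq by (simp add: q_def Q_def)
  have Q0: "Q (p i) = 0" if "i \<in> J" for i
  proof -
    have "(\<Sum>l\<in>J. f x (p l) * E (b l) (p i)) = (\<Sum>l\<in>J. f x (p l) * (if i = l then 1 else 0))"
      using b that by (intro sum.cong) auto
    also have "\<dots> = f x (p i)" using insert.hyps that by (simp add: if_distrib[of "(*) _"] cong: if_cong)
    finally show ?thesis by (simp add: Q_def)
  qed
  have "\<exists>y\<in>X. Q y \<noteq> 0"
  proof (rule ccontr)
    assume "\<not> ?thesis"
    then have "\<forall>j\<in>insert x J. q j = 0" by (intro insert.prems) (simp add: Q)
    then show False by (simp add: q_def)
  qed
  then obtain y where y: "y \<in> X" "Q y \<noteq> 0" by blast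
  define p' where "p' = p(x := y)"
  define b' where "b' l j = (if l = x then q j / Q y
      else (if j = x then 0 else b l j) - E (b l) y * (q j / Q y))" for l j
  have bx: "(\<Sum>j\<in>insert x J. b' x j * f j w) = Q w / Q y" for w
  proof -
    have "(\<Sum>j\<in>insert x J. b' x j * f j w) = (\<Sum>j\<in>insert x J. q j * f j w) / Q y"
      by (simp add: b'_def sum_divide_distrib add_divide_distrib)
    then show ?thesis by (simp only: Q)
  qed
  have bl: "(\<Sum>j\<in>insert x J. b' l j * f j w) = E (b l) w - E (b l) y * (Q w / Q y)" if "l \<in> J" for l w
  proof -
    have lx: "l \<noteq> x" using that insert.hyps by auto
    have "(\<Sum>j\<in>insert x J. b' l j * f j w) =
        (\<Sum>j\<in>insert x J. (if j = x then 0 else b l j) * f j w) - E (b l) y * (\<Sum>j\<in>insert x J. b' x j * f j w)"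
      unfolding sum_distrib_left sum_subtractf[symmetric]
      by (rule sum.cong) (use lx in \<open>auto simp: b'_def algebra_simps\<close>)
    also have "(\<Sum>j\<in>insert x J. (if j = x then 0 else b l j) * f j w) = E (b l) w"
      unfolding ins by (simp add: E_def) (rule sum.cong, use insert.hyps in auto)
    finally show ?thesis by (simp only: bx)
  qed
  have "(\<Sum>j\<in>insert x J. b' l j * f j (p' i)) = (if i = l then 1 else 0)"
    if "i \<in> insert x J" "l \<in> insert x J" for i l
  proof (cases "l = x")
    case True
    then show ?thesis using that y Q0 unfolding True bx by (auto simp: p'_def)
  next
    case False
    then have l: "l \<in> J" using that by simp
    show ?thesis unfolding bl[OF l] using that y b[OF _ l] Q0 False by (auto simp: p'_def)
  qed
  moreover have "p' j \<in> X" if "j \<in> insert x J" for j using that y p by (auto simp: p'_def)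
  ultimately show ?case by blast
qed

lemma cis_eq_1_iff_dvd:
  assumes "m > 0"
  shows "cis (2 * pi * of_int a / real m) = 1 \<longleftrightarrow> int m dvd a"
proof -
  have "cis (2 * pi * of_int a / real m) = 1 \<longleftrightarrow> (\<exists>n::int. 2 * pi * of_int a / real m = of_int (2 * n) * pi)"
    unfolding cis_conv_exp exp_eq_1 by simp
  also have "\<dots> \<longleftrightarrow> (\<exists>n::int. real_of_int a = real_of_int (int m * n))"
    using assms by (intro arg_cong[of _ _ Ex] ext) (auto simp: field_simps)
  also have "\<dots> \<longleftrightarrow> int m dvd a" by (simp only: of_int_eq_iff dvd_def)
  finally show ?thesis .
qed

lemma sum_powi_roots_of_unity:
  assumes "N > 0"
  shows "(\<Sum>l<N. cis (2 * pi * real l / real N) powi k) = (if int N dvd k then of_nat N else 0)"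
proof -
  define w where "w = cis (2 * pi * of_int k / real N)"
  have "cis (2 * pi * real l / real N) powi k = w ^ l" for l
    unfolding w_def cis_power_int Complex.DeMoivre by (simp add: mult_ac)
  then have *: "(\<Sum>l<N. cis (2 * pi * real l / real N) powi k) = (\<Sum>l<N. w ^ l)" by simp
  have "w ^ N = cis (2 * pi * of_int k)"
    unfolding w_def Complex.DeMoivre using assms by simp
  then have wN: "w ^ N = 1" by simp
  show ?thesis
  proof (cases "w = 1")
    case True
    then show ?thesis unfolding * using cis_eq_1_iff_dvd[OF assms, of k] by (simp add: w_def[symmetric])
  next
    case False
    then show ?thesis unfolding * geometric_sum[OF False] wN using cis_eq_1_iff_dvd[OF assms, of k]
      by (simp add: w_def[symmetric])
  qed
qed

text \<open>
  On the group of \<open>d\<^sup>4\<close>-th roots of unity the lacunary series collapses to four terms and a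
  constant. The first three frequencies separate the modes below. With the exponent 4 the group is
  large enough for the fourth frequency, a multiple of \<open>d\<^sup>3\<close>, and the constant not to be aliased
  onto them.
\<close>
lemma ell_root_of_unity:
  assumes d: "d \<ge> 2" and y: "y ^ (d ^ 4) = 1"
  shows "ell d y = (\<Sum>n<4. y ^ (d ^ n) / of_nat d ^ Suc n) + ell d 1 / of_nat d ^ 4"
proof -
  have "norm y ^ (d ^ 4) = 1" using y by (metis norm_power norm_one)
  then have y1: "norm y = 1" by (intro power_eq_imp_eq_base[of "norm y" "d ^ 4" 1]) (use d in auto)
  have step: "ell d (y ^ (d ^ n)) = y ^ (d ^ n) / of_nat d + ell d (y ^ (d ^ Suc n)) / of_nat d" for n
    using ell_step[OF d, of "y ^ (d ^ n)"] d y1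
    by (simp add: norm_power field_simps flip: power_mult)
  have "ell d y = (\<Sum>i<n. y ^ (d ^ i) / of_nat d ^ Suc i) + ell d (y ^ (d ^ n)) / of_nat d ^ n" for n
  proof (induction n)
    case (Suc n)
    then show ?case using step[of n] by (simp add: add_divide_distrib mult.commute)
  qed simp
  from this[of 4] y show ?thesis by simp
qed

text \<open>
  On the circle the \<open>j\<close>-th numerator coefficient excites the Fourier mode \<open>j - d\<close>, the \<open>j\<close>-th
  denominator coefficient the mode \<open>j\<close> with the opposite sign. Mode 0 occurs twice, and its
  numerator copy is chosen.
\<close>
definition frequency_index :: "nat \<Rightarrow> int \<Rightarrow> nat" where
  "frequency_index d k = (if k \<le> 0 then nat (k + int d) else nat (k + int d + 1))"

definition frequency_vector :: "nat \<Rightarrow> int \<Rightarrow> nat \<Rightarrow> complex" where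
  "frequency_vector d k i = (if i = frequency_index d k then if k \<le> 0 then - 1 else 1 else 0)"

lemma velocity_frequency_vector:
  assumes "- int d \<le> k" "k \<le> int d"
  shows "velocity d (frequency_vector d k) z = ell d (z powi k)"
proof (cases "k \<le> 0")
  case True
  have 1: "frequency_vector d k (d + 1 + j) = 0" for j
    using True assms by (auto simp: frequency_vector_def frequency_index_def)
  have 2: "frequency_vector d k j = (if j = nat (k + int d) then - 1 else 0)" for j
    using True by (auto simp: frequency_vector_def frequency_index_def)
  have "nat (k + int d) \<le> d" using True by linarith
  then show ?thesis unfolding velocity_def 1 2 using True assms
    by (simp add: if_distrib[of "\<lambda>x. x * _"] cong: if_cong)
next
  case False
  have 1: "frequency_vector d k j = 0" if "j \<le> d" for j
    using False that by (auto simp: frequency_vector_def frequency_index_def)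
  have 2: "frequency_vector d k (d + 1 + j) = (if j = nat k then 1 else 0)" for j
    using False by (auto simp: frequency_vector_def frequency_index_def)
  have "nat k \<le> d" using assms by linarith
  then show ?thesis unfolding velocity_def 2 using 1 False
    by (simp add: if_distrib[of "\<lambda>x. x * _"] flip: power_int_of_nat cong: if_cong)
qed

lemma dvd_small_imp_zero: "m dvd a \<Longrightarrow> \<bar>a\<bar> < m \<Longrightarrow> a = 0" for m a :: int
  using zdvd_imp_le[of m "\<bar>a\<bar>"] by fastforce

text \<open>
  The \<open>j\<close>-th discrete Fourier coefficient over the \<open>d\<^sup>4\<close>-th roots of unity. The \<open>n\<close>-th term of the
  series for mode \<open>k\<close> has frequency \<open>k d\<^sup>n\<close>, and the rotation by \<open>c\<close> multiplies it by a phase that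
  depends on \<open>n\<close>.
\<close>
lemma fourier_coefficient_relation:
  fixes a b :: "int \<Rightarrow> complex"
  assumes d: "d \<ge> 2" and c: "c ^ (d ^ 4) = 1" and j: "\<not> int (d ^ 4) dvd j"
    and zero: "\<And>z. z ^ (d ^ 4) = 1 \<Longrightarrow>
      (\<Sum>k\<in>{- int d..int d}. a k * ell d (z powi k) + b k * ell d ((z / c) powi k)) = 0"
  shows "(\<Sum>n<4. (\<Sum>k\<in>{- int d..int d}. if int (d ^ 4) dvd k * int d ^ n - j
            then a k + b k * c powi (- (k * int d ^ n)) else 0) / of_nat d ^ Suc n) = 0"
proof -
  define N where "N = d ^ 4"
  have N: "N > 0" using d by (simp add: N_def)
  have c0: "c \<noteq> 0" using c d by (metis power_0_left zero_neq_one N N_def less_irrefl)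
  define K where "K = {- int d..int d}"
  define g where "g n k = a k + b k * c powi (- (k * int d ^ n))" for n k
  define s where "s = (\<Sum>k\<in>K. a k + b k) * (ell d 1 / of_nat d ^ 4)"
  have powi_pow: "(y powi k) ^ (d ^ n) = y powi (k * int d ^ n)" for y :: complex and k n
    by (simp flip: power_int_mult power_int_of_nat)
  have total: "(\<Sum>n<4. \<Sum>k\<in>K. g n k * z powi (k * int d ^ n) / of_nat d ^ Suc n) + s = 0"
    if z: "z ^ N = 1" for z
  proof -
    have root: "(y powi k) ^ (d ^ 4) = 1" if "y ^ N = 1" for y :: complex and k
    proof -
      have "(y powi k) ^ (d ^ 4) = (y ^ N) powi k"
        unfolding N_def by (simp flip: power_int_mult power_int_of_nat add: mult.commute)
      then show ?thesis using that by simp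
    qed
    have zc: "(z / c) ^ N = 1" using z c by (simp add: power_divide N_def)
    have expand: "a k * ell d (z powi k) + b k * ell d ((z / c) powi k) =
        (\<Sum>n<4. g n k * z powi (k * int d ^ n) / of_nat d ^ Suc n) + (a k + b k) * (ell d 1 / of_nat d ^ 4)" for k
    proof -
      have "(z / c) powi m = z powi m * c powi (- m)" for m
        by (simp only: power_int_divide_distrib power_int_minus) (simp add: divide_inverse)
      then show ?thesis
        unfolding ell_root_of_unity[OF d root[OF z]] ell_root_of_unity[OF d root[OF zc]] powi_pow g_def
        by (simp add: sum_distrib_left sum.distrib algebra_simps add_divide_distrib)
    qed
    have "0 = (\<Sum>k\<in>K. a k * ell d (z powi k) + b k * ell d ((z / c) powi k))"
      using zero[of z] z by (simp add: K_def N_def)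
    also have "\<dots> = (\<Sum>k\<in>K. (\<Sum>n<4. g n k * z powi (k * int d ^ n) / of_nat d ^ Suc n) + (a k + b k) * (ell d 1 / of_nat d ^ 4))"
      by (simp only: expand)
    also have "\<dots> = (\<Sum>n<4. \<Sum>k\<in>K. g n k * z powi (k * int d ^ n) / of_nat d ^ Suc n) + s"
      unfolding s_def sum_distrib_right by (subst sum.distrib, subst sum.swap, rule refl)
    finally show ?thesis by simp
  qed
  define e where "e l = cis (2 * pi * real l / real N)" for l
  have e: "e l ^ N = 1" "e l \<noteq> 0" for l
    unfolding e_def Complex.DeMoivre using N by (simp_all add: cis_multiple_2pi)
  have shift: "e l powi (- j) * e l powi m = e l powi (m - j)" for l m
    using e by (simp add: power_int_diff power_int_minus divide_inverse mult.commute)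
  have inner: "e l powi (- j) * (x * e l powi m / y) = x / y * e l powi (m - j)" for l m x y
    unfolding shift[symmetric] by simp
  have "0 = (\<Sum>l<N. e l powi (- j) * ((\<Sum>n<4. \<Sum>k\<in>K. g n k * e l powi (k * int d ^ n) / of_nat d ^ Suc n) + s))"
    using total[OF e(1)] by simp
  also have "\<dots> = (\<Sum>l<N. (\<Sum>n<4. \<Sum>k\<in>K. g n k / of_nat d ^ Suc n * e l powi (k * int d ^ n - j)) + s * e l powi (- j))"
    by (simp only: distrib_left sum_distrib_left inner mult.commute[of _ s])
  also have "\<dots> = (\<Sum>n<4. \<Sum>k\<in>K. g n k / of_nat d ^ Suc n * (\<Sum>l<N. e l powi (k * int d ^ n - j)))
      + s * (\<Sum>l<N. e l powi (- j))"
    unfolding sum.distrib sum_distrib_left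
    by (subst sum.swap) (intro arg_cong2[of _ _ _ _ "(+)"] sum.cong refl sum.swap)
  also have "(\<Sum>l<N. e l powi (- j)) = 0"
    unfolding e_def sum_powi_roots_of_unity[OF N] using j by (simp add: N_def)
  also have "(\<Sum>n<4. \<Sum>k\<in>K. g n k / of_nat d ^ Suc n * (\<Sum>l<N. e l powi (k * int d ^ n - j)))
      = of_nat N * (\<Sum>n<4. (\<Sum>k\<in>K. if int N dvd k * int d ^ n - j then g n k else 0) / of_nat d ^ Suc n)"
    unfolding e_def sum_powi_roots_of_unity[OF N] sum_distrib_left sum_divide_distrib
    by (intro sum.cong refl) auto
  finally show ?thesis using N unfolding g_def K_def N_def by simp
qed

text \<open>
  The modes \<open>\<bar>k\<bar> \<le> d\<close> of the first map and the modes \<open>0 < \<bar>k\<bar> < d\<close> of the second are independent. The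
  lacunary frequencies \<open>k, k d, k d\<^sup>2, \<dots>\<close> of different \<open>k\<close> not divisible by \<open>d\<close> do not meet, so only
  three kinds of functions can interfere: \<open>k\<close> from the first map, \<open>k\<close> from the second, and, if
  \<open>k = \<plusminus>1\<close>, also \<open>k d\<close> from the first. Frequencies \<open>k\<close> and \<open>k d\<close>, and for \<open>k = \<plusminus>1\<close> also \<open>k d\<^sup>2\<close>, give
  enough relations, because the phases \<open>c\<^bsup>-k\<^esup>, c\<^bsup>-kd\<^esup>\<close>, respectively \<open>c\<^bsup>-kd\<^esup>, c\<^bsup>-kd\<^sup>2\<^esup>\<close>, are different for \<open>c\<close> of
  order \<open>d\<^sup>2\<close>. The modes \<open>0\<close> and \<open>\<plusminus>d\<close> of the second map have to be left out, since conjugating both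
  maps by the same Moebius transformation produces three relations.
\<close>
lemma motion_frequencies_independent:
  fixes a b :: "int \<Rightarrow> complex"
  assumes d: "d \<ge> 2" and c: "c = cis (2 * pi / real (d\<^sup>2))"
    and b: "\<And>k. k = 0 \<or> \<bar>k\<bar> = int d \<Longrightarrow> b k = 0"
    and zero: "\<And>z. z ^ (d ^ 4) = 1 \<Longrightarrow>
      (\<Sum>k\<in>{- int d..int d}. a k * ell d (z powi k) + b k * ell d ((z / c) powi k)) = 0"
    and k: "\<bar>k\<bar> \<le> int d"
  shows "a k = 0 \<and> b k = 0"
proof -
  define D where "D = int d"
  have D: "D \<ge> 2" using d by (simp add: D_def)
  have c0: "c \<noteq> 0" by (simp add: c)
  have c_powi: "c powi m = 1 \<longleftrightarrow> D\<^sup>2 dvd m" for m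
  proof -
    have "c powi m = cis (2 * pi * of_int m / real (d\<^sup>2))" unfolding c cis_power_int by (simp add: mult_ac)
    then show ?thesis using cis_eq_1_iff_dvd[of "d\<^sup>2" m] d by (simp add: D_def)
  qed
  have cN: "c ^ (d ^ 4) = 1"
  proof -
    have "c powi int (d ^ 4) = 1" unfolding c_powi by (simp add: D_def le_imp_power_dvd)
    then show ?thesis by (simp only: power_int_of_nat)
  qed
  define g where "g n k = a k + b k * c powi (- (k * D ^ n))" for n k
  \<comment> \<open>the contribution of the \<open>n\<close>-th terms of all series to the frequency \<open>j\<close>\<close>
  define S where "S n j = (\<Sum>k\<in>{-D..D}. if D ^ 4 dvd k * D ^ n - j then g n k else 0)" for n j
  have D1: "1 < D" "0 < D" using D by auto
  have pow_less: "D ^ m < D ^ n" if "m < n" for m n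
    by (rule power_strict_increasing[OF that D1(1)])
  have pow_double: "2 * D ^ n \<le> D ^ Suc n" for n
    using mult_right_mono[OF D, of "D ^ n"] D1 by simp
  have rel: "S 0 j / of_nat d + S 1 j / of_nat d ^ 2 + S 2 j / of_nat d ^ 3 + S 3 j / of_nat d ^ 4 = 0"
    if "\<not> D ^ 4 dvd j" for j
  proof -
    have "\<not> int (d ^ 4) dvd j" using that by (simp add: D_def)
    from fourier_coefficient_relation[OF d cN this zero]
    have "(\<Sum>n<4. S n j / of_nat d ^ Suc n) = 0"
      unfolding S_def D_def g_def of_nat_power .
    moreover have "sum h {..<4::nat} = h 0 + h 1 + h 2 + h 3" for h :: "nat \<Rightarrow> complex"
      by (simp add: eval_nat_numeral)
    ultimately show ?thesis by (simp add: eval_nat_numeral)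
  qed
  have none: "S n j = 0" if "\<And>k. \<bar>k\<bar> \<le> D \<Longrightarrow> \<not> D ^ 4 dvd k * D ^ n - j" for n j
    unfolding S_def by (rule sum.neutral) (use that in auto)
  have one: "S n j = g n k0"
    if "\<bar>k0\<bar> \<le> D" "k0 * D ^ n = j" "\<And>k. \<bar>k\<bar> \<le> D \<Longrightarrow> D ^ 4 dvd k * D ^ n - j \<Longrightarrow> k = k0" for n j k0
  proof -
    have "S n j = (\<Sum>k\<in>{-D..D}. if k = k0 then g n k else 0)"
      unfolding S_def
    proof (rule sum.cong[OF refl])
      fix k assume "k \<in> {-D..D}"
      then have "D ^ 4 dvd k * D ^ n - j \<longleftrightarrow> k = k0" using that(2) that(3)[of k] by auto
      then show "(if D ^ 4 dvd k * D ^ n - j then g n k else 0) = (if k = k0 then g n k else 0)" by simp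
    qed
    then show ?thesis using that(1) by (simp add: abs_le_iff)
  qed
  have nd: "\<not> D dvd k" if "k \<noteq> 0" "\<bar>k\<bar> < D" for k
    using dvd_small_imp_zero[of D k] that by blast
  have D_dvd: "D ^ m dvd D ^ n" if "m \<le> n" for m n using that by (rule le_imp_power_dvd)
  have dvd_low: "D ^ m dvd j" if "D ^ 4 dvd k * D ^ n - j" "m \<le> n" "m \<le> 4" for k n j m
  proof -
    have "D ^ m dvd k * D ^ n - j" using dvd_trans[OF D_dvd[OF that(3)] that(1)] .
    moreover have "D ^ m dvd k * D ^ n" using D_dvd[OF that(2)] by simp
    ultimately show ?thesis using dvd_diff_right_iff by blast
  qed
  have small: "m = 0" if "D ^ 4 dvd m * D ^ n" "n \<le> 4" "\<bar>m\<bar> < D ^ (4 - n)" for m n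
  proof -
    have "D ^ (4 - n) * D ^ n dvd m * D ^ n" using that(1,2) by (simp flip: power_add)
    then have "D ^ (4 - n) dvd m" using D1 by simp
    then show ?thesis using that(3) dvd_small_imp_zero by blast
  qed
  \<comment> \<open>at frequency \<open>k\<close> only the first terms of the mode \<open>k\<close> contribute\<close>
  have g0: "g 0 k = 0" if k: "k \<noteq> 0" "\<bar>k\<bar> < D" for k
  proof -
    have D4: "D dvd j" if "D ^ 4 dvd j" for j using dvd_trans[OF D_dvd[of 1 4] that] by simp
    have ndk: "\<not> D ^ 4 dvd k" using nd[OF k] D4 by blast
    have "S n k = 0" if "n \<ge> 1" for n
      by (rule none) (use dvd_low[of _ n k 1] that nd[OF k] in auto)
    moreover have "S 0 k = g 0 k"
    proof (rule one)
      fix m assume m: "\<bar>m\<bar> \<le> D" "D ^ 4 dvd m * D ^ 0 - k"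
      have "\<bar>m - k\<bar> < D ^ 4" using m k pow_double[of 1] pow_less[of 2 4] by (simp add: numeral_2_eq_2)
      then have "m - k = 0" using dvd_small_imp_zero[of "D ^ 4" "m - k"] m by simp
      then show "m = k" by simp
    qed (use k in auto)
    ultimately show ?thesis using rel[OF ndk] d by simp
  qed
  have D_less: "2 * D < D ^ 3" "D + D\<^sup>2 < D ^ 4" "D\<^sup>2 < D ^ 4" "D + 1 < D\<^sup>2" "D < D\<^sup>2" "D < D ^ 3"
  proof -
    have "2 * D \<le> D\<^sup>2" "2 * D\<^sup>2 \<le> D ^ 3"
      using pow_double[of 1] pow_double[of 2] by (simp_all add: numeral_2_eq_2[symmetric] numeral_3_eq_3[symmetric])
    moreover have "D\<^sup>2 < D ^ 3" "D ^ 3 < D ^ 4" "D < D\<^sup>2"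
      using pow_less[of 2 3] pow_less[of 3 4] pow_less[of 1 2] unfolding power_one_right by linarith+
    moreover have "D + 1 < D\<^sup>2"
    proof (cases "D = 2")
      case False
      then show ?thesis using D \<open>2 * D \<le> D\<^sup>2\<close> by linarith
    qed simp
    ultimately show "2 * D < D ^ 3" "D + D\<^sup>2 < D ^ 4" "D\<^sup>2 < D ^ 4" "D + 1 < D\<^sup>2" "D < D\<^sup>2" "D < D ^ 3"
      using D1 by linarith+
  qed
  \<comment> \<open>at frequency \<open>k d\<close>, where the mode \<open>k d\<close> interferes if \<open>k = \<plusminus>1\<close>\<close>
  have second: "S 0 (k * D) / of_nat d + g 1 k / of_nat d ^ 2 = 0"
    and S0: "1 < \<bar>k\<bar> \<Longrightarrow> S 0 (k * D) = 0" "\<bar>k\<bar> = 1 \<Longrightarrow> S 0 (k * D) = a (k * D)"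
    if k: "k \<noteq> 0" "\<bar>k\<bar> < D" for k
  proof -
    have ndk: "\<not> D ^ 4 dvd k * D" using small[of k 1] k D_less by auto
    have "S n (k * D) = 0" if "n \<ge> 2" for n
    proof (rule none)
      fix m
      have "\<not> D ^ 2 dvd k * D" using nd[OF k] D1 by (simp add: power2_eq_square)
      then show "\<not> D ^ 4 dvd m * D ^ n - k * D" using dvd_low[of m n "k * D" 2] that by auto
    qed
    moreover have "S 1 (k * D) = g 1 k"
    proof (rule one)
      fix m assume m: "\<bar>m\<bar> \<le> D" "D ^ 4 dvd m * D ^ 1 - k * D"
      have "\<bar>m - k\<bar> < D ^ 3" using m(1) k D_less by linarith
      then have "m - k = 0" using small[of "m - k" 1] m(2) by (simp add: left_diff_distrib)
      then show "m = k" by simp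
    qed (use k in auto)
    ultimately show "S 0 (k * D) / of_nat d + g 1 k / of_nat d ^ 2 = 0" using rel[OF ndk] by simp
    have kD: "\<bar>k * D\<bar> \<le> D\<^sup>2" using k D1 by (simp add: abs_mult power2_eq_square)
    have eq: "m = k * D" if "\<bar>m\<bar> \<le> D" "D ^ 4 dvd m * D ^ 0 - k * D" for m
    proof -
      have "\<bar>m - k * D\<bar> < D ^ 4" using that(1) kD D_less by linarith
      then show ?thesis using dvd_small_imp_zero[of "D ^ 4" "m - k * D"] that(2) by simp
    qed
    show "S 0 (k * D) = 0" if k1: "1 < \<bar>k\<bar>"
    proof (rule none)
      fix m assume m: "\<bar>m\<bar> \<le> D"
      have "1 * D < \<bar>k\<bar> * D" using k1 D1 by (intro mult_strict_right_mono)
      then have "m \<noteq> k * D" using m D1 by (auto simp: abs_mult)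
      then show "\<not> D ^ 4 dvd m * D ^ 0 - k * D" using eq m by blast
    qed
    show "S 0 (k * D) = a (k * D)" if k1: "\<bar>k\<bar> = 1"
    proof -
      have "S 0 (k * D) = g 0 (k * D)" by (rule one) (use eq k1 D1 in \<open>auto simp: abs_mult\<close>)
      moreover have "b (k * D) = 0" using k1 by (intro b) (simp add: abs_mult D_def)
      ultimately show ?thesis by (simp add: g_def)
    qed
  qed
  \<comment> \<open>at frequency \<open>k d\<^sup>2\<close>, used to eliminate the mode \<open>k d\<close>\<close>
  have third: "a (k * D) / of_nat d ^ 2 + g 2 k / of_nat d ^ 3 = 0" if k: "\<bar>k\<bar> = 1" for k
  proof -
    have ndk: "\<not> D ^ 4 dvd k * D ^ 2" using small[of k 2] k D D_less by auto
    have abs_kD: "\<bar>k * D ^ n\<bar> = D ^ n" for n using k D1 by (simp add: abs_mult)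
    have "S 0 (k * D ^ 2) = 0"
    proof (rule none)
      fix m assume m: "\<bar>m\<bar> \<le> D"
      have "\<bar>m - k * D ^ 2\<bar> < D ^ 4" using m abs_kD[of 2] D_less by linarith
      moreover have "m - k * D ^ 2 \<noteq> 0" using m abs_kD[of 2] D_less by auto
      ultimately show "\<not> D ^ 4 dvd m * D ^ 0 - k * D ^ 2" using dvd_small_imp_zero[of "D ^ 4" "m - k * D ^ 2"] by auto
    qed
    moreover have "S 1 (k * D ^ 2) = g 1 (k * D)"
    proof (rule one)
      fix m assume m: "\<bar>m\<bar> \<le> D" "D ^ 4 dvd m * D ^ 1 - k * D ^ 2"
      have "\<bar>m - k * D\<bar> < D ^ 3" using m(1) abs_kD[of 1] D_less by simp
      then have "m - k * D = 0"
        using small[of "m - k * D" 1] m(2) by (simp add: left_diff_distrib power2_eq_square mult.assoc)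
      then show "m = k * D" by simp
    qed (use abs_kD[of 1] in \<open>auto simp: power2_eq_square\<close>)
    moreover have "S 2 (k * D ^ 2) = g 2 k"
    proof (rule one)
      fix m assume m: "\<bar>m\<bar> \<le> D" "D ^ 4 dvd m * D ^ 2 - k * D ^ 2"
      have "\<bar>m - k\<bar> < D ^ 2" using m(1) k D_less by linarith
      then have "m - k = 0" using small[of "m - k" 2] m(2) by (simp add: left_diff_distrib)
      then show "m = k" by simp
    qed (use k D in auto)
    moreover have "S 3 (k * D ^ 2) = 0"
    proof (rule none)
      fix m
      have "\<not> D ^ 3 dvd k * D ^ 2" using nd[of k] k D D1 by (auto simp: power3_eq_cube power2_eq_square)
      then show "\<not> D ^ 4 dvd m * D ^ 3 - k * D ^ 2" using dvd_low[of m 3 "k * D ^ 2" 3] by auto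
    qed
    moreover have "g 1 (k * D) = a (k * D)"
      using b[of "k * D"] k by (simp add: g_def abs_mult D_def)
    ultimately show ?thesis using rel[OF ndk] by simp
  qed
  have b0: "b k = 0" if eq: "g m k = g n k" and nz: "\<not> D\<^sup>2 dvd k * D ^ n - k * D ^ m" for k m n
  proof (rule ccontr)
    assume "b k \<noteq> 0"
    then have "c powi (- (k * D ^ m)) = c powi (- (k * D ^ n))" using eq by (simp add: g_def)
    then have "c powi (- (k * D ^ m) - - (k * D ^ n)) = 1" using c0 by (subst power_int_diff) auto
    then show False using nz by (simp add: c_powi)
  qed
  have dc: "(of_nat d :: complex) \<noteq> 0" using d by simp
  have inner: "a k = 0 \<and> b k = 0" "\<bar>k\<bar> = 1 \<Longrightarrow> a (k * D) = 0" if k: "k \<noteq> 0" "\<bar>k\<bar> < D" for k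
  proof -
    have "b k = 0 \<and> (\<bar>k\<bar> = 1 \<longrightarrow> a (k * D) = 0)"
    proof (cases "\<bar>k\<bar> = 1")
      case True
      have "a (k * D) + g 1 k / of_nat d = 0" "a (k * D) + g 2 k / of_nat d = 0"
        using second[OF k] S0(2)[OF k True] third[OF True] dc by (simp_all add: field_simps eval_nat_numeral)
      then have "g 1 k / of_nat d = g 2 k / of_nat d" by (metis add_left_cancel)
      then have g12: "g 1 k = g 2 k" using dc by simp
      have "\<not> D\<^sup>2 dvd k * D ^ 2 - k * D ^ 1"
      proof
        assume "D\<^sup>2 dvd k * D ^ 2 - k * D ^ 1"
        then have "D\<^sup>2 dvd k * D" by (metis dvd_diff_right_iff dvd_triv_right power_one_right)
        then show False using nd[OF k] D1 by (simp add: power2_eq_square)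
      qed
      then have "b k = 0" using b0[OF g12] by blast
      then have "g 1 k = g 0 k" by (simp add: g_def)
      then show ?thesis using \<open>b k = 0\<close> \<open>a (k * D) + g 1 k / of_nat d = 0\<close> g0[OF k] by simp
    next
      case False
      then have "1 < \<bar>k\<bar>" using k by linarith
      then have "g 1 k = 0" using second[OF k] S0(1)[OF k] dc by simp
      then have g01: "g 0 k = g 1 k" using g0[OF k] by simp
      have "\<not> D\<^sup>2 dvd k * D ^ 1 - k * D ^ 0"
      proof
        assume dvd: "D\<^sup>2 dvd k * D ^ 1 - k * D ^ 0"
        have eq: "k * D ^ 1 - k * D ^ 0 = k * (D - 1)" by (simp add: algebra_simps)
        have "\<bar>k * (D - 1)\<bar> \<le> D * (D - 1)" using k D1 by (simp add: abs_mult)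
        also have "\<dots> < D\<^sup>2" using D1 by (simp add: power2_eq_square)
        finally have "k * (D - 1) = 0" using dvd_small_imp_zero dvd unfolding eq by blast
        then show False using k D by simp
      qed
      then show ?thesis using b0[OF g01] False by blast
    qed
    then show "a k = 0 \<and> b k = 0" "\<bar>k\<bar> = 1 \<Longrightarrow> a (k * D) = 0"
      using g0[OF k] by (auto simp: g_def)
  qed
  have outer: "a k = 0 \<and> b k = 0" if "\<bar>k\<bar> = D" for k
  proof -
    have "k = 1 * D \<or> k = (- 1) * D" using that by auto
    then show ?thesis using inner(2)[of 1] inner(2)[of "- 1"] b[of k] that D by (auto simp: D_def)
  qed
  have "a 0 = 0"
  proof -
    have "0 = (\<Sum>k\<in>{-D..D}. a k * ell d (1 powi k) + b k * ell d ((1 / c) powi k))"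
      using zero[of 1] by (simp add: D_def)
    also have "\<dots> = (\<Sum>k\<in>{-D..D}. if k = 0 then a 0 * ell d 1 else 0)"
    proof (rule sum.cong[OF refl])
      fix k assume "k \<in> {-D..D}"
      then have "\<bar>k\<bar> < D \<or> \<bar>k\<bar> = D" by auto
      then show "a k * ell d (1 powi k) + b k * ell d ((1 / c) powi k) = (if k = 0 then a 0 * ell d 1 else 0)"
        using inner(1)[of k] outer[of k] b[of 0] by auto
    qed
    finally have "a 0 * ell d 1 = 0" using D by simp
    moreover have "ell d 1 \<noteq> 0" using ell_step[OF d, of 1] by auto
    ultimately show ?thesis by simp
  qed
  then show ?thesis
    using inner(1)[of k] outer[of k] b[of 0] k by (cases "k = 0"; cases "\<bar>k\<bar> = D") (auto simp: D_def)
qed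

text \<open>
  The count is \<open>(2 d + 1) + 2 (d - 1)\<close>, the modes in \<open>motion_frequencies_independent\<close>. The vectors \<open>v\<close>
  form a basis of coefficient directions dual to the coincidence conditions at the points \<open>z\<close>.
\<close>
lemma exists_dual_points:
  assumes d: "d \<ge> 2" and c: "c = cis (2 * pi / real (d\<^sup>2))"
  shows "\<exists>(J :: (int + int) set) z v. finite J \<and> card J = 4 * d - 1 \<and> (\<forall>i\<in>J. z i ^ (d ^ 4) = 1) \<and>
           (\<forall>i\<in>J. \<forall>l\<in>J. gap_velocity d c (v l) (z i) = (if i = l then 1 else 0))"
proof -
  define A where "A = {- int d..int d}"
  define K where "K = {- (int d - 1)..int d - 1} - {0}"
  define J where "J = (Inl ` A \<union> Inr ` K :: (int + int) set)"
  define f where "f s z = (case s of Inl k \<Rightarrow> ell d (z powi k) | Inr k \<Rightarrow> ell d ((z / c) powi k))" for s z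
  have fin: "finite A" "finite K" "finite J" by (auto simp: A_def K_def J_def)
  have KA: "K \<subseteq> A" by (auto simp: K_def A_def)
  have split: "(\<Sum>j\<in>J. a j * f j z) =
      (\<Sum>k\<in>A. a (Inl k) * ell d (z powi k) + (if k \<in> K then a (Inr k) else 0) * ell d ((z / c) powi k))" for a z
  proof -
    have "(\<Sum>j\<in>J. a j * f j z) = (\<Sum>j\<in>Inl ` A. a j * f j z) + (\<Sum>j\<in>Inr ` K. a j * f j z)"
      unfolding J_def by (rule sum.union_disjoint) (use fin in auto)
    also have "(\<Sum>j\<in>Inl ` A. a j * f j z) = (\<Sum>k\<in>A. a (Inl k) * ell d (z powi k))"
      by (subst sum.reindex) (auto simp: f_def)
    also have "(\<Sum>j\<in>Inr ` K. a j * f j z) = (\<Sum>k\<in>K. (if k \<in> K then a (Inr k) else 0) * ell d ((z / c) powi k))"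
      by (subst sum.reindex) (auto simp: f_def)
    also have "\<dots> = (\<Sum>k\<in>A. (if k \<in> K then a (Inr k) else 0) * ell d ((z / c) powi k))"
      by (rule sum.mono_neutral_left) (use fin KA in auto)
    finally show ?thesis by (simp only: sum.distrib)
  qed
  have "\<exists>p b. (\<forall>j\<in>J. p j \<in> {z. z ^ (d ^ 4) = 1}) \<and>
           (\<forall>i\<in>J. \<forall>l\<in>J. (\<Sum>j\<in>J. b l j * f j (p i)) = (if i = l then 1 else 0))"
  proof (rule independent_functions_dual_points[OF fin(3)])
    fix a :: "int + int \<Rightarrow> complex"
    assume zero: "\<forall>z\<in>{z. z ^ (d ^ 4) = 1}. (\<Sum>j\<in>J. a j * f j z) = 0"
    define b where "b k = (if k \<in> K then a (Inr k) else 0)" for k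
    have "a (Inl k) = 0 \<and> b k = 0" if "\<bar>k\<bar> \<le> int d" for k
    proof (rule motion_frequencies_independent[OF d c _ _ that])
      show "b k = 0" if "k = 0 \<or> \<bar>k\<bar> = int d" for k using that by (auto simp: b_def K_def)
      show "(\<Sum>k\<in>{- int d..int d}. a (Inl k) * ell d (z powi k) + b k * ell d ((z / c) powi k)) = 0"
        if "z ^ (d ^ 4) = 1" for z
        using zero that unfolding split A_def b_def by simp
    qed
    then have *: "a (Inl k) = 0 \<and> b k = 0" if "k \<in> A" for k using that by (auto simp: A_def)
    show "\<forall>j\<in>J. a j = 0"
    proof
      fix j assume "j \<in> J"
      then consider k where "j = Inl k" "k \<in> A" | k where "j = Inr k" "k \<in> K" by (auto simp: J_def)
      then show "a j = 0"
      proof cases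
        case 1
        then show ?thesis using * by simp
      next
        case 2
        then have "b k = 0" using * KA by blast
        then show ?thesis using 2 by (simp add: b_def)
      qed
    qed
  qed
  then obtain p b where p: "\<And>j. j \<in> J \<Longrightarrow> p j ^ (d ^ 4) = 1"
    and b: "\<And>i l. i \<in> J \<Longrightarrow> l \<in> J \<Longrightarrow> (\<Sum>j\<in>J. b l j * f j (p i)) = (if i = l then 1 else 0)"
    by blast
  define u :: "int + int \<Rightarrow> nat + nat \<Rightarrow> complex" where
    "u s = (case s of Inl k \<Rightarrow> case_sum (frequency_vector d k) (\<lambda>_. 0)
      | Inr k \<Rightarrow> case_sum (\<lambda>_. 0) (\<lambda>i. - frequency_vector d k i))" for s
  have vel: "velocity d (\<lambda>_. 0) z = 0" "velocity d (\<lambda>i. - w i) z = - velocity d w z" for w z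
    by (simp_all add: velocity_def sum_negf)
  have u: "gap_velocity d c (u s) z = f s z" if sJ: "s \<in> J" for s z
  proof -
    have abs: "\<bar>k\<bar> \<le> int d" if "k \<in> A" for k using that by (auto simp: A_def)
    consider k where "s = Inl k" "k \<in> A" | k where "s = Inr k" "k \<in> A" using sJ KA by (auto simp: J_def)
    then show ?thesis
    proof cases
      case 1
      have "u s \<circ> Inl = frequency_vector d k" "u s \<circ> Inr = (\<lambda>_. 0)" by (auto simp: u_def 1)
      then show ?thesis using 1 by (simp add: gap_velocity_def vel f_def velocity_frequency_vector A_def)
    next
      case 2
      have "u s \<circ> Inl = (\<lambda>_. 0)" "u s \<circ> Inr = (\<lambda>i. - frequency_vector d k i)" by (auto simp: u_def 2)
      then show ?thesis using 2 by (simp add: gap_velocity_def vel f_def velocity_frequency_vector A_def)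
    qed
  qed
  define v where "v l = (\<lambda>j. \<Sum>s\<in>J. b l s * u s j)" for l
  have "gap_velocity d c (v l) (p i) = (if i = l then 1 else 0)" if "i \<in> J" "l \<in> J" for i l
  proof -
    have "gap_velocity d c (v l) (p i) = (\<Sum>s\<in>J. b l s * f s (p i))"
      unfolding v_def gap_velocity_sum[OF fin(3)] by (rule sum.cong) (auto simp: u)
    then show ?thesis using b[OF that] by simp
  qed
  moreover have "card J = 4 * d - 1"
  proof -
    have "card J = card A + card K"
      unfolding J_def using fin by (subst card_Un_disjoint) (auto simp: card_image)
    moreover have "card A = 2 * d + 1" by (simp add: A_def)
    moreover have "card K = 2 * (d - 1)"
    proof -
      have "card K = card {- (int d - 1)..int d - 1} - 1"
        unfolding K_def using d by (subst card_Diff_singleton) auto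
      then show ?thesis using d by simp
    qed
    ultimately show ?thesis using d by simp
  qed
  ultimately show ?thesis using fin(3) p by blast
qed


section \<open>Solving the coincidence equations\<close>

lemma exp_difference_quotient: "(\<lambda>k. of_nat k * (exp (x / of_nat k) - 1)) \<longlonglongrightarrow> (x :: complex)"
proof (cases "x = 0")
  case False
  have "((\<lambda>h. (exp (0 + h) - exp 0) / h) \<longlongrightarrow> exp 0) (at (0::complex))"
    using DERIV_exp[of "0::complex"] by (simp only: DERIV_def)
  then have lim: "((\<lambda>h. (exp h - 1) / h) \<longlongrightarrow> 1) (at (0::complex))" by simp
  have "filterlim (\<lambda>k. x / of_nat k) (at 0) sequentially"
    unfolding filterlim_at using False tendsto_divide_0[OF tendsto_const tendsto_of_nat]
    by (auto intro: eventually_mono[OF eventually_gt_at_top[of 0]])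
  from filterlim_compose[OF lim this]
  have "(\<lambda>k. x * ((exp (x / of_nat k) - 1) / (x / of_nat k))) \<longlonglongrightarrow> x * 1"
    by (intro tendsto_mult tendsto_const)
  then show ?thesis using False by (simp add: mult.commute)
qed simp

text \<open>
  The velocity is a combination, with the entries of \<open>u\<close> as coefficients, of finitely many
  functions that are continuous on the circle.
\<close>
lemma velocity_equicontinuous:
  assumes d: "d \<ge> 2" and y: "norm y = 1" and e: "e > 0" and w: "w \<longlonglongrightarrow> y" "\<And>k. norm (w k) = 1"
  shows "\<forall>\<^sub>F k in sequentially. \<forall>u b. bounded_by d b u \<longrightarrow> norm (velocity d u (w k) - velocity d u y) \<le> e * b"
proof -
  define D where "D i v = norm (ell d (v powi i) - ell d (y powi i))" for i :: int and v
  define \<kappa> where "\<kappa> v = (\<Sum>j\<le>d. D (int j) v) + (\<Sum>j\<le>d. D (int j - int d) v)" for v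
  have D_lim: "(\<lambda>k. D i (w k)) \<longlonglongrightarrow> 0" for i
  proof -
    have powi: "continuous_on (sphere 0 1) (\<lambda>v :: complex. v powi i)"
      by (rule continuous_on_power_int[OF continuous_on_id]) auto
    have "continuous_on (sphere 0 1) (\<lambda>v. ell d (v powi i))"
      by (rule continuous_on_compose2[OF continuous_on_ell[OF d] powi]) (auto simp: norm_power_int)
    then have "(\<lambda>k. ell d (w k powi i)) \<longlonglongrightarrow> ell d (y powi i)"
      by (rule continuous_on_tendsto_compose) (use w y in auto)
    then show ?thesis unfolding D_def by (simp add: tendsto_norm_zero LIM_zero)
  qed
  have "(\<lambda>k. \<kappa> (w k)) \<longlonglongrightarrow> (\<Sum>j\<le>d. 0) + (\<Sum>j\<le>d. 0)"
    unfolding \<kappa>_def by (intro tendsto_add tendsto_sum D_lim)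
  then have "\<forall>\<^sub>F k in sequentially. \<kappa> (w k) < e" using order_tendstoD(2) e by simp
  then show ?thesis
  proof (rule eventually_mono, intro allI impI)
    fix k u b assume k: "\<kappa> (w k) < e" and u: "bounded_by d b u"
    have "norm (u 0) \<le> b" using u by (simp add: bounded_by_def)
    then have b: "b \<ge> 0" by (rule order_trans[OF norm_ge_zero])
    have *: "norm (\<Sum>j\<le>d. u (f j) * (ell d (w k powi g j) - ell d (y powi g j))) \<le> b * (\<Sum>j\<le>d. D (g j) (w k))"
      if f: "\<And>j. j \<le> d \<Longrightarrow> f j \<le> 2 * d + 1" for f g
      unfolding sum_distrib_left
    proof (rule sum_norm_le)
      fix j assume "j \<in> {..d}"
      then have "norm (u (f j)) \<le> b" using u f[of j] unfolding bounded_by_def by simp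
      then show "norm (u (f j) * (ell d (w k powi g j) - ell d (y powi g j))) \<le> b * D (g j) (w k)"
        unfolding D_def norm_mult by (rule mult_right_mono) simp
    qed
    have eq: "velocity d u (w k) - velocity d u y =
        (\<Sum>j\<le>d. u (d + 1 + j) * (ell d (w k powi int j) - ell d (y powi int j)))
        - (\<Sum>j\<le>d. u j * (ell d (w k powi (int j - int d)) - ell d (y powi (int j - int d))))"
      unfolding velocity_def by (simp add: sum_subtractf right_diff_distrib)
    have "norm (velocity d u (w k) - velocity d u y)
        \<le> b * (\<Sum>j\<le>d. D (int j) (w k)) + b * (\<Sum>j\<le>d. D (int j - int d) (w k))"
      unfolding eq by (rule order_trans[OF norm_triangle_ineq4 add_mono[OF *[of "\<lambda>j. d + 1 + j" int]
          *[of "\<lambda>j. j" "\<lambda>j. int j - int d"]]]) simp_all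
    also have "\<dots> = \<kappa> (w k) * b" by (simp add: \<kappa>_def algebra_simps)
    also have "\<dots> \<le> e * b" using k b by (intro mult_right_mono) auto
    finally show "norm (velocity d u (w k) - velocity d u y) \<le> e * b" .
  qed
qed

definition pair_bounded :: "nat \<Rightarrow> real \<Rightarrow> (nat + nat \<Rightarrow> complex) \<Rightarrow> bool" where
  "pair_bounded d r q \<longleftrightarrow> bounded_by d r (q \<circ> Inl) \<and> bounded_by d r (q \<circ> Inr)"

text \<open>
  Vanishing of the gap means that the motion of \<open>z\<close> under the first map coincides with the rotated
  motion of \<open>z \<omega> / c\<close> under the second.
\<close>
definition gap ::
  "((nat \<Rightarrow> complex) \<Rightarrow> complex \<Rightarrow> complex) \<Rightarrow> complex \<Rightarrow> (nat + nat \<Rightarrow> complex) \<Rightarrow> complex \<Rightarrow> complex \<Rightarrow> complex" where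
  "gap \<xi> c q z \<omega> = (1 + \<xi> (q \<circ> Inl) z) - \<omega> * (1 + \<xi> (q \<circ> Inr) (z / c * \<omega>))"

text \<open>
  The gap depends on \<open>q\<close> with derivative \<^const>\<open>gap_velocity\<close> up to errors that tend to 0 as \<open>q\<close> tends
  to 0 and \<open>\<omega>\<close> to 1. The last error is the change of the velocity between \<open>z / c\<close> and \<open>z \<omega> / c\<close>.
\<close>
lemma gap_variation:
  assumes d: "d \<ge> 2" and \<xi>: "circle_motion d \<rho> C \<xi>" and z: "norm z = 1" "norm c = 1" "norm \<omega> = 1"
    and r: "r \<le> \<rho>" and p: "pair_bounded d r p" and q: "pair_bounded d r q"
    and pq: "pair_bounded d b (\<lambda>j. p j - q j)"
    and \<kappa>: "\<And>u b. bounded_by d b u \<Longrightarrow> norm (velocity d u (z / c * \<omega>) - velocity d u (z / c)) \<le> \<kappa> * b"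
  shows "norm (gap \<xi> c p z \<omega> - gap \<xi> c q z \<omega> - gap_velocity d c (\<lambda>j. p j - q j) z)
           \<le> (2 * C * r + norm (\<omega> - 1) * (2 * real d + 2) + \<kappa>) * b"
proof -
  have motion: "norm (\<xi> u z - \<xi> v z - velocity d (\<lambda>i. u i - v i) z) \<le> C * r * b"
    if "bounded_by d r u" "bounded_by d r v" "bounded_by d b (\<lambda>i. u i - v i)" "norm z = 1" for u v z
    using \<xi> that r unfolding circle_motion_def by blast
  let ?L = "\<lambda>i. (p \<circ> Inl) i - (q \<circ> Inl) i" and ?R = "\<lambda>i. (p \<circ> Inr) i - (q \<circ> Inr) i"
  have LR: "(\<lambda>j. p j - q j) \<circ> Inl = ?L" "(\<lambda>j. p j - q j) \<circ> Inr = ?R" by auto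
  have bd: "bounded_by d b ?L" "bounded_by d b ?R" using pq unfolding pair_bounded_def LR by auto
  define y where "y = z / c"
  have y: "norm (y * \<omega>) = 1" "norm y = 1" using z by (auto simp: y_def norm_mult norm_divide)
  define a1 where "a1 = \<xi> (p \<circ> Inl) z - \<xi> (q \<circ> Inl) z - velocity d ?L z"
  define a2 where "a2 = \<xi> (p \<circ> Inr) (y * \<omega>) - \<xi> (q \<circ> Inr) (y * \<omega>) - velocity d ?R (y * \<omega>)"
  define a3 where "a3 = velocity d ?R (y * \<omega>) - velocity d ?R y"
  have eq: "gap \<xi> c p z \<omega> - gap \<xi> c q z \<omega> - gap_velocity d c (\<lambda>j. p j - q j) z
      = a1 - \<omega> * a2 - (\<omega> - 1) * velocity d ?R (y * \<omega>) - a3"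
    unfolding gap_def gap_velocity_def LR a1_def a2_def a3_def y_def[symmetric] by (simp add: algebra_simps)
  have "norm (gap \<xi> c p z \<omega> - gap \<xi> c q z \<omega> - gap_velocity d c (\<lambda>j. p j - q j) z)
      \<le> norm a1 + norm \<omega> * norm a2 + norm (\<omega> - 1) * norm (velocity d ?R (y * \<omega>)) + norm a3"
    unfolding eq by (intro order_trans[OF norm_triangle_ineq4] add_mono) (auto simp: norm_mult)
  also have "\<dots> \<le> C * r * b + 1 * (C * r * b) + norm (\<omega> - 1) * ((2 * real d + 2) * b) + \<kappa> * b"
  proof (intro add_mono mult_mono mult_left_mono)
    show "norm a1 \<le> C * r * b" "norm a2 \<le> C * r * b"
      using p q bd z y unfolding a1_def a2_def pair_bounded_def by (blast intro: motion)+
    show "norm (velocity d ?R (y * \<omega>)) \<le> (2 * real d + 2) * b"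
      by (rule norm_velocity_le[OF y(1) bd(2) d])
    show "norm a3 \<le> \<kappa> * b" unfolding a3_def y_def by (rule \<kappa>[OF bd(2)])
  qed (use z in auto)
  finally show ?thesis by (simp add: algebra_simps)
qed

text \<open>
  At \<open>t / k\<close> the gaps are \<open>o(1 / k)\<close>: the linear part \<open>2 \<pi> \<i> m / k\<close> cancels the rotation
  \<open>cis (2 \<pi> m / k) - 1\<close> to first order. A correction in the span of the dual directions, found by
  Newton iteration with the derivative frozen at the base pair, makes the gaps vanish, and it has
  the size of the error, which is \<open>o(1 / k)\<close>.
\<close>
lemma shadowing_along_direction:
  fixes z :: "'i \<Rightarrow> complex" and t :: "nat + nat \<Rightarrow> complex" and m :: "'i \<Rightarrow> int"
  assumes d: "d \<ge> 2" and \<rho>: "\<rho> > 0" and C: "C \<ge> 0" and \<xi>: "circle_motion d \<rho> C \<xi>"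
    and c: "norm c = 1" and J: "finite J" and z: "\<And>i. i \<in> J \<Longrightarrow> norm (z i) = 1"
    and dual: "\<And>i l. i \<in> J \<Longrightarrow> l \<in> J \<Longrightarrow> gap_velocity d c (v l) (z i) = (if i = l then 1 else 0)"
    and t: "\<And>i. i \<in> J \<Longrightarrow> gap_velocity d c t (z i) = 2 * of_real pi * \<i> * of_int (m i)"
    and e: "e > 0"
  shows "\<forall>\<^sub>F k in sequentially. \<exists>q. pair_bounded d (e / real k) (\<lambda>j. q j - t j / of_nat k) \<and>
           (\<forall>i\<in>J. gap \<xi> c q (z i) (cis (2 * pi * of_int (m i) / real k)) = 0)"
proof -
  define B where "B = (\<Sum>j\<in>Inl ` {..2 * d + 1} \<union> Inr ` {..2 * d + 1}. \<Sum>l\<in>J. norm (v l j)) + 1"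
  define \<tau> where "\<tau> = (\<Sum>j\<in>Inl ` {..2 * d + 1} \<union> Inr ` {..2 * d + 1}. norm (t j))"
  have B1: "B \<ge> 1" unfolding B_def by (simp add: sum_nonneg)
  have \<tau>0: "\<tau> \<ge> 0" unfolding \<tau>_def by (simp add: sum_nonneg)
  have pb: "pair_bounded d r q \<longleftrightarrow> (\<forall>j\<in>Inl ` {..2 * d + 1} \<union> Inr ` {..2 * d + 1}. norm (q j) \<le> r)" for r q
    unfolding pair_bounded_def bounded_by_def by auto
  have comb: "pair_bounded d (B * b) (\<lambda>j. \<Sum>l\<in>J. a l * v l j)" if a: "\<forall>l. norm (a l) \<le> b" for a b
    unfolding pb
  proof
    fix j assume j: "j \<in> Inl ` {..2 * d + 1} \<union> Inr ` {..2 * d + 1}"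
    have b: "b \<ge> 0" using a norm_ge_zero order_trans by blast
    have "norm (\<Sum>l\<in>J. a l * v l j) \<le> (\<Sum>l\<in>J. b * norm (v l j))"
      using a by (intro sum_norm_le) (auto simp: norm_mult intro!: mult_right_mono)
    also have "\<dots> = b * (\<Sum>l\<in>J. norm (v l j))" by (simp add: sum_distrib_left)
    also have "\<dots> \<le> b * B"
    proof (rule mult_left_mono[OF _ b])
      have "(\<Sum>l\<in>J. norm (v l j)) \<le> (\<Sum>j\<in>Inl ` {..2 * d + 1} \<union> Inr ` {..2 * d + 1}. \<Sum>l\<in>J. norm (v l j))"
        using j by (intro member_le_sum) (auto intro: sum_nonneg)
      then show "(\<Sum>l\<in>J. norm (v l j)) \<le> B" by (simp add: B_def)
    qed
    finally show "norm (\<Sum>l\<in>J. a l * v l j) \<le> B * b" by (simp only: mult.commute)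
  qed
  have t_bd: "pair_bounded d \<tau> t" unfolding pb \<tau>_def by (auto intro!: member_le_sum)
  \<comment> \<open>\<open>\<eta> / k\<close> is the radius for the correction, and \<open>\<mu>\<close> a Lipschitz error for which the
    iteration halves distances and moves the centre by at most half the radius\<close>
  define \<eta> where "\<eta> = e / B"
  define \<mu> where "\<mu> = min (1 / (2 * B)) (\<eta> / (4 * (\<tau> + 1)))"
  have \<eta>: "\<eta> > 0" "B * \<eta> = e" using e B1 by (auto simp: \<eta>_def)
  have \<mu>: "\<mu> > 0" "\<mu> * B \<le> 1 / 2" "\<mu> * \<tau> \<le> \<eta> / 4"
  proof -
    show "\<mu> > 0" using \<eta> B1 \<tau>0 by (simp add: \<mu>_def)
    have "\<mu> * B \<le> 1 / (2 * B) * B" using B1 by (intro mult_right_mono) (auto simp: \<mu>_def)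
    then show "\<mu> * B \<le> 1 / 2" using B1 by simp
    have "\<mu> * \<tau> \<le> \<eta> / (4 * (\<tau> + 1)) * \<tau>" using \<tau>0 by (intro mult_right_mono) (auto simp: \<mu>_def)
    also have "\<dots> = \<eta> / 4 * (\<tau> / (\<tau> + 1))" using \<tau>0 by (simp add: field_simps)
    also have "\<dots> \<le> \<eta> / 4 * 1" using \<tau>0 \<eta> by (intro mult_left_mono) auto
    finally show "\<mu> * \<tau> \<le> \<eta> / 4" by simp
  qed
  define \<omega> where "\<omega> k i = cis (2 * pi * of_int (m i) / real k)" for k i
  have \<omega>1: "norm (\<omega> k i) = 1" for k i by (simp add: \<omega>_def)
  have \<omega>_exp: "\<omega> k i = exp (2 * of_real pi * \<i> * of_int (m i) / of_nat k)" for k i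
    by (simp add: \<omega>_def cis_conv_exp mult_ac)
  have ev1: "\<forall>\<^sub>F k in sequentially. norm (of_nat k * (\<omega> k i - 1) - 2 * of_real pi * \<i> * of_int (m i)) < \<eta> / 4" for i
    using tendstoD[OF exp_difference_quotient, of "\<eta> / 4"] \<eta> unfolding \<omega>_exp dist_norm by simp
  have \<omega>_lim: "(\<lambda>k. \<omega> k i) \<longlonglongrightarrow> 1" for i
  proof -
    have "(\<lambda>k. 2 * of_real pi * \<i> * of_int (m i) / of_nat k) \<longlonglongrightarrow> (0 :: complex)"
      by (rule tendsto_divide_0[OF tendsto_const tendsto_of_nat])
    from tendsto_exp[OF this] show ?thesis unfolding \<omega>_exp by simp
  qed
  have ev2: "\<forall>\<^sub>F k in sequentially. norm (\<omega> k i - 1) * (2 * real d + 2) < \<mu> / 3" for i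
  proof -
    have "(\<lambda>k. norm (\<omega> k i - 1) * (2 * real d + 2)) \<longlonglongrightarrow> norm (1 - 1 :: complex) * (2 * real d + 2)"
      by (intro tendsto_intros \<omega>_lim)
    from order_tendstoD(2)[OF this, of "\<mu> / 3"] show ?thesis using \<mu> by simp
  qed
  have inv: "(\<lambda>k. a / real k) \<longlonglongrightarrow> 0" for a
    by (rule tendsto_divide_0[OF tendsto_const filterlim_real_sequentially[THEN filterlim_at_top_imp_at_infinity]])
  have ev3: "\<forall>\<^sub>F k in sequentially. 2 * C * ((\<tau> + e) / real k) < \<mu> / 3"
  proof -
    have "(\<lambda>k. 2 * C * ((\<tau> + e) / real k)) \<longlonglongrightarrow> 2 * C * 0" by (intro tendsto_intros inv)
    from order_tendstoD(2)[OF this, of "\<mu> / 3"] show ?thesis using \<mu> by simp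
  qed
  have ev4: "\<forall>\<^sub>F k in sequentially. (\<tau> + e) / real k < \<rho>"
    using order_tendstoD(2)[OF inv \<rho>] .
  have ev5: "\<forall>\<^sub>F k in sequentially. \<forall>u b. bounded_by d b u \<longrightarrow>
      norm (velocity d u (z i / c * \<omega> k i) - velocity d u (z i / c)) \<le> \<mu> / 3 * b" if "i \<in> J" for i
  proof (rule velocity_equicontinuous[OF d])
    show "(\<lambda>k. z i / c * \<omega> k i) \<longlonglongrightarrow> z i / c" using tendsto_mult[OF tendsto_const \<omega>_lim, of "z i / c"] by simp
  qed (use z[OF that] c \<mu> \<omega>1 in \<open>auto simp: norm_mult norm_divide\<close>)
  have "\<forall>\<^sub>F k in sequentially. k > 0 \<and> 2 * C * ((\<tau> + e) / real k) < \<mu> / 3 \<and> (\<tau> + e) / real k < \<rho> \<and>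
     (\<forall>i\<in>J. norm (of_nat k * (\<omega> k i - 1) - 2 * of_real pi * \<i> * of_int (m i)) < \<eta> / 4 \<and>
        norm (\<omega> k i - 1) * (2 * real d + 2) < \<mu> / 3 \<and>
        (\<forall>u b. bounded_by d b u \<longrightarrow> norm (velocity d u (z i / c * \<omega> k i) - velocity d u (z i / c)) \<le> \<mu> / 3 * b))"
    using J ev1 ev2 ev5 ev3 ev4 by (auto intro!: eventually_conj eventually_ball_finite eventually_gt_at_top)
  then show ?thesis
  proof (rule eventually_mono)
    fix k
    assume k: "k > 0 \<and> 2 * C * ((\<tau> + e) / real k) < \<mu> / 3 \<and> (\<tau> + e) / real k < \<rho> \<and>
     (\<forall>i\<in>J. norm (of_nat k * (\<omega> k i - 1) - 2 * of_real pi * \<i> * of_int (m i)) < \<eta> / 4 \<and>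
        norm (\<omega> k i - 1) * (2 * real d + 2) < \<mu> / 3 \<and>
        (\<forall>u b. bounded_by d b u \<longrightarrow> norm (velocity d u (z i / c * \<omega> k i) - velocity d u (z i / c)) \<le> \<mu> / 3 * b))"
    then have k0: "real k > 0" by simp
    define r where "r = (\<tau> + e) / real k"
    define h where "h = \<eta> / real k"
    have h: "h > 0" "B * h = e / real k" using \<eta> k0 by (auto simp: h_def)
    \<comment> \<open>the pair with correction coefficients \<open>a\<close>, and its gaps\<close>
    define q where "q a j = t j / of_nat k + (\<Sum>l\<in>J. a l * v l j)" for a j
    define G where "G a i = gap \<xi> c (q a) (z i) (\<omega> k i)" for a i
    have var: "norm (gap \<xi> c p (z i) (\<omega> k i) - gap \<xi> c p' (z i) (\<omega> k i) - gap_velocity d c (\<lambda>j. p j - p' j) (z i)) \<le> \<mu> * b"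
      if "i \<in> J" "pair_bounded d r p" "pair_bounded d r p'" "pair_bounded d b (\<lambda>j. p j - p' j)" for p p' b i
    proof -
      have "norm (p (Inl 0) - p' (Inl 0)) \<le> b" using that(4) unfolding pb by auto
      then have b: "b \<ge> 0" by (rule order_trans[OF norm_ge_zero])
      have "norm (gap \<xi> c p (z i) (\<omega> k i) - gap \<xi> c p' (z i) (\<omega> k i) - gap_velocity d c (\<lambda>j. p j - p' j) (z i))
          \<le> (2 * C * r + norm (\<omega> k i - 1) * (2 * real d + 2) + \<mu> / 3) * b"
        by (rule gap_variation[OF d \<xi> z[OF that(1)] c \<omega>1 _ that(2-4)])
          (use k that(1) in \<open>auto simp: r_def\<close>)
      also have "\<dots> \<le> \<mu> * b"
      proof (rule mult_right_mono[OF _ b])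
        have "2 * C * r < \<mu> / 3" "norm (\<omega> k i - 1) * (2 * real d + 2) < \<mu> / 3"
          using k that(1) unfolding r_def by blast+
        then show "2 * C * r + norm (\<omega> k i - 1) * (2 * real d + 2) + \<mu> / 3 \<le> \<mu>" by linarith
      qed
      finally show ?thesis .
    qed
    have tk: "pair_bounded d (\<tau> / real k) (\<lambda>j. t j / of_nat k)"
      using t_bd k0 unfolding pb by (auto simp: norm_divide divide_right_mono)
    have q_diff: "pair_bounded d (B * b) (\<lambda>j. q a j - q a' j)" if "\<forall>l. norm (a l - a' l) \<le> b" for a a' b
      using comb[OF that] by (simp add: q_def algebra_simps sum_subtractf)
    have q_bd: "pair_bounded d r (q a)" if "\<forall>l. norm (a l) \<le> h" for a
    proof -
      have "norm (q a j) \<le> \<tau> / real k + B * h" if "j \<in> Inl ` {..2 * d + 1} \<union> Inr ` {..2 * d + 1}" for j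
        unfolding q_def
        using tk comb[OF \<open>\<forall>l. norm (a l) \<le> h\<close>] that unfolding pb by (intro norm_triangle_mono) blast+
      then show ?thesis unfolding pb r_def h(2) by (simp add: add_divide_distrib)
    qed
    have gv: "gap_velocity d c (\<lambda>j. q a j - q a' j) (z i) = a i - a' i" if "i \<in> J" for a a' i
    proof -
      have "(\<lambda>j. q a j - q a' j) = (\<lambda>j. \<Sum>l\<in>J. (a l - a' l) * v l j)"
        by (auto simp: q_def algebra_simps sum_subtractf)
      then have "gap_velocity d c (\<lambda>j. q a j - q a' j) (z i) = (\<Sum>l\<in>J. (a l - a' l) * (if i = l then 1 else 0))"
        using that by (simp add: gap_velocity_sum[OF J] dual)
      then show ?thesis using J that by (simp add: if_distrib[of "(*) _"] cong: if_cong)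
    qed
    define S where "S a i = (if i \<in> J then a i - G a i else 0)" for a i
    have contr: "\<forall>i. norm (S a i - S a' i) \<le> 1 / 2 * b"
      if a: "\<forall>l. norm (a l) \<le> h" and a': "\<forall>l. norm (a' l) \<le> h" and aa': "\<forall>l. norm (a l - a' l) \<le> b" for a a' b
    proof
      fix i
      have b: "b \<ge> 0" using aa' norm_ge_zero order_trans by blast
      show "norm (S a i - S a' i) \<le> 1 / 2 * b"
      proof (cases "i \<in> J")
        case True
        have "norm (S a i - S a' i) = norm (G a i - G a' i - (a i - a' i))"
          using True by (subst norm_minus_commute) (simp add: S_def algebra_simps)
        also have "\<dots> \<le> \<mu> * (B * b)"
          using var[OF True q_bd[OF a] q_bd[OF a'] q_diff[OF aa']] unfolding gv[OF True] G_def .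
        also have "\<dots> = (\<mu> * B) * b" by simp
        also have "\<dots> \<le> 1 / 2 * b" using \<mu> b by (intro mult_right_mono)
        finally show ?thesis .
      next
        case False
        then show ?thesis using b by (simp add: S_def)
      qed
    qed
    have S0: "norm (S (\<lambda>_. 0) i) \<le> h / 2" for i
    proof (cases "i \<in> J")
      case True
      have q0: "q (\<lambda>_. 0) = (\<lambda>j. t j / of_nat k)" by (simp add: q_def fun_eq_iff)
      have r0: "0 \<le> r" "r \<le> \<rho>" using \<tau>0 e k0 k by (auto simp: r_def)
      have zero: "pair_bounded d 0 (\<lambda>_. 0)" unfolding pb by auto
      have \<xi>0: "\<xi> (\<lambda>_. 0) y = 0" if "norm y = 1" for y
      proof -
        have "norm (\<xi> (\<lambda>_. 0) y) \<le> C * 0"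
        proof -
          have "bounded_by d 0 (\<lambda>_. 0)" by (simp add: bounded_by_def)
          then show ?thesis using \<xi> \<rho> that less_imp_le unfolding circle_motion_def by blast
        qed
        then show ?thesis by simp
      qed
      have g0: "gap \<xi> c (\<lambda>_. 0) (z i) (\<omega> k i) = 1 - \<omega> k i"
        using z[OF True] c \<omega>1 by (simp add: gap_def comp_def \<xi>0 norm_mult norm_divide)
      have gt: "gap_velocity d c (\<lambda>j. t j / of_nat k) (z i) = 2 * of_real pi * \<i> * of_int (m i) / of_nat k"
        using gap_velocity_scale[of d c "1 / of_nat k" t "z i"] t[OF True] by simp
      have "norm (G (\<lambda>_. 0) i - (1 - \<omega> k i) - 2 * of_real pi * \<i> * of_int (m i) / of_nat k) \<le> \<mu> * (\<tau> / real k)"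
        using var[OF True q_bd[of "\<lambda>_. 0"], of "\<lambda>_. 0" "\<tau> / real k"] zero tk h r0
        unfolding G_def q0 g0 by (auto simp: gt pb)
      also have "\<dots> \<le> h / 4" using \<mu>(3) k0 by (simp add: h_def field_simps)
      finally have 1: "norm (G (\<lambda>_. 0) i - (1 - \<omega> k i) - 2 * of_real pi * \<i> * of_int (m i) / of_nat k) \<le> h / 4" .
      have "norm (of_nat k * (\<omega> k i - 1) - 2 * of_real pi * \<i> * of_int (m i)) < \<eta> / 4" using k True by blast
      then have "norm (of_nat k * (\<omega> k i - 1) - 2 * of_real pi * \<i> * of_int (m i)) / real k \<le> \<eta> / 4 / real k"
        using k0 by (intro divide_right_mono) auto
      also have "norm (of_nat k * (\<omega> k i - 1) - 2 * of_real pi * \<i> * of_int (m i)) / real k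
          = norm ((of_nat k * (\<omega> k i - 1) - 2 * of_real pi * \<i> * of_int (m i)) / of_nat k)"
        by (simp add: norm_divide)
      also have "(of_nat k * (\<omega> k i - 1) - 2 * of_real pi * \<i> * of_int (m i)) / of_nat k
          = (\<omega> k i - 1) - 2 * of_real pi * \<i> * of_int (m i) / of_nat k"
        using k0 by (simp add: diff_divide_distrib)
      finally have 2: "norm ((\<omega> k i - 1) - 2 * of_real pi * \<i> * of_int (m i) / of_nat k) \<le> h / 4"
        by (simp add: h_def)
      have "G (\<lambda>_. 0) i = (G (\<lambda>_. 0) i - (1 - \<omega> k i) - 2 * of_real pi * \<i> * of_int (m i) / of_nat k)
           - ((\<omega> k i - 1) - 2 * of_real pi * \<i> * of_int (m i) / of_nat k)" by simp
      then have "norm (G (\<lambda>_. 0) i) \<le> norm (G (\<lambda>_. 0) i - (1 - \<omega> k i) - 2 * of_real pi * \<i> * of_int (m i) / of_nat k)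
           + norm ((\<omega> k i - 1) - 2 * of_real pi * \<i> * of_int (m i) / of_nat k)"
        by (metis norm_triangle_ineq4)
      also have "\<dots> \<le> h / 4 + h / 4" by (intro add_mono 1 2)
      finally have "norm (G (\<lambda>_. 0) i) \<le> h / 4 + h / 4" .
      then show ?thesis using True by (simp add: S_def)
    qed (use h in \<open>simp add: S_def\<close>)
    have self: "\<forall>i. norm (S a i) \<le> h" if "\<forall>i. norm (a i) \<le> h" for a
    proof
      fix i
      have "norm (S a i - S (\<lambda>_. 0) i) \<le> 1 / 2 * h"
        using contr[OF that, of "\<lambda>_. 0" h] that h by auto
      then show "norm (S a i) \<le> h" using S0[of i] norm_triangle_sub[of "S a i" "S (\<lambda>_. 0) i"] by simp
    qed
    obtain a where a: "\<forall>i. norm (a i) \<le> h" "S a = a"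
      by (rule sup_contraction[of "1 / 2" h S]) (use self contr h in auto)
    have "G a i = 0" if "i \<in> J" for i
    proof -
      have "S a i = a i" using a by simp
      then show ?thesis using that by (simp add: S_def)
    qed
    moreover have "pair_bounded d (e / real k) (\<lambda>j. q a j - t j / of_nat k)"
      using comb[OF a(1)] h by (simp add: q_def)
    ultimately show "\<exists>q. pair_bounded d (e / real k) (\<lambda>j. q j - t j / of_nat k) \<and>
           (\<forall>i\<in>J. gap \<xi> c q (z i) (cis (2 * pi * of_int (m i) / real k)) = 0)"
      unfolding G_def \<omega>_def by blast
  qed
qed


section \<open>Polynomial functions\<close>

text \<open>
  Polynomial functions in possibly infinitely many variables. An inductive description suffices
  because only evaluation, restriction to lines and the expansion along rays are at stake.
\<close>
inductive_set polyfuns :: "(('i \<Rightarrow> complex) \<Rightarrow> complex) set" where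
  polyfuns_const: "(\<lambda>_. c) \<in> polyfuns"
| polyfuns_coord: "(\<lambda>x. x i) \<in> polyfuns"
| polyfuns_add: "f \<in> polyfuns \<Longrightarrow> g \<in> polyfuns \<Longrightarrow> (\<lambda>x. f x + g x) \<in> polyfuns"
| polyfuns_mult: "f \<in> polyfuns \<Longrightarrow> g \<in> polyfuns \<Longrightarrow> (\<lambda>x. f x * g x) \<in> polyfuns"

lemma polyfuns_sum: "(\<And>a. a \<in> A \<Longrightarrow> f a \<in> polyfuns) \<Longrightarrow> (\<lambda>x. \<Sum>a\<in>A. f a x) \<in> polyfuns"
  by (induction A rule: infinite_finite_induct) (auto intro: polyfuns.intros)

lemma polyfuns_prod: "(\<And>a. a \<in> A \<Longrightarrow> f a \<in> polyfuns) \<Longrightarrow> (\<lambda>x. \<Prod>a\<in>A. f a x) \<in> polyfuns"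
  by (induction A rule: infinite_finite_induct) (auto intro: polyfuns.intros)

lemma polyfuns_power: "f \<in> polyfuns \<Longrightarrow> (\<lambda>x. f x ^ n) \<in> polyfuns"
  by (induction n) (auto intro: polyfuns.intros)

lemma polyfuns_substitute:
  assumes "H \<in> polyfuns" "\<And>i. (\<lambda>x. L x i) \<in> polyfuns"
  shows "(\<lambda>x. H (L x)) \<in> polyfuns"
  using assms(1) by induction (auto intro: polyfuns.intros assms(2))

lemma polyfuns_cmpoly_eval: "cmpoly_eval F \<in> polyfuns"
proof -
  have "(\<lambda>z. \<Sum>t\<in>Poly_Mapping.keys F. Poly_Mapping.lookup F t * (\<Prod>k\<in>Poly_Mapping.keys t. z k ^ Poly_Mapping.lookup t k)) \<in> polyfuns"
    by (intro polyfuns_sum polyfuns_prod polyfuns_mult polyfuns_const polyfuns_power polyfuns_coord)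
  then show ?thesis by (simp add: cmpoly_eval_def[abs_def] monom_eval_def)
qed

lemma polyfuns_tendsto:
  assumes "H \<in> polyfuns" "\<And>i. ((\<lambda>n. T n i) \<longlongrightarrow> t i) F"
  shows "((\<lambda>n. H (T n)) \<longlongrightarrow> H t) F"
  using assms(1) by induction (auto intro: tendsto_intros assms(2))

lemma polyfuns_on_line:
  assumes "H \<in> polyfuns"
  shows "\<exists>p. \<forall>x. H (\<lambda>i. a i + x * b i) = poly p x"
  using assms
proof induction
  case (polyfuns_const c)
  show ?case by (rule exI[of _ "[:c:]"]) simp
next
  case (polyfuns_coord i)
  show ?case by (rule exI[of _ "[:a i, b i:]"]) simp
next
  case (polyfuns_add f g)
  then obtain p q where "\<forall>x. f (\<lambda>i. a i + x * b i) = poly p x" "\<forall>x. g (\<lambda>i. a i + x * b i) = poly q x" by blast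
  then show ?case by (intro exI[of _ "p + q"]) simp
next
  case (polyfuns_mult f g)
  then obtain p q where "\<forall>x. f (\<lambda>i. a i + x * b i) = poly p x" "\<forall>x. g (\<lambda>i. a i + x * b i) = poly q x" by blast
  then show ?case by (intro exI[of _ "p * q"]) simp
qed

text \<open>
  Collecting the powers of \<open>s\<close> in \<open>H(s t)\<close> exhibits the homogeneous components of \<open>H\<close> as the coefficients
  of a polynomial in \<open>s\<close> that depends on \<open>t\<close>.
\<close>
lemma polyfuns_homogeneous_expansion:
  fixes H :: "('i \<Rightarrow> complex) \<Rightarrow> complex"
  assumes "H \<in> polyfuns"
  shows "\<exists>P M. (\<forall>t. degree (P t) \<le> M) \<and> (\<forall>m. (\<lambda>t. coeff (P t) m) \<in> polyfuns) \<and>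
           (\<forall>s t. H (\<lambda>i. s * t i) = poly (P t) s)"
  using assms
proof induction
  case (polyfuns_const c)
  show ?case
    by (rule exI[of _ "\<lambda>_. [:c:]"], rule exI[of _ 0]) (auto intro: polyfuns.intros)
next
  case (polyfuns_coord i)
  have "(\<lambda>t :: 'i \<Rightarrow> complex. coeff [:0, t i:] m) \<in> polyfuns" for m
    by (cases m; cases "m - 1") (auto intro: polyfuns.intros simp: coeff_pCons split: nat.splits)
  then show ?case
    by (intro exI[of _ "\<lambda>t. [:0, t i:]"] exI[of _ 1]) auto
next
  case (polyfuns_add f g)
  then obtain P M Q N where
    P: "\<And>t. degree (P t) \<le> M" "\<And>m. (\<lambda>t. coeff (P t) m) \<in> polyfuns" "\<And>s t. f (\<lambda>i. s * t i) = poly (P t) s" and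
    Q: "\<And>t. degree (Q t) \<le> N" "\<And>m. (\<lambda>t. coeff (Q t) m) \<in> polyfuns" "\<And>s t. g (\<lambda>i. s * t i) = poly (Q t) s"
    by blast
  have "degree (P t + Q t) \<le> max M N" for t
    using P(1) Q(1) by (meson degree_add_le max.coboundedI1 max.coboundedI2)
  moreover have "(\<lambda>t. coeff (P t + Q t) m) \<in> polyfuns" for m
    unfolding coeff_add by (intro polyfuns.polyfuns_add P(2) Q(2))
  ultimately show ?case using P(3) Q(3) by (intro exI[of _ "\<lambda>t. P t + Q t"] exI[of _ "max M N"]) simp
next
  case (polyfuns_mult f g)
  then obtain P M Q N where
    P: "\<And>t. degree (P t) \<le> M" "\<And>m. (\<lambda>t. coeff (P t) m) \<in> polyfuns" "\<And>s t. f (\<lambda>i. s * t i) = poly (P t) s" and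
    Q: "\<And>t. degree (Q t) \<le> N" "\<And>m. (\<lambda>t. coeff (Q t) m) \<in> polyfuns" "\<And>s t. g (\<lambda>i. s * t i) = poly (Q t) s"
    by blast
  have "degree (P t * Q t) \<le> M + N" for t
    using P(1) Q(1) by (meson degree_mult_le add_mono order_trans)
  moreover have "(\<lambda>t. coeff (P t * Q t) m) \<in> polyfuns" for m
    unfolding coeff_mult by (intro polyfuns_sum polyfuns.polyfuns_mult P(2) Q(2))
  ultimately show ?case using P(3) Q(3) by (intro exI[of _ "\<lambda>t. P t * Q t"] exI[of _ "M + N"]) simp
qed

text \<open>
  \<open>G\<close> is the component of least degree, say \<open>m\<close>, that is not identically zero. Then
  \<open>H(s T) / s\<^sup>m\<close> tends to \<open>G(t)\<close> as \<open>s\<close> tends to 0 and \<open>T\<close> to \<open>t\<close>.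
\<close>
lemma polyfuns_leading_form:
  fixes H :: "('i \<Rightarrow> complex) \<Rightarrow> complex"
  assumes H: "H \<in> polyfuns" and nz: "H t1 \<noteq> 0"
  obtains G t0 where "G \<in> polyfuns" "G t0 \<noteq> 0"
    "\<And>t (T :: nat \<Rightarrow> 'i \<Rightarrow> complex) s. \<lbrakk>G t \<noteq> 0; \<And>i. (\<lambda>n. T n i) \<longlonglongrightarrow> t i; s \<longlonglongrightarrow> 0; \<And>n. s n \<noteq> 0\<rbrakk> \<Longrightarrow>
       \<forall>\<^sub>F n in sequentially. H (\<lambda>i. s n * T n i) \<noteq> 0"
proof -
  obtain P M where P: "\<And>t. degree (P t) \<le> M" "\<And>m. (\<lambda>t. coeff (P t) m) \<in> polyfuns" "\<And>s t. H (\<lambda>i. s * t i) = poly (P t) s"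
    using polyfuns_homogeneous_expansion[OF H] by blast
  have "poly (P t1) 1 \<noteq> 0" using P(3)[of 1 t1] nz by simp
  then have "P t1 \<noteq> 0" by auto
  then have ex: "\<exists>m t. coeff (P t) m \<noteq> 0" by (metis leading_coeff_0_iff)
  define m where "m = (LEAST m. \<exists>t. coeff (P t) m \<noteq> 0)"
  have "\<exists>t. coeff (P t) m \<noteq> 0" unfolding m_def using ex by (rule LeastI_ex)
  then obtain t0 where t0: "coeff (P t0) m \<noteq> 0" by blast
  have low: "coeff (P t) i = 0" if "i < m" for t i using not_less_Least that unfolding m_def by blast
  have expand: "poly (P t) x = x ^ m * (\<Sum>j\<le>M. coeff (P t) (m + j) * x ^ j)" for t x
  proof -
    have "poly (P t) x = (\<Sum>i\<le>m + M. coeff (P t) i * x ^ i)"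
      unfolding poly_altdef by (rule sum.mono_neutral_left) (use P(1)[of t] in \<open>auto intro: coeff_eq_0\<close>)
    also have "\<dots> = (\<Sum>i\<in>{m..m + M}. coeff (P t) i * x ^ i)"
      by (rule sum.mono_neutral_right) (auto simp: low)
    also have "\<dots> = (\<Sum>j\<le>M. coeff (P t) (m + j) * x ^ (m + j))"
      by (rule sum.reindex_bij_witness[of _ "\<lambda>j. m + j" "\<lambda>i. i - m"]) auto
    finally show ?thesis by (simp add: sum_distrib_left power_add mult_ac)
  qed
  show thesis
  proof (rule that[of "\<lambda>t. coeff (P t) m" t0])
    fix t :: "'i \<Rightarrow> complex" and T :: "nat \<Rightarrow> 'i \<Rightarrow> complex" and s :: "nat \<Rightarrow> complex"
    assume G: "coeff (P t) m \<noteq> 0" and T: "\<And>i. (\<lambda>n. T n i) \<longlonglongrightarrow> t i" and s: "s \<longlonglongrightarrow> 0" "\<And>n. s n \<noteq> 0"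
    have "(\<lambda>n. \<Sum>j\<le>M. coeff (P (T n)) (m + j) * s n ^ j) \<longlonglongrightarrow> (\<Sum>j\<le>M. coeff (P t) (m + j) * 0 ^ j)"
      by (intro tendsto_sum tendsto_mult tendsto_power s polyfuns_tendsto[OF P(2)] T)
    also have "(\<Sum>j\<le>M. coeff (P t) (m + j) * 0 ^ j) = coeff (P t) m"
      by (simp add: power_0_left if_distrib[of "(*) _"] cong: if_cong)
    finally have "\<forall>\<^sub>F n in sequentially. (\<Sum>j\<le>M. coeff (P (T n)) (m + j) * s n ^ j) \<noteq> 0"
      using G by (rule tendsto_imp_eventually_ne)
    then show "\<forall>\<^sub>F n in sequentially. H (\<lambda>i. s n * T n i) \<noteq> 0"
      by (rule eventually_mono) (simp add: P(3) expand s)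
  qed (use P t0 in auto)
qed

text \<open>
  The conditions are met one after the other: moving along the \<open>l\<close>-th dual direction changes only
  the \<open>l\<close>-th linear form. On that line \<open>G\<close> is a nonzero polynomial of one variable, so it vanishes at
  finitely many of the infinitely many points where the form takes a lattice value.
\<close>
lemma polyfuns_nonzero_at_lattice_point:
  fixes D :: "'k \<Rightarrow> ('i \<Rightarrow> complex) \<Rightarrow> complex"
  assumes G: "G \<in> polyfuns" "G t0 \<noteq> 0" and J: "finite J" and w: "w \<noteq> 0"
    and D: "\<And>i l t x. i \<in> J \<Longrightarrow> l \<in> J \<Longrightarrow> D i (\<lambda>j. t j + x * v l j) = D i t + (if i = l then x else 0)"
  shows "\<exists>t m. G t \<noteq> 0 \<and> (\<forall>i\<in>J. D i t = w * of_int (m i))"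
proof -
  have "\<exists>t. G t \<noteq> 0 \<and> (\<forall>i\<in>I. \<exists>m. D i t = w * of_int m)" if "finite I" "I \<subseteq> J" for I
    using that
  proof (induction I rule: finite_induct)
    case empty
    show ?case using G by auto
  next
    case (insert l I)
    then obtain t where t: "G t \<noteq> 0" "\<And>i. i \<in> I \<Longrightarrow> \<exists>m. D i t = w * of_int m" by blast
    obtain p where p: "\<And>x. G (\<lambda>j. t j + x * v l j) = poly p x"
      using polyfuns_on_line[OF G(1), of t "v l"] by blast
    have "p \<noteq> 0" using p[of 0] t(1) by auto
    then have "finite {x. poly p x = 0}" by (rule poly_roots_finite)
    moreover have "infinite (range (\<lambda>m::int. w * of_int m - D l t))"
    proof -
      have "inj (\<lambda>m::int. w * of_int m - D l t)" using w by (auto simp: inj_on_def)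
      then show ?thesis using infinite_UNIV_int by (simp add: finite_image_iff)
    qed
    ultimately have "\<not> range (\<lambda>m::int. w * of_int m - D l t) \<subseteq> {x. poly p x = 0}"
      using finite_subset by metis
    then obtain x where x: "x \<in> range (\<lambda>m::int. w * of_int m - D l t)" "x \<notin> {x. poly p x = 0}" by blast
    then obtain m :: int where m: "x = w * of_int m - D l t" by blast
    have "\<exists>m. D i (\<lambda>j. t j + x * v l j) = w * of_int m" if i: "i \<in> insert l I" for i
    proof (cases "i = l")
      case True
      have "D l (\<lambda>j. t j + x * v l j) = D l t + x" using D[of l l t x] insert.prems by simp
      also have "\<dots> = w * of_int m" by (simp add: m)
      finally show ?thesis unfolding True by blast
    next
      case False
      have "D i (\<lambda>j. t j + x * v l j) = D i t" using D[of i l t x] insert.prems i False by auto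
      then show ?thesis using t(2)[of i] i False by simp
    qed
    moreover have "G (\<lambda>j. t j + x * v l j) \<noteq> 0" using x(2) unfolding p by simp
    ultimately show ?case by blast
  qed
  from this[OF J order_refl] obtain t where t: "G t \<noteq> 0" "\<forall>i\<in>J. \<exists>m. D i t = w * of_int m" by blast
  from bchoice[OF t(2)] t(1) show ?thesis by blast
qed


section \<open>From moved roots of unity to points of the projective line\<close>

definition coeff_vector :: "nat \<Rightarrow> (nat \<Rightarrow> complex) \<Rightarrow> nat \<Rightarrow> complex" where
  "coeff_vector d u i = (if i \<le> 2 * d + 1 then u i + (if i = d \<or> i = d + 1 then 1 else 0) else 0)"

text \<open>
  The coefficients of the map \<open>x \<mapsto> c f(x / c)\<close> in terms of those of \<open>f\<close>.
\<close>
definition rotate_coeffs :: "nat \<Rightarrow> complex \<Rightarrow> (nat \<Rightarrow> complex) \<Rightarrow> nat \<Rightarrow> complex" where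
  "rotate_coeffs d c v i = (if i \<le> d then c * v i / c ^ i else v i / c ^ (i - (d + 1)))"

definition proj_class :: "(nat \<Rightarrow> complex) \<Rightarrow> (nat \<Rightarrow> complex) set" where
  "proj_class v = {(\<lambda>i. a * v i) | a. a \<noteq> 0}"

definition affine_point :: "complex \<Rightarrow> nat \<Rightarrow> complex" where
  "affine_point x i = (if i = 0 then x else if i = 1 then 1 else 0)"

lemma proj_class_in_proj_space: "v \<in> hcoords n \<Longrightarrow> proj_class v \<in> proj_space n"
  unfolding proj_space_eq proj_class_def by blast

lemma self_in_proj_class: "v \<in> proj_class v"
  unfolding proj_class_def by (auto intro!: exI[of _ 1])

lemma proj_class_scale:
  assumes "a \<noteq> 0"
  shows "proj_class (\<lambda>i. a * v i) = proj_class v"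
proof
  show "proj_class (\<lambda>i. a * v i) \<subseteq> proj_class v"
  proof
    fix w assume "w \<in> proj_class (\<lambda>i. a * v i)"
    then obtain e where "e \<noteq> 0" "w = (\<lambda>i. e * (a * v i))" unfolding proj_class_def by blast
    then show "w \<in> proj_class v"
      unfolding proj_class_def using assms by (auto simp: mult.assoc intro!: exI[of _ "e * a"])
  qed
  show "proj_class v \<subseteq> proj_class (\<lambda>i. a * v i)"
  proof
    fix w assume "w \<in> proj_class v"
    then obtain e where "e \<noteq> 0" "w = (\<lambda>i. e * v i)" unfolding proj_class_def by blast
    then show "w \<in> proj_class (\<lambda>i. a * v i)"
      unfolding proj_class_def using assms by (auto intro!: exI[of _ "e / a"])
  qed
qed

lemma affine_point_hcoords: "affine_point x \<in> hcoords 1"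
proof -
  have "affine_point x 1 \<noteq> 0" by (simp add: affine_point_def)
  then show ?thesis by (auto simp: hcoords_def affine_point_def fun_eq_iff)
qed

lemma inj_affine_class: "proj_class (affine_point x) = proj_class (affine_point y) \<Longrightarrow> x = y"
proof -
  assume "proj_class (affine_point x) = proj_class (affine_point y)"
  then have "affine_point x \<in> proj_class (affine_point y)" using self_in_proj_class by metis
  then obtain a where a: "\<And>i. affine_point x i = a * affine_point y i"
    unfolding proj_class_def by (auto simp: fun_eq_iff)
  from a[of 0] a[of 1] show "x = y" by (simp add: affine_point_def)
qed

lemma proj_class_in_Rat:
  assumes "v \<in> hcoords (2 * d + 1)" "\<And>x. x \<in> hcoords 1 \<Longrightarrow> form_pair d v x \<noteq> (\<lambda>_. 0)"
  shows "proj_class v \<in> Rat d"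
proof -
  have "form_pair d (\<lambda>i. a * v i) x \<noteq> (\<lambda>_. 0)" if "x \<in> hcoords 1" "a \<noteq> 0" for a x
    using assms(2)[OF that(1)] form_pair_scale[of d a v 1 x] that(2) by (auto simp: fun_eq_iff)
  then show ?thesis
    unfolding Rat_def using proj_class_in_proj_space[OF assms(1)] by (auto simp: proj_class_def)
qed

lemma form_pair_coeffs_affine:
  "form_pair d (coeff_vector d u) (affine_point x) 0 = num d u x"
  "form_pair d (coeff_vector d u) (affine_point x) 1 = den d u x"
proof -
  have 1: "coeff_vector d u j = u j + (if j = d then 1 else 0)" if "j \<le> d" for j
    using that by (auto simp: coeff_vector_def)
  have 2: "coeff_vector d u (d + 1 + j) = u (d + 1 + j) + (if j = 0 then 1 else 0)" if "j \<le> d" for j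
    using that by (auto simp: coeff_vector_def)
  have "form_pair d (coeff_vector d u) (affine_point x) 0 = (\<Sum>j\<le>d. u j * x ^ j + (if j = d then x ^ j else 0))"
    unfolding form_pair_def using 1 by (auto simp: affine_point_def distrib_right intro!: sum.cong)
  then show "form_pair d (coeff_vector d u) (affine_point x) 0 = num d u x"
    by (simp add: num_def sum.distrib)
  have "form_pair d (coeff_vector d u) (affine_point x) 1 = (\<Sum>j\<le>d. u (d + 1 + j) * x ^ j + (if j = 0 then x ^ j else 0))"
    unfolding form_pair_def using 2 by (auto simp: affine_point_def distrib_right intro!: sum.cong)
  then show "form_pair d (coeff_vector d u) (affine_point x) 1 = den d u x"
    by (simp add: den_def sum.distrib)
qed

lemma small_perturbation_nonzero:
  fixes x :: complex and w :: "nat \<Rightarrow> complex"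
  assumes "\<And>j. j \<le> d \<Longrightarrow> norm (w j) \<le> r" "(real d + 1) * r < 1" "norm x \<le> 1"
  shows "1 + (\<Sum>j\<le>d. w j * x ^ f j) \<noteq> 0"
proof
  assume "1 + (\<Sum>j\<le>d. w j * x ^ f j) = 0"
  then have "(\<Sum>j\<le>d. w j * x ^ f j) = - 1" by (simp add: add_eq_0_iff)
  then have "1 = norm (\<Sum>j\<le>d. w j * x ^ f j)" by simp
  also have "\<dots> \<le> (\<Sum>j\<le>d. r)"
  proof (rule sum_norm_le)
    fix j assume j: "j \<in> {..d}"
    have "norm (w j) * norm (x ^ f j) \<le> r * 1"
      using assms j by (intro mult_mono) (auto simp: norm_power power_le_one intro: order_trans[OF norm_ge_zero])
    then show "norm (w j * x ^ f j) \<le> r" by (simp add: norm_mult)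
  qed
  also have "\<dots> < 1" using assms(2) by (simp add: algebra_simps)
  finally show False by simp
qed

text \<open>
  The two closed unit discs around 0 and infinity cover the projective line.
\<close>
lemma hcoords_1_cases:
  assumes "x \<in> hcoords 1"
  obtains y where "x 1 \<noteq> 0" "norm y \<le> 1" "x 0 = x 1 * y" | y where "x 0 \<noteq> 0" "norm y \<le> 1" "x 1 = x 0 * y"
proof -
  have "x 0 \<noteq> 0 \<or> x 1 \<noteq> 0"
  proof (rule ccontr)
    assume "\<not> ?thesis"
    then have "x i = 0" for i using assms by (cases "i > 1") (auto simp: hcoords_def less_Suc_eq not_less le_Suc_eq)
    then show False using assms by (auto simp: hcoords_def fun_eq_iff)
  qed
  then show thesis
  proof (cases "norm (x 0) \<le> norm (x 1)")
    case True
    with \<open>x 0 \<noteq> 0 \<or> x 1 \<noteq> 0\<close> have "x 1 \<noteq> 0" by auto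
    then show thesis using True by (intro that(1)[of "x 0 / x 1"]) (auto simp: norm_divide divide_le_eq)
  next
    case False
    then have "x 0 \<noteq> 0" by auto
    then show thesis using False by (intro that(2)[of "x 1 / x 0"]) (auto simp: norm_divide divide_le_eq)
  qed
qed

text \<open>
  On the disc around 0 the denominator is close to 1, on the disc around infinity the
  numerator is.
\<close>
lemma coeffs_no_common_zero:
  assumes d: "d \<ge> 1" and u: "bounded_by d r u" and r: "(real d + 1) * r < 1" and x: "x \<in> hcoords 1"
  shows "form_pair d (coeff_vector d u) x \<noteq> (\<lambda>_. 0)"
  using x
proof (cases rule: hcoords_1_cases)
  case (1 y)
  have "form_pair d (coeff_vector d u) (\<lambda>i. x 1 * affine_point y i) 1 = x 1 ^ d * den d u y"
    using form_pair_scale[of d 1 "coeff_vector d u" "x 1" "affine_point y"] form_pair_coeffs_affine(2)[of d u y]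
    by (simp del: One_nat_def)
  moreover have "form_pair d (coeff_vector d u) x 1 = form_pair d (coeff_vector d u) (\<lambda>i. x 1 * affine_point y i) 1"
    by (simp add: form_pair_def affine_point_def 1(3))
  moreover have "den d u y \<noteq> 0"
    unfolding den_def by (rule small_perturbation_nonzero[OF _ r 1(2)]) (use u in \<open>auto simp: bounded_by_def\<close>)
  ultimately have "form_pair d (coeff_vector d u) x 1 \<noteq> 0" using 1(1) by simp
  then show ?thesis by auto
next
  case (2 y)
  have "form_pair d (coeff_vector d u) x 0 = (\<Sum>j\<le>d. x 0 ^ d * (u j * y ^ (d - j) + (if j = d then 1 else 0)))"
  proof -
    have "coeff_vector d u j * x 0 ^ j * x 1 ^ (d - j) = x 0 ^ d * (u j * y ^ (d - j) + (if j = d then 1 else 0))"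
      if j: "j \<le> d" for j
    proof -
      have p: "x 0 ^ d = x 0 ^ j * x 0 ^ (d - j)" using j by (simp flip: power_add)
      have "coeff_vector d u j = u j + (if j = d then 1 else 0)" using j by (auto simp: coeff_vector_def)
      then show ?thesis unfolding p 2(3) power_mult_distrib by (auto simp: algebra_simps)
    qed
    then show ?thesis by (simp add: form_pair_def)
  qed
  also have "\<dots> = x 0 ^ d * (1 + (\<Sum>j\<le>d. u j * y ^ (d - j)))"
    unfolding sum_distrib_left[symmetric] sum.distrib by simp
  finally have "form_pair d (coeff_vector d u) x 0 = x 0 ^ d * (1 + (\<Sum>j\<le>d. u j * y ^ (d - j)))" .
  moreover have "1 + (\<Sum>j\<le>d. u j * y ^ (d - j)) \<noteq> 0"
    by (rule small_perturbation_nonzero[OF _ r 2(2)]) (use u in \<open>auto simp: bounded_by_def\<close>)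
  ultimately have "form_pair d (coeff_vector d u) x 0 \<noteq> 0" using 2(1) by simp
  then show ?thesis by auto
qed

lemma form_pair_rotate:
  assumes "c \<noteq> 0"
  shows "form_pair d (rotate_coeffs d c v) (\<lambda>i. if i = 0 then c * x 0 else x i)
    = (\<lambda>i. if i = 0 then c * form_pair d v x 0 else form_pair d v x i)"
proof -
  have "c * v j / c ^ j * (c * x 0) ^ j * y = c * (v j * x 0 ^ j * y)" "w / c ^ j * (c * x 0) ^ j * y = w * x 0 ^ j * y" for j y w
    using assms by (auto simp: power_mult_distrib)
  then show ?thesis
    by (auto simp: form_pair_def rotate_coeffs_def sum_distrib_left fun_eq_iff intro!: sum.cong)
qed

text \<open>
  A map semiconjugate through \<open>h\<close> to \<open>z \<mapsto> z\<^sup>d\<close> on the circle has the images of roots of unity as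
  preperiodic points, since powers of a root of unity take finitely many values.
\<close>
lemma preperiodic_root_of_unity_motion:
  fixes h :: "complex \<Rightarrow> complex"
  assumes f: "f = proj_class v" "f \<in> Rat d" and d: "d \<ge> 1" and N: "N > 0"
    and step: "\<And>z. norm z = 1 \<Longrightarrow> rat_map d f (proj_class (affine_point (h z))) = proj_class (affine_point (h (z ^ d)))"
    and z: "z ^ N = 1"
  shows "proj_class (affine_point (h z)) \<in> Preper d f"
proof -
  have unit: "norm w = 1" if "w ^ N = 1" for w :: complex
  proof -
    have "norm w ^ N = 1" using that by (metis norm_power norm_one)
    then show ?thesis using N by (intro power_eq_imp_eq_base[of "norm w" N 1]) auto
  qed
  have zn: "(z ^ (d ^ n)) ^ N = 1" for n
  proof -
    have "(z ^ (d ^ n)) ^ N = z ^ (d ^ n * N)" by (rule power_mult[symmetric])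
    also have "d ^ n * N = N * d ^ n" by (rule mult.commute)
    also have "z ^ (N * d ^ n) = (z ^ N) ^ (d ^ n)" by (rule power_mult)
    also have "\<dots> = 1" using z by simp
    finally show ?thesis .
  qed
  have it: "(rat_map d f ^^ n) (proj_class (affine_point (h z))) = proj_class (affine_point (h (z ^ (d ^ n))))" for n
  proof (induction n)
    case (Suc n)
    have "z ^ (d ^ Suc n) = (z ^ (d ^ n)) ^ d" by (simp only: power_Suc2 power_mult)
    then show ?case using Suc step[OF unit[OF zn[of n]]] by simp
  qed simp
  have "finite {w :: complex. w ^ N = 1}" using N by (intro finite_roots_unity) auto
  moreover have "range (\<lambda>n. z ^ (d ^ n)) \<subseteq> {w. w ^ N = 1}" using zn by auto
  ultimately have "finite (range (\<lambda>n. z ^ (d ^ n)))" using finite_subset by blast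
  then have "\<not> inj (\<lambda>n::nat. z ^ (d ^ n))" using finite_imageD infinite_UNIV_nat by blast
  then obtain m n :: nat where "m \<noteq> n" "z ^ (d ^ m) = z ^ (d ^ n)" unfolding inj_def by blast
  then obtain m n :: nat where mn: "m < n" "z ^ (d ^ m) = z ^ (d ^ n)" by (cases m n rule: linorder_cases) auto
  have "(rat_map d f ^^ m) (proj_class (affine_point (h z))) = (rat_map d f ^^ n) (proj_class (affine_point (h z)))"
    unfolding it mn(2) ..
  then show ?thesis
    unfolding Preper_def using mn(1) proj_class_in_proj_space[OF affine_point_hcoords] by blast
qed

lemma coeffs_hcoords:
  assumes "\<And>x. x \<in> hcoords 1 \<Longrightarrow> form_pair d v x \<noteq> (\<lambda>_. 0)" "\<And>i. i > 2 * d + 1 \<Longrightarrow> v i = 0"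
  shows "v \<in> hcoords (2 * d + 1)"
proof -
  have "form_pair d (\<lambda>_. 0) (affine_point 0) = (\<lambda>_. 0)" by (auto simp: form_pair_def)
  then have "v \<noteq> (\<lambda>_. 0)" using assms(1)[OF affine_point_hcoords] by blast
  then show ?thesis using assms(2) by (simp add: hcoords_def)
qed

lemma coeffs_in_Rat:
  assumes "d \<ge> 1" "bounded_by d r u" "(real d + 1) * r < 1"
  shows "proj_class (coeff_vector d u) \<in> Rat d"
  by (intro proj_class_in_Rat coeffs_hcoords coeffs_no_common_zero[OF assms]) (simp_all add: coeff_vector_def)

lemma rotate_coeffs_in_Rat:
  assumes "d \<ge> 1" "bounded_by d r u" "(real d + 1) * r < 1" and c: "c \<noteq> 0"
  shows "proj_class (rotate_coeffs d c (coeff_vector d u)) \<in> Rat d"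
proof -
  have nz: "form_pair d (rotate_coeffs d c (coeff_vector d u)) x \<noteq> (\<lambda>_. 0)" if x: "x \<in> hcoords 1" for x
  proof -
  define y where "y i = (if i = 0 then x 0 / c else x i)" for i
  have "y \<in> hcoords 1"
  proof -
    obtain i where i: "x i \<noteq> 0" using x by (auto simp: hcoords_def)
    then have "y i \<noteq> 0" using c by (auto simp: y_def)
    then have "y \<noteq> (\<lambda>_. 0)" by auto
    then show ?thesis using x by (auto simp: hcoords_def y_def)
  qed
  then have "form_pair d (coeff_vector d u) y \<noteq> (\<lambda>_. 0)" by (rule coeffs_no_common_zero[OF assms(1-3)])
  then obtain i where i: "form_pair d (coeff_vector d u) y i \<noteq> 0" by auto
  have xy: "x = (\<lambda>i. if i = 0 then c * y 0 else y i)" using c by (auto simp: y_def)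
  have "form_pair d (rotate_coeffs d c (coeff_vector d u)) x i \<noteq> 0"
    unfolding xy form_pair_rotate[OF c] using i c by auto
  then show ?thesis by auto
  qed
  show ?thesis
    by (intro proj_class_in_Rat coeffs_hcoords nz) (simp_all add: rotate_coeffs_def coeff_vector_def)
qed

lemma motion_step:
  assumes d: "d \<ge> 1" and \<xi>: "circle_motion d \<rho> C \<xi>" and r: "r \<le> \<rho>" "(real d + 1) * r < 1"
    and u: "bounded_by d r u" and z: "norm z = 1"
  defines "h \<equiv> \<lambda>z. z * (1 + \<xi> u z)"
  shows "rat_map d (proj_class (coeff_vector d u)) (proj_class (affine_point (h z))) = proj_class (affine_point (h (z ^ d)))"
    and "c \<noteq> 0 \<Longrightarrow> rat_map d (proj_class (rotate_coeffs d c (coeff_vector d u))) (proj_class (affine_point (c * h z)))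
      = proj_class (affine_point (c * h (z ^ d)))"
proof -
  have eq: "num d u (h z) = h (z ^ d) * den d u (h z)"
    using \<xi> bounded_by_mono[OF u r(1)] z unfolding circle_motion_def h_def by blast
  have fp: "form_pair d (coeff_vector d u) (affine_point (h z)) = (\<lambda>i. den d u (h z) * affine_point (h (z ^ d)) i)"
  proof
    fix i :: nat
    consider "i = 0" | "i = 1" | "i > 1" by linarith
    then show "form_pair d (coeff_vector d u) (affine_point (h z)) i = den d u (h z) * affine_point (h (z ^ d)) i"
    proof cases
      case 1
      then show ?thesis using form_pair_coeffs_affine(1)[of d u "h z"] eq by (simp add: affine_point_def)
    next
      case 2
      then show ?thesis using form_pair_coeffs_affine(2)[of d u "h z"] unfolding 2 by (simp add: affine_point_def)
    next
      case 3
      then show ?thesis by (simp add: affine_point_def form_pair_def)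
    qed
  qed
  have nz: "den d u (h z) \<noteq> 0"
  proof
    assume "den d u (h z) = 0"
    then have "form_pair d (coeff_vector d u) (affine_point (h z)) = (\<lambda>_. 0)" unfolding fp by simp
    then show False using coeffs_no_common_zero[OF d u r(2) affine_point_hcoords] by blast
  qed
  have map_eq: "rat_map d (proj_class v) (proj_class x) = proj_class (form_pair d v x)" for v x
    unfolding proj_class_def by (rule rat_map_class)
  show "rat_map d (proj_class (coeff_vector d u)) (proj_class (affine_point (h z))) = proj_class (affine_point (h (z ^ d)))"
    unfolding map_eq fp by (rule proj_class_scale[OF nz])
  show "rat_map d (proj_class (rotate_coeffs d c (coeff_vector d u))) (proj_class (affine_point (c * h z)))
      = proj_class (affine_point (c * h (z ^ d)))" if c: "c \<noteq> 0"
  proof -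
    have "affine_point (c * h z) = (\<lambda>i. if i = 0 then c * affine_point (h z) 0 else affine_point (h z) i)"
      by (auto simp: affine_point_def)
    then have "form_pair d (rotate_coeffs d c (coeff_vector d u)) (affine_point (c * h z))
        = (\<lambda>i. if i = 0 then c * form_pair d (coeff_vector d u) (affine_point (h z)) 0 else form_pair d (coeff_vector d u) (affine_point (h z)) i)"
      using form_pair_rotate[OF c] by simp
    also have "\<dots> = (\<lambda>i. den d u (h z) * affine_point (c * h (z ^ d)) i)"
      unfolding fp by (auto simp: affine_point_def)
    finally show ?thesis unfolding map_eq using proj_class_scale[OF nz] by simp
  qed
qed

text \<open>
  Affine coordinates around the base pair \<open>(x\<^sup>d, c (x / c)\<^sup>d)\<close>, which corresponds to \<open>q = 0\<close>.
\<close>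
definition pair_coords :: "nat \<Rightarrow> complex \<Rightarrow> (nat + nat \<Rightarrow> complex) \<Rightarrow> nat + nat \<Rightarrow> complex" where
  "pair_coords d c q = case_sum (coeff_vector d (q \<circ> Inl)) (rotate_coeffs d c (coeff_vector d (q \<circ> Inr)))"

lemma pair_coords_polyfun: "(\<lambda>q. pair_coords d c q j) \<in> polyfuns"
proof -
  have aff: "(\<lambda>q. coeff_vector d (q \<circ> s) i) \<in> polyfuns" for s :: "nat \<Rightarrow> nat + nat" and i
    unfolding coeff_vector_def comp_def
    by (cases "i \<le> 2 * d + 1") (auto intro: polyfuns_add polyfuns_coord polyfuns_const)
  have "(\<lambda>q. rotate_coeffs d c (coeff_vector d (q \<circ> s)) i) \<in> polyfuns" for s :: "nat \<Rightarrow> nat + nat" and i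
  proof -
    have "(\<lambda>q. (if i \<le> d then c / c ^ i else 1 / c ^ (i - (d + 1))) * coeff_vector d (q \<circ> s) i) \<in> polyfuns"
      by (intro polyfuns_mult polyfuns_const aff)
    also have "(\<lambda>q. (if i \<le> d then c / c ^ i else 1 / c ^ (i - (d + 1))) * coeff_vector d (q \<circ> s) i)
        = (\<lambda>q. rotate_coeffs d c (coeff_vector d (q \<circ> s)) i)"
      by (auto simp: rotate_coeffs_def)
    finally show ?thesis .
  qed
  then show ?thesis unfolding pair_coords_def using aff by (cases j) auto
qed

lemma pair_coords_surj:
  assumes v: "v \<in> hcoords (2 * d + 1)" and w: "w \<in> hcoords (2 * d + 1)" and c: "c \<noteq> 0"
  obtains q where "pair_coords d c q = case_sum v w"
proof -
  define base :: "nat \<Rightarrow> complex" where "base i = (if i = d \<or> i = d + 1 then 1 else 0)" for i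
  define w' where "w' i = (if i \<le> d then w i * c ^ i / c else w i * c ^ (i - (d + 1)))" for i
  define q where "q = case_sum (\<lambda>i. v i - base i) (\<lambda>i. w' i - base i)"
  have 1: "coeff_vector d (q \<circ> Inl) = v"
    using v by (auto simp: coeff_vector_def q_def base_def hcoords_def fun_eq_iff)
  have "w' i = 0" if "i > 2 * d + 1" for i using w that by (auto simp: w'_def hcoords_def)
  then have 2: "coeff_vector d (q \<circ> Inr) = w'" by (auto simp: coeff_vector_def q_def base_def fun_eq_iff)
  have "rotate_coeffs d c w' = w" using c by (auto simp: rotate_coeffs_def w'_def)
  then have "pair_coords d c q = case_sum v w" unfolding pair_coords_def 1 2 by simp
  then show thesis by (rule that)
qed

lemma pair_coords_cong:
  assumes "\<And>j. j \<in> Inl ` {..2 * d + 1} \<union> Inr ` {..2 * d + 1} \<Longrightarrow> p j = q j"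
  shows "pair_coords d c p = pair_coords d c q"
proof -
  have "coeff_vector d (p \<circ> Inl) = coeff_vector d (q \<circ> Inl)" "coeff_vector d (p \<circ> Inr) = coeff_vector d (q \<circ> Inr)"
    using assms by (auto simp: coeff_vector_def fun_eq_iff)
  then show ?thesis by (simp add: pair_coords_def)
qed

text \<open>
  Vanishing gaps make the moved points \<open>z i\<close> preperiodic for both maps. They remain distinct because
  each is displaced by less than half the distance between any two of them.
\<close>
lemma many_common_preperiodic_points:
  fixes z :: "'i \<Rightarrow> complex" and m :: "'i \<Rightarrow> int"
  assumes d: "d \<ge> 2" and \<xi>: "circle_motion d \<rho> C \<xi>" and r: "r \<le> \<rho>" "(real d + 1) * r < 1"
    and q: "pair_bounded d r q" and c: "c ^ (d ^ 4) = 1" and k: "k > 0"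
    and J: "finite J" and z: "\<And>i. i \<in> J \<Longrightarrow> z i ^ (d ^ 4) = 1"
    and sep: "\<And>i l. i \<in> J \<Longrightarrow> l \<in> J \<Longrightarrow> i \<noteq> l \<Longrightarrow> 2 * (C * r) < norm (z i - z l)"
    and gap: "\<And>i. i \<in> J \<Longrightarrow> gap \<xi> c q (z i) (cis (2 * pi * of_int (m i) / real k)) = 0"
  defines "f \<equiv> proj_class (coeff_vector d (q \<circ> Inl))" and "g \<equiv> proj_class (rotate_coeffs d c (coeff_vector d (q \<circ> Inr)))"
  shows "f \<in> Rat d" "g \<in> Rat d" "infinite (Preper d f \<inter> Preper d g) \<or> card (Preper d f \<inter> Preper d g) \<ge> card J"
proof -
  have d1: "d \<ge> 1" using d by simp
  have c0: "c \<noteq> 0" using c d by (auto simp: power_0_left)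
  have u: "bounded_by d r (q \<circ> Inl)" "bounded_by d r (q \<circ> Inr)" using q by (auto simp: pair_bounded_def)
  show f: "f \<in> Rat d" unfolding f_def by (rule coeffs_in_Rat[OF d1 u(1) r(2)])
  show g: "g \<in> Rat d" unfolding g_def by (rule rotate_coeffs_in_Rat[OF d1 u(2) r(2) c0])
  define h where "h u z = z * (1 + \<xi> u z)" for u z
  define P where "P i = proj_class (affine_point (h (q \<circ> Inl) (z i)))" for i
  have unit: "norm w = 1" if "w ^ N = 1" "N > 0" for w :: complex and N
  proof -
    have "norm w ^ N = 1" using that by (metis norm_power norm_one)
    then show ?thesis using that by (intro power_eq_imp_eq_base[of "norm w" N 1]) auto
  qed
  have z1: "norm (z i) = 1" if "i \<in> J" for i using unit[OF z[OF that]] d by simp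
  have "P i \<in> Preper d f" if i: "i \<in> J" for i
    unfolding P_def
  proof (rule preperiodic_root_of_unity_motion[OF f_def[THEN meta_eq_to_obj_eq] f d1 _ _ z[OF i]])
    show "rat_map d f (proj_class (affine_point (h (q \<circ> Inl) z))) = proj_class (affine_point (h (q \<circ> Inl) (z ^ d)))"
      if "norm z = 1" for z
      unfolding f_def h_def by (rule motion_step(1)[OF d1 \<xi> r u(1) that])
  qed (use d in auto)
  moreover have "P i \<in> Preper d g" if i: "i \<in> J" for i
  proof -
    define y where "y = z i / c * cis (2 * pi * of_int (m i) / real k)"
    have "1 + \<xi> (q \<circ> Inl) (z i) = cis (2 * pi * of_int (m i) / real k) * (1 + \<xi> (q \<circ> Inr) y)"
      using gap[OF i] by (simp add: gap_def y_def)
    then have Pi: "h (q \<circ> Inl) (z i) = c * h (q \<circ> Inr) y"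
      using c0 by (simp add: h_def y_def)
    have cis_k: "cis (2 * pi * of_int (m i) / real k) ^ k = 1"
      unfolding Complex.DeMoivre using k by (simp add: cis_multiple_2pi)
    have y: "y ^ (d ^ 4 * k) = 1"
    proof -
      have "y ^ (d ^ 4 * k) = (z i ^ (d ^ 4) / c ^ (d ^ 4)) ^ k * (cis (2 * pi * of_int (m i) / real k) ^ k) ^ (d ^ 4)"
        unfolding y_def power_mult_distrib power_divide by (simp only: power_mult[symmetric] mult.commute[of k] power_divide[symmetric])
      then show ?thesis using z[OF i] c cis_k by simp
    qed
    show ?thesis
      unfolding P_def Pi
    proof (rule preperiodic_root_of_unity_motion[OF g_def[THEN meta_eq_to_obj_eq] g d1 _ _ y, where h = "\<lambda>y. c * h (q \<circ> Inr) y"])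
      show "rat_map d g (proj_class (affine_point (c * h (q \<circ> Inr) z))) = proj_class (affine_point (c * h (q \<circ> Inr) (z ^ d)))"
        if "norm z = 1" for z
        unfolding g_def h_def by (rule motion_step(2)[OF d1 \<xi> r u(2) that c0])
    qed (use d k in auto)
  qed
  ultimately have sub: "P ` J \<subseteq> Preper d f \<inter> Preper d g" by blast
  have "inj_on P J"
  proof (rule inj_onI, rule ccontr)
    fix i l assume il: "i \<in> J" "l \<in> J" "P i = P l" "i \<noteq> l"
    have "h (q \<circ> Inl) (z i) = h (q \<circ> Inl) (z l)" using il(3) unfolding P_def by (rule inj_affine_class)
    then have "z i - z l = z l * \<xi> (q \<circ> Inl) (z l) - z i * \<xi> (q \<circ> Inl) (z i)" by (simp add: h_def algebra_simps)
    also have "norm \<dots> \<le> norm (\<xi> (q \<circ> Inl) (z l)) + norm (\<xi> (q \<circ> Inl) (z i))"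
      by (rule order_trans[OF norm_triangle_ineq4]) (simp add: norm_mult z1 il)
    also have "\<dots> \<le> C * r + C * r"
      using \<xi> r(1) u(1) z1 il unfolding circle_motion_def by (intro add_mono) blast+
    finally show False using sep[OF il(1,2,4)] by simp
  qed
  then have "card (P ` J) = card J" by (rule card_image)
  then show "infinite (Preper d f \<inter> Preper d g) \<or> card (Preper d f \<inter> Preper d g) \<ge> card J"
    using card_mono[OF _ sub] by metis
qed


section \<open>Density\<close>

text \<open>
  A sequence of solutions with displacements \<open>t / k + o(1 / k)\<close> is chosen in a direction \<open>t\<close> where the
  lowest-degree form of \<open>F\<close>, expanded at the base pair, does not vanish. Far enough in the sequence
  \<open>F\<close> is nonzero and the perturbation is small enough for the motions to be defined and the points
  to stay apart.
\<close>
lemma exists_good_pair_avoiding_polynomial: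
  assumes d: "d \<ge> 2" and v: "v \<in> hcoords (2 * d + 1)" "w \<in> hcoords (2 * d + 1)"
    and F: "cmpoly_eval F (case_sum v w) \<noteq> 0"
  shows "\<exists>v' w'. proj_class v' \<in> Rat d \<and> proj_class w' \<in> Rat d \<and> cmpoly_eval F (case_sum v' w') \<noteq> 0 \<and>
    (infinite (Preper d (proj_class v') \<inter> Preper d (proj_class w')) \<or>
     card (Preper d (proj_class v') \<inter> Preper d (proj_class w')) \<ge> 4 * d - 1)"
proof -
  define c where "c = cis (2 * pi / real (d\<^sup>2))"
  have c0: "c \<noteq> 0" and c1: "norm c = 1" by (auto simp: c_def)
  have cN: "c ^ (d ^ 4) = 1"
  proof -
    have "c ^ (d\<^sup>2) = 1" unfolding c_def Complex.DeMoivre using d by simp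
    moreover have "d ^ 4 = d\<^sup>2 * d\<^sup>2" by (simp flip: power_add)
    ultimately show ?thesis by (simp only: power_mult power_one)
  qed
  obtain \<rho> C \<xi> where \<rho>: "\<rho> > 0" and C: "C \<ge> 0" and \<xi>: "circle_motion d \<rho> C \<xi>"
    using exists_circle_motion[OF d] by blast
  obtain J :: "(int + int) set" and z b where J: "finite J" "card J = 4 * d - 1"
    and z: "\<And>i. i \<in> J \<Longrightarrow> z i ^ (d ^ 4) = 1"
    and dual: "\<And>i l. i \<in> J \<Longrightarrow> l \<in> J \<Longrightarrow> gap_velocity d c (b l) (z i) = (if i = l then 1 else 0)"
    using exists_dual_points[OF d c_def] by blast
  have z1: "norm (z i) = 1" if "i \<in> J" for i
  proof -
    have "norm (z i) ^ (d ^ 4) = 1" using z[OF that] by (metis norm_power norm_one)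
    then show ?thesis using d by (intro power_eq_imp_eq_base[of "norm (z i)" "d ^ 4" 1]) auto
  qed
  define H where "H q = cmpoly_eval F (pair_coords d c q)" for q
  have H: "H \<in> polyfuns"
    unfolding H_def[abs_def] by (intro polyfuns_substitute[OF polyfuns_cmpoly_eval] pair_coords_polyfun)
  obtain t1 where "pair_coords d c t1 = case_sum v w" by (rule pair_coords_surj[OF v c0])
  then have "H t1 \<noteq> 0" using F by (simp add: H_def)
  then obtain G t0 where G: "G \<in> polyfuns" "G t0 \<noteq> 0" and
    lead: "\<And>t (T :: nat \<Rightarrow> nat + nat \<Rightarrow> complex) s. \<lbrakk>G t \<noteq> 0; \<And>i. (\<lambda>n. T n i) \<longlonglongrightarrow> t i; s \<longlonglongrightarrow> 0; \<And>n. s n \<noteq> 0\<rbrakk> \<Longrightarrow>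
       \<forall>\<^sub>F n in sequentially. H (\<lambda>i. s n * T n i) \<noteq> 0"
    using polyfuns_leading_form[OF H] by blast
  have "\<exists>t m. G t \<noteq> 0 \<and> (\<forall>i\<in>J. gap_velocity d c t (z i) = 2 * of_real pi * \<i> * of_int (m i))"
    by (rule polyfuns_nonzero_at_lattice_point[OF G J(1), where v = b and D = "\<lambda>i t. gap_velocity d c t (z i)"])
      (simp_all add: gap_velocity_add gap_velocity_scale dual)
  then obtain t m where t: "G t \<noteq> 0" "\<And>i. i \<in> J \<Longrightarrow> gap_velocity d c t (z i) = 2 * of_real pi * \<i> * of_int (m i)"
    by blast
  define idx :: "(nat + nat) set" where "idx = Inl ` {..2 * d + 1} \<union> Inr ` {..2 * d + 1}"
  have pb: "pair_bounded d r q \<longleftrightarrow> (\<forall>j\<in>idx. norm (q j) \<le> r)" for r q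
    unfolding pair_bounded_def bounded_by_def idx_def by auto
  define approx where "approx n k q \<longleftrightarrow> k \<ge> Suc n \<and>
      pair_bounded d (1 / real (Suc n) / real k) (\<lambda>j. q j - t j / of_nat k) \<and>
      (\<forall>i\<in>J. gap \<xi> c q (z i) (cis (2 * pi * of_int (m i) / real k)) = 0)" for n k q
  have "\<exists>k q. approx n k q" for n
  proof -
    have "\<forall>\<^sub>F k in sequentially. k \<ge> Suc n \<and> (\<exists>q. pair_bounded d (1 / real (Suc n) / real k) (\<lambda>j. q j - t j / of_nat k) \<and>
      (\<forall>i\<in>J. gap \<xi> c q (z i) (cis (2 * pi * of_int (m i) / real k)) = 0))"
      by (intro eventually_conj eventually_ge_at_top shadowing_along_direction[OF d \<rho> C \<xi> c1 J(1) z1 dual t(2)]) auto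
    from eventually_happens'[OF _ this] show ?thesis unfolding approx_def by auto
  qed
  then obtain k q where "\<And>n. approx n (k n) (q n)" by metis
  then have k: "\<And>n. k n \<ge> Suc n"
    and q: "\<And>n. pair_bounded d (1 / real (Suc n) / real (k n)) (\<lambda>j. q n j - t j / of_nat (k n))"
    and gap: "\<And>n i. i \<in> J \<Longrightarrow> gap \<xi> c (q n) (z i) (cis (2 * pi * of_int (m i) / real (k n))) = 0"
    unfolding approx_def by blast+
  have k0: "k n > 0" for n using k[of n] by simp
  \<comment> \<open>\<open>H\<close> depends only on the entries in \<open>idx\<close>, the ones that \<open>pair_bounded\<close> controls\<close>
  define T where "T n j = (if j \<in> idx then of_nat (k n) * q n j else t j)" for n j
  define s :: "nat \<Rightarrow> complex" where "s n = 1 / of_nat (k n)" for n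
  have inv_lim: "(\<lambda>n. a / real (Suc n)) \<longlonglongrightarrow> 0" for a
    using LIMSEQ_Suc[OF lim_const_over_n[of a]] by simp
  have T_lim: "(\<lambda>n. T n j) \<longlonglongrightarrow> t j" for j
  proof (cases "j \<in> idx")
    case True
    have "norm (T n j - t j) \<le> 1 / real (Suc n)" for n
    proof -
      have "norm (q n j - t j / of_nat (k n)) \<le> 1 / real (Suc n) / real (k n)"
        using q[of n] True unfolding pb by blast
      then have "real (k n) * norm (q n j - t j / of_nat (k n)) \<le> real (k n) * (1 / real (Suc n) / real (k n))"
        by (rule mult_left_mono) simp
      also have "real (k n) * norm (q n j - t j / of_nat (k n)) = norm (of_nat (k n) * (q n j - t j / of_nat (k n)))"
        by (simp add: norm_mult)
      also have "of_nat (k n) * (q n j - t j / of_nat (k n)) = T n j - t j"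
        using k0[of n] True by (simp add: T_def right_diff_distrib)
      finally show ?thesis using k0[of n] by simp
    qed
    then have "(\<lambda>n. T n j - t j) \<longlonglongrightarrow> 0"
      by (intro Lim_null_comparison[OF always_eventually inv_lim[of 1]]) simp
    then show ?thesis by (simp add: LIM_zero_iff)
  next
    case False
    then show ?thesis by (simp add: T_def)
  qed
  have s_lim: "s \<longlonglongrightarrow> 0"
  proof (rule Lim_null_comparison[OF always_eventually inv_lim[of 1]], rule allI)
    fix n
    show "norm (s n) \<le> 1 / real (Suc n)"
      unfolding s_def using k[of n] by (simp add: norm_divide frac_le)
  qed
  have ev_H: "\<forall>\<^sub>F n in sequentially. H (\<lambda>i. s n * T n i) \<noteq> 0"
    by (rule lead[OF t(1) T_lim s_lim]) (use k0 in \<open>auto simp: s_def\<close>)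
  have H_eq: "H (\<lambda>i. s n * T n i) = H (q n)" for n
    unfolding H_def
    by (intro arg_cong[of _ _ "cmpoly_eval F"] pair_coords_cong) (use k0[of n] in \<open>auto simp: s_def T_def idx_def\<close>)
  have "\<exists>e>0. \<forall>i\<in>J. \<forall>l\<in>J. i \<noteq> l \<longrightarrow> e \<le> norm (z i - z l)"
  proof -
    define A where "A = insert 1 ((\<lambda>(i, l). norm (z i - z l)) ` {(i, l). i \<in> J \<and> l \<in> J \<and> i \<noteq> l})"
    have "{(i, l). i \<in> J \<and> l \<in> J \<and> i \<noteq> l} \<subseteq> J \<times> J" by auto
    then have A: "finite A" "A \<noteq> {}" using J(1) finite_subset unfolding A_def by blast+
    have "z i \<noteq> z l" if "i \<in> J" "l \<in> J" "i \<noteq> l" for i l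
      using dual[of i i] dual[of l i] that by auto
    then have "\<forall>a\<in>A. a > 0" by (auto simp: A_def)
    then have "Min A > 0" using A by simp
    moreover have "Min A \<le> norm (z i - z l)" if "i \<in> J" "l \<in> J" "i \<noteq> l" for i l
      using A(1) that by (intro Min_le) (auto simp: A_def)
    ultimately show ?thesis by blast
  qed
  then obtain e where e: "e > 0" "\<And>i l. i \<in> J \<Longrightarrow> l \<in> J \<Longrightarrow> i \<noteq> l \<Longrightarrow> e \<le> norm (z i - z l)" by blast
  define r where "r = min \<rho> (min (1 / (2 * (real d + 1))) (e / (4 * (C + 1))))"
  have r: "r > 0" "r \<le> \<rho>" "(real d + 1) * r < 1" "2 * (C * r) < e"
  proof -
    show "r > 0" "r \<le> \<rho>" using \<rho> e C by (auto simp: r_def)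
    have "(real d + 1) * r \<le> (real d + 1) * (1 / (2 * (real d + 1)))" by (intro mult_left_mono) (auto simp: r_def)
    also have "\<dots> = 1 / 2" by (simp add: field_simps)
    finally show "(real d + 1) * r < 1" by simp
    have "2 * (C * r) \<le> 2 * ((C + 1) * r)" using \<open>r > 0\<close> by (simp add: algebra_simps)
    also have "\<dots> \<le> 2 * ((C + 1) * (e / (4 * (C + 1))))" using C by (intro mult_left_mono) (auto simp: r_def)
    also have "\<dots> = e / 2" using C by (simp add: field_simps)
    also have "\<dots> < e" using e(1) by simp
    finally show "2 * (C * r) < e" .
  qed
  have ev_r: "\<forall>\<^sub>F n in sequentially. pair_bounded d r (q n)"
  proof -
    have "(\<lambda>n. s n * T n j) \<longlonglongrightarrow> 0" for j using tendsto_mult[OF s_lim T_lim[of j]] by simp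
    then have "\<forall>\<^sub>F n in sequentially. norm (s n * T n j) < r" for j
      using order_tendstoD(2)[OF tendsto_norm_zero r(1)] by blast
    moreover have "finite idx" by (simp add: idx_def)
    ultimately have "\<forall>\<^sub>F n in sequentially. \<forall>j\<in>idx. norm (s n * T n j) < r" by (simp add: eventually_ball_finite)
    then show ?thesis
    proof (rule eventually_mono)
      fix n assume *: "\<forall>j\<in>idx. norm (s n * T n j) < r"
      have "s n * T n j = q n j" if "j \<in> idx" for j using that k0[of n] by (simp add: s_def T_def)
      then show "pair_bounded d r (q n)" unfolding pb using * by (simp add: less_imp_le)
    qed
  qed
  obtain n where n: "H (q n) \<noteq> 0" "pair_bounded d r (q n)"
    using eventually_happens'[OF _ eventually_conj[OF ev_H ev_r]] unfolding H_eq by auto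
  define v' where "v' = coeff_vector d (q n \<circ> Inl)"
  define w' where "w' = rotate_coeffs d c (coeff_vector d (q n \<circ> Inr))"
  have sep: "2 * (C * r) < norm (z i - z l)" if "i \<in> J" "l \<in> J" "i \<noteq> l" for i l
    using e(2)[OF that] r(4) by linarith
  have good: "proj_class v' \<in> Rat d" "proj_class w' \<in> Rat d"
    "infinite (Preper d (proj_class v') \<inter> Preper d (proj_class w')) \<or>
     card (Preper d (proj_class v') \<inter> Preper d (proj_class w')) \<ge> card J"
    unfolding v'_def w'_def
    by (rule many_common_preperiodic_points[where z = z and m = m, OF d \<xi> r(2,3) n(2) cN k0[of n] J(1)];
        use z sep gap[of _ n] in blast)+
  have "cmpoly_eval F (case_sum v' w') \<noteq> 0" using n(1) by (simp add: H_def pair_coords_def v'_def w'_def)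
  then show ?thesis using good unfolding J(2) by blast
qed

lemma proj_space_class:
  assumes "p \<in> proj_space n" "v \<in> p"
  shows "v \<in> hcoords n"
proof -
  obtain x where x: "p = {(\<lambda>i. c * x i) | c. c \<noteq> 0}" "x \<in> hcoords n"
    using assms(1) unfolding proj_space_eq by blast
  then obtain c where "v = (\<lambda>i. c * x i)" "c \<noteq> 0" using assms(2) by blast
  then show ?thesis using hcoords_scale x(2) by simp
qed

theorem corollary1p6:
  fixes d :: nat
  assumes "d \<ge> 2"
  shows "(subtopology (zariski (2 * d + 1) (2 * d + 1)) (Rat d \<times> Rat d)) closure_of
           {(f, g) \<in> Rat d \<times> Rat d.
              infinite (Preper d f \<inter> Preper d g) \<or> card (Preper d f \<inter> Preper d g) \<ge> 4 * d - 1}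
         = Rat d \<times> Rat d"
    (is "?X closure_of ?S = _")
proof
  have Rat_proj: "Rat d \<subseteq> proj_space (2 * d + 1)" by (auto simp: Rat_def)
  have top: "topspace ?X = Rat d \<times> Rat d"
    using Rat_proj by (auto simp: topspace_subtopology topspace_zariski)
  show "?X closure_of ?S \<subseteq> Rat d \<times> Rat d"
    using closure_of_subset_topspace[of ?X ?S] unfolding top .
  show "Rat d \<times> Rat d \<subseteq> ?X closure_of ?S"
  proof
    fix x assume x: "x \<in> Rat d \<times> Rat d"
    have "\<exists>y. y \<in> ?S \<and> y \<in> U" if U: "x \<in> U" "openin ?X U" for U
    proof -
      obtain V where V: "openin (zariski (2 * d + 1) (2 * d + 1)) V" "U = V \<inter> (Rat d \<times> Rat d)"
        using U(2) unfolding openin_subtopology by blast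
      obtain A where A: "A \<subseteq> bihom_polys (2 * d + 1) (2 * d + 1)"
        "V = proj_space (2 * d + 1) \<times> proj_space (2 * d + 1) - zero_locus (2 * d + 1) (2 * d + 1) A"
        using V(1) unfolding openin_zariski by blast
      obtain f g where fg: "x = (f, g)" "f \<in> proj_space (2 * d + 1)" "g \<in> proj_space (2 * d + 1)"
        using x Rat_proj by auto
      have "(f, g) \<notin> zero_locus (2 * d + 1) (2 * d + 1) A" using U(1) unfolding V(2) A(2) fg(1) by simp
      then obtain F v w where F: "F \<in> A" "v \<in> f" "w \<in> g" "cmpoly_eval F (case_sum v w) \<noteq> 0"
        using fg(2,3) unfolding zero_locus_def by auto
      obtain v' w' where vw: "proj_class v' \<in> Rat d" "proj_class w' \<in> Rat d" "cmpoly_eval F (case_sum v' w') \<noteq> 0"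
        "infinite (Preper d (proj_class v') \<inter> Preper d (proj_class w')) \<or>
         card (Preper d (proj_class v') \<inter> Preper d (proj_class w')) \<ge> 4 * d - 1"
        using exists_good_pair_avoiding_polynomial[OF assms proj_space_class[OF fg(2) F(2)] proj_space_class[OF fg(3) F(3)] F(4)]
        by blast
      have "(proj_class v', proj_class w') \<notin> zero_locus (2 * d + 1) (2 * d + 1) A"
        using F(1) vw(3) self_in_proj_class[of v'] self_in_proj_class[of w'] unfolding zero_locus_def by auto
      then have "(proj_class v', proj_class w') \<in> U"
        using vw(1,2) Rat_proj unfolding V(2) A(2) by auto
      moreover have "(proj_class v', proj_class w') \<in> ?S" using vw by simp
      ultimately show ?thesis by blast
    qed
    then show "x \<in> ?X closure_of ?S" using x unfolding in_closure_of top by simp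
  qed
qed

end
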